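(* Suppose $V,F\in C^2(\mathbb{R}^d;\mathbb{R})$ and $\nabla V,\nabla F$ are globally Lipschitz continuous. Let $T>0$. For any $\mathbf{x}\in\mathfrak{X}$, the probability measures $(\nu^{\mathbf{x},\sigma})_{\sigma>0}$ induced on $C([0,T];\mathbb{R}^d)$ by the process $(\boldsymbol{X}^{\mathbf{x},\sigma}_t)_{0\le t\le T}$ (the generalized self-interacting diffusion with initial condition $\mathbf{x}$ defined in the context) satisfy a Large Deviation Principle (in the normalization of the context) with the good rate function $$I_T^{\mathbf{x}}(f):=\frac14\int_0^T\Big|\dot f(t)+\nabla V(f(t))+\frac{\mathrm{T}\mathbf{x}}{\mathrm{T}\mathbf{x}+t}\nabla F*\mathrm{M}\mathbf{x}(f(t))+\frac{1}{\mathrm{T}\mathbf{x}+t}\int_0^t\nabla F(f(t)-f(s))\,ds\Big|^2dt$$ for $f\in H_1^{\mathrm{P}\mathbf{x}}$, and $I_T^{\mathbf{x}}(f):=\infty$ otherwise, where for $x\in\mathbb{R}^d$, $H_1^x:=\{x+\int_0^{\cdot}g(s)\,ds: g\in L_2([0,T];\mathbb{R}^d)\}$.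
   Context: Standing assumptions: $\nabla F(0)=0$, $F(0)=0$. $W$ is a standard $d$-dimensional Brownian motion. $\nabla F*\mu(x)=\int\nabla F(x-z)\mu(dz)$. $\mathcal{P}_2(\mathbb{R}^d)$: probability measures with finite second moment, with the Wasserstein-2 distance. $C([0,T];\mathbb{R}^d)$ carries the sup norm. $\mathfrak{X}=[0,\infty]\times\mathcal{P}_2(\mathbb{R}^d)\times\mathbb{R}^d$; for $\mathbf{x}\in\mathfrak{X}$ write $\mathbf{x}=(\mathrm{T}\mathbf{x},\mathrm{M}\mathbf{x},\mathrm{P}\mathbf{x})$ for its three coordinates. Generalized self-interacting diffusion: for $\mathbf{x}\in\mathfrak{X}$ and $\sigma\ge0$, $\boldsymbol{X}^{\mathbf{x},\sigma}$ is the unique strong solution of $$d\boldsymbol{X}_t=-\nabla V(\boldsymbol{X}_t)dt-\nabla F*\boldsymbol{\mu}_t(\boldsymbol{X}_t)dt+\sigma dW_t,\quad \boldsymbol{\mu}_t=\frac{\mathrm{T}\mathbf{x}}{\mathrm{T}\mathbf{x}+t}\mathrm{M}\mathbf{x}+\frac{1}{\mathrm{T}\mathbf{x}+t}\int_0^t\delta_{\boldsymbol{X}_s}ds,\quad \boldsymbol{X}_0=\mathrm{P}\mathbf{x}\ \text{a.s.}$$ When $\mathrm{T}\mathbf{x}=\infty$ one uses $\frac{\mathrm{T}\mathbf{x}}{\mathrm{T}\mathbf{x}+t}=1$ and $\frac1{\mathrm{T}\mathbf{x}+t}=0$ (so $\boldsymbol{\mu}_t=\mathrm{M}\mathbf{x}$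 for all $t$), both in the equation and in the rate function; when $\mathrm{T}\mathbf{x}=0$ the formulas are used for $t>0$. Large Deviation Principle: a family of measures $(\nu^\sigma)_{\sigma>0}$ on the Borel sets of a Banach space $B$ satisfies the LDP with good rate function $I$ if for every Borel set $\Gamma$, $$-\inf_{x\in\mathring\Gamma}I(x)\le\liminf_{\sigma\to0}\frac{\sigma^2}{2}\log\nu^\sigma(\Gamma)\le\limsup_{\sigma\to0}\frac{\sigma^2}{2}\log\nu^\sigma(\Gamma)\le-\inf_{x\in\overline\Gamma}I(x),$$ where $I:B\to[0,\infty]$ is lower semicontinuous and its level sets $\{I\le\alpha\}$, $0\le\alpha<\infty$, are compact. *)

theory Defs
  imports "HOL-Probability.Probability"
begin

section \<open>Smoothness\<close>

definition C2 :: "('a::real_normed_vector \<Rightarrow> 'b::real_normed_vector) \<Rightarrow> bool" where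
  "C2 f \<longleftrightarrow> (\<exists>(f' :: 'a \<Rightarrow> 'a \<Rightarrow>\<^sub>L 'b) (f'' :: 'a \<Rightarrow> 'a \<Rightarrow>\<^sub>L 'a \<Rightarrow>\<^sub>L 'b).
     (\<forall>x. (f has_derivative blinfun_apply (f' x)) (at x)) \<and>
     (\<forall>x. (f' has_derivative blinfun_apply (f'' x)) (at x)) \<and>
     continuous_on UNIV f'')"

definition grad :: "('a::euclidean_space \<Rightarrow> real) \<Rightarrow> 'a \<Rightarrow> 'a" where
  "grad f x = (THE D. GDERIV f x :> D)"

definition convolve :: "('a::euclidean_space \<Rightarrow> 'a) \<Rightarrow> 'a measure \<Rightarrow> 'a \<Rightarrow> 'a" where
  "convolve G \<mu> x = (\<integral>z. G (x - z) \<partial>\<mu>)"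

section \<open>Brownian motion\<close>

text \<open>The product over \<^term>\<open>Basis\<close> is the density of the centred Gaussian law with covariance
  \<open>t - s\<close> times the identity.\<close>

definition brownian_motion :: "'w measure \<Rightarrow> (real \<Rightarrow> 'w \<Rightarrow> 'a::euclidean_space) \<Rightarrow> bool" where
  "brownian_motion M W \<longleftrightarrow>
     prob_space M \<and>
     (\<forall>t\<ge>0. W t \<in> borel_measurable M) \<and>
     (AE \<omega> in M. W 0 \<omega> = 0) \<and>
     (AE \<omega> in M. continuous_on {0..} (\<lambda>t. W t \<omega>)) \<and>
     (\<forall>s t. 0 \<le> s \<and> s < t \<longrightarrow>
        distributed M lborel (\<lambda>\<omega>. W t \<omega> - W s \<omega>)
          (\<lambda>y. ennreal (\<Prod>b\<in>Basis. normal_density 0 (sqrt (t - s)) (y \<bullet> b)))) \<and>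
     (\<forall>(n::nat) (\<tau> :: nat \<Rightarrow> real). 0 \<le> \<tau> 0 \<and> (\<forall>i<n. \<tau> i \<le> \<tau> (Suc i)) \<longrightarrow>
        prob_space.indep_vars M (\<lambda>_. borel) (\<lambda>i \<omega>. W (\<tau> (Suc i)) \<omega> - W (\<tau> i) \<omega>) {..<n})"

text \<open>The natural filtration of \<open>W\<close>, augmented by the null sets of \<open>M\<close>.\<close>

definition brownian_filtration ::
    "'w measure \<Rightarrow> (real \<Rightarrow> 'w \<Rightarrow> 'a::euclidean_space) \<Rightarrow> real \<Rightarrow> 'w measure" where
  "brownian_filtration M W t =
     sigma (space M) ({W s -` A \<inter> space M |s A. 0 \<le> s \<and> s \<le> t \<and> A \<in> sets borel} \<union> null_sets M)"

section \<open>Generalized self-interacting diffusion\<close>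

definition P2 :: "'a::euclidean_space measure set" where
  "P2 = {\<mu>. prob_space \<mu> \<and> sets \<mu> = sets borel \<and> integrable \<mu> (\<lambda>z. (norm z)\<^sup>2)}"

type_synonym 'a init = "ennreal \<times> 'a measure \<times> 'a"

definition XX :: "'a::euclidean_space init set" where
  "XX = UNIV \<times> P2 \<times> UNIV"

definition Tc :: "'a init \<Rightarrow> ennreal" where "Tc x = fst x"
definition Mc :: "'a init \<Rightarrow> 'a measure" where "Mc x = fst (snd x)"
definition Pc :: "'a init \<Rightarrow> 'a" where "Pc x = snd (snd x)"

text \<open>The coefficients \<open>T/(T+t)\<close> and \<open>1/(T+t)\<close>, equal to \<open>1\<close> and \<open>0\<close> for infinite \<open>T\<close>.
  For \<open>T = t = 0\<close> both are \<open>0\<close> (division by zero); this concerns a single time only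
  and does not affect the time integrals below.\<close>

definition w_init :: "ennreal \<Rightarrow> real \<Rightarrow> real" where
  "w_init T t = (if T = \<infinity> then 1 else enn2real T / (enn2real T + t))"

definition w_occ :: "ennreal \<Rightarrow> real \<Rightarrow> real" where
  "w_occ T t = (if T = \<infinity> then 0 else 1 / (enn2real T + t))"

definition interaction_measure ::
    "'a::euclidean_space init \<Rightarrow> (real \<Rightarrow> 'a) \<Rightarrow> real \<Rightarrow> 'a measure" where
  "interaction_measure x p t = measure_of UNIV (sets borel)
     (\<lambda>A. ennreal (w_init (Tc x) t) * emeasure (Mc x) A +
          ennreal (w_occ (Tc x) t) * (\<integral>\<^sup>+s\<in>{0..t}. emeasure (return borel (p s)) A \<partial>lborel))"

definition drift ::
    "('a::euclidean_space \<Rightarrow> real) \<Rightarrow> ('a \<Rightarrow> real) \<Rightarrow> 'a init \<Rightarrow> (real \<Rightarrow> 'a) \<Rightarrow> real \<Rightarrow> 'a" where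
  "drift V F x p t =
     - grad V (p t) - convolve (grad F) (interaction_measure x p t) (p t)"

text \<open>As the noise is additive, the stochastic integral in the equation is \<open>\<sigma> W\<^sub>t\<close>.\<close>

definition strong_solution ::
    "('a::euclidean_space \<Rightarrow> real) \<Rightarrow> ('a \<Rightarrow> real) \<Rightarrow> 'a init \<Rightarrow> real \<Rightarrow>
     'w measure \<Rightarrow> (real \<Rightarrow> 'w \<Rightarrow> 'a) \<Rightarrow> (real \<Rightarrow> 'w \<Rightarrow> 'a) \<Rightarrow> bool" where
  "strong_solution V F x \<sigma> M W X \<longleftrightarrow>
     (\<forall>t\<ge>0. X t \<in> borel_measurable (brownian_filtration M W t)) \<and>
     (\<forall>\<omega>\<in>space M. continuous_on {0..} (\<lambda>t. X t \<omega>)) \<and>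
     (AE \<omega> in M. X 0 \<omega> = Pc x) \<and>
     (AE \<omega> in M. \<forall>t\<ge>0.
        set_integrable lborel {0..t} (drift V F x (\<lambda>s. X s \<omega>)) \<and>
        X t \<omega> = X 0 \<omega> + (LINT s:{0..t}|lborel. drift V F x (\<lambda>s. X s \<omega>) s) + \<sigma> *\<^sub>R W t \<omega>)"

section \<open>Path space and large deviations\<close>

text \<open>\<open>C([0,T])\<close> with the sup metric; its points are extensional functions on \<open>{0..T}\<close>.\<close>

definition path_space :: "real \<Rightarrow> (real \<Rightarrow> 'a::euclidean_space) topology" where
  "path_space T = mtopology_of (cfunspace (top_of_set {0..T}) euclidean_metric)"

definition borel_of :: "'b topology \<Rightarrow> 'b measure" where
  "borel_of B = sigma (topspace B) {U. openin B U}"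

definition path_law ::
    "real \<Rightarrow> 'w measure \<Rightarrow> (real \<Rightarrow> 'w \<Rightarrow> 'a::euclidean_space) \<Rightarrow> (real \<Rightarrow> 'a) measure" where
  "path_law T M X = distr M (borel_of (path_space T)) (\<lambda>\<omega>. \<lambda>t\<in>{0..T}. X t \<omega>)"

definition ln_ennreal :: "ennreal \<Rightarrow> ereal" where
  "ln_ennreal p = (if p = 0 then -\<infinity> else if p = \<infinity> then \<infinity> else ereal (ln (enn2real p)))"

definition good_rate_function :: "'b topology \<Rightarrow> ('b \<Rightarrow> ennreal) \<Rightarrow> bool" where
  "good_rate_function B I \<longleftrightarrow>
     (\<forall>\<alpha>. openin B {y \<in> topspace B. \<alpha> < I y}) \<and>
     (\<forall>\<alpha><\<infinity>. compactin B {y \<in> topspace B. I y \<le> \<alpha>})"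

definition LDP :: "'b topology \<Rightarrow> (real \<Rightarrow> 'b measure) \<Rightarrow> ('b \<Rightarrow> ennreal) \<Rightarrow> bool" where
  "LDP B \<nu> I \<longleftrightarrow>
     (\<forall>\<sigma>>0. sets (\<nu> \<sigma>) = sets (borel_of B)) \<and>
     good_rate_function B I \<and>
     (\<forall>\<Gamma>\<in>sets (borel_of B).
        - enn2ereal (INF y\<in>B interior_of \<Gamma>. I y)
          \<le> Liminf (at_right 0) (\<lambda>\<sigma>. ereal (\<sigma>\<^sup>2 / 2) * ln_ennreal (emeasure (\<nu> \<sigma>) \<Gamma>)) \<and>
        Liminf (at_right 0) (\<lambda>\<sigma>. ereal (\<sigma>\<^sup>2 / 2) * ln_ennreal (emeasure (\<nu> \<sigma>) \<Gamma>))
          \<le> Limsup (at_right 0) (\<lambda>\<sigma>. ereal (\<sigma>\<^sup>2 / 2) * ln_ennreal (emeasure (\<nu> \<sigma>) \<Gamma>)) \<and>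
        Limsup (at_right 0) (\<lambda>\<sigma>. ereal (\<sigma>\<^sup>2 / 2) * ln_ennreal (emeasure (\<nu> \<sigma>) \<Gamma>))
          \<le> - enn2ereal (INF y\<in>B closure_of \<Gamma>. I y))"

section \<open>The rate function\<close>

definition L2_fun :: "real \<Rightarrow> (real \<Rightarrow> 'a::euclidean_space) set" where
  "L2_fun T = {g. set_borel_measurable lborel {0..T} g \<and>
                  set_integrable lborel {0..T} (\<lambda>s. (norm (g s))\<^sup>2)}"

definition primitive :: "real \<Rightarrow> 'a::euclidean_space \<Rightarrow> (real \<Rightarrow> 'a) \<Rightarrow> real \<Rightarrow> 'a" where
  "primitive T y g = (\<lambda>t\<in>{0..T}. y + (LINT s:{0..t}|lborel. g s))"

definition H1 :: "real \<Rightarrow> 'a::euclidean_space \<Rightarrow> (real \<Rightarrow> 'a) set" where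
  "H1 T y = {primitive T y g |g. g \<in> L2_fun T}"

text \<open>The derivative of a path in \<^term>\<open>H1 T y\<close>: the density \<open>g\<close> of its definition,
  which is unique up to a null set of times.\<close>

definition velocity :: "real \<Rightarrow> (real \<Rightarrow> 'a::euclidean_space) \<Rightarrow> real \<Rightarrow> 'a" where
  "velocity T f = (SOME g. g \<in> L2_fun T \<and> f = primitive T (f 0) g)"

definition rate_function ::
    "('a::euclidean_space \<Rightarrow> real) \<Rightarrow> ('a \<Rightarrow> real) \<Rightarrow> real \<Rightarrow> 'a init \<Rightarrow> (real \<Rightarrow> 'a) \<Rightarrow> ennreal" where
  "rate_function V F T x f =
     (if f \<in> H1 T (Pc x) then
        ennreal (1 / 4) * (\<integral>\<^sup>+t\<in>{0..T}. ennreal ((norm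
          (velocity T f t + grad V (f t)
           + w_init (Tc x) t *\<^sub>R convolve (grad F) (Mc x) (f t)
           + w_occ (Tc x) t *\<^sub>R (LINT s:{0..t}|lborel. grad F (f t - f s))))\<^sup>2) \<partial>lborel)
      else \<infinity>)"

end

(* Let Psi f (t) = f(t) - f_0 - int_0^t b(f, s) ds, where f_0 is the initial point and b the drift seen as a
   functional of the path (below: noise and field). Since b is Lipschitz in the sup norm, Psi is injective with
   Lipschitz inverse on its range (Gronwall), the diffusion X satisfies Psi X = sigma W, and the rate function is
   1/4 int |(Psi f)'|^2. So the large deviations of sigma W (Schilder's theorem) are transported by Psi, and no
   existence theorem for the equation is needed.
   Schilder's theorem is obtained without the Cameron-Martin formula, from the dyadic increments of W.
   The energies S_m(w) = sum_i |w(t_{i+1}) - w(t_i)|^2 / (T/2^m) increase to int |w'|^2 (infinite unless w lies in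
   H1), so the level sets are compact by Arzela-Ascoli. Upper bound: sigma W is close to its interpolation on the
   grid m except on an event of probability exp(-c 2^m / sigma^2) (chaining), and S_m(W) has Gaussian exponential
   moments. Lower bound: the increments on the grid are independent Gaussian vectors, so the probability that all
   of sigma times them are close to those of w is bounded below directly. *)
theory Submission
  imports Defs "HOL-Complex_Analysis.Great_Picard"
begin


section \<open>The path space\<close>

text \<open>Two obstacles shape the estimates. The drift contains the factor 1/(S + t), where S is
  the time coordinate of the initial condition; it is singular at t = 0 when S = 0. It always
  multiplies an integral over {0..t}, which cancels the singularity, so the drift is Lipschitz in
  the sup norm uniformly in time. Moreover, the interpolation of \<sigma> W need not be Psi of any
  path. The upper bound therefore separates a closed set from all paths of bounded energy, in the
  range of Psi or not: if Psi f_n approaches such paths, the Lipschitz inverse makes a subsequence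
  of f_n Cauchy. The lower bound compares Psi f, for one f of finite rate, with Psi X. Energies also
  remove the a.e. defined velocity: the rate of f is at most a exactly when f starts at the
  prescribed point and all energies of Psi f are at most 4 a. For a Gaussian vector y of variance s,
  exp(\<theta> |y|^2 / s) is integrable only for \<theta> < 1/2. Hence the upper bound loses a
  factor 1 - \<eta>, which tends to 1 after \<sigma> has gone to 0 on a fixed grid.\<close>

definition paths :: "real \<Rightarrow> (real \<Rightarrow> 'a::euclidean_space) set" where
  "paths T = {f \<in> extensional {0..T}. continuous_on {0..T} f}"

text \<open>The boundedness demanded by \<open>cfunspace\<close> is automatic, the interval being
  compact.\<close>

lemma mspace_cfunspace_interval:
  "mspace (cfunspace (top_of_set {0..T}) (euclidean_metric :: 'a::euclidean_space metric)) = paths T"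
  by (subst compactin_mspace_cfunspace) (auto simp: paths_def compactin_subtopology)

lemma topspace_path_space [simp]: "topspace (path_space T) = paths T"
  by (simp add: path_space_def topspace_mtopology_of mspace_cfunspace_interval del: mspace_cfunspace)

lemma mdist_cfunspace_interval_le_iff:
  fixes f g :: "real \<Rightarrow> 'a::euclidean_space"
  assumes "0 < T" "f \<in> paths T" "g \<in> paths T"
  shows "mdist (cfunspace (top_of_set {0..T}) euclidean_metric) f g \<le> r
           \<longleftrightarrow> (\<forall>t\<in>{0..T}. dist (f t) (g t) \<le> r)"
  using assms
  by (subst cfunspace_mdist_le) (auto simp: mspace_cfunspace_interval simp del: mspace_cfunspace)

text \<open>Nonstrict inequalities are used because \<open>mdist f g \<le> r\<close> is a pointwise
  condition at once, whereas the strict version would involve attainment of the supremum. Later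
  arguments then handle pointwise distances only.\<close>

lemma openin_path_space_iff:
  fixes U :: "(real \<Rightarrow> 'a::euclidean_space) set"
  assumes "0 < T"
  shows "openin (path_space T) U \<longleftrightarrow> U \<subseteq> paths T \<and>
    (\<forall>f\<in>U. \<exists>r>0. \<forall>g\<in>paths T. (\<forall>t\<in>{0..T}. dist (f t) (g t) \<le> r) \<longrightarrow> g \<in> U)"
proof -
  let ?m = "cfunspace (top_of_set {0..T}) (euclidean_metric :: 'a metric)"
  interpret Metric_space "mspace ?m" "mdist ?m" by (rule Metric_space_mspace_mdist)
  have m: "mspace ?m = paths T" by (rule mspace_cfunspace_interval)
  have "(\<exists>r>0. mball f r \<subseteq> U) \<longleftrightarrow>
        (\<exists>r>0. \<forall>g\<in>paths T. (\<forall>t\<in>{0..T}. dist (f t) (g t) \<le> r) \<longrightarrow> g \<in> U)" (is "?L = ?R")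
    if f: "f \<in> paths T" for f
  proof
    assume ?L
    then obtain r where r: "r > 0" "mball f r \<subseteq> U" by blast
    show ?R
    proof (intro exI[of _ "r/2"] conjI ballI impI)
      fix g assume g: "g \<in> paths T" "\<forall>t\<in>{0..T}. dist (f t) (g t) \<le> r / 2"
      then have "mdist ?m f g \<le> r/2"
        using f assms by (subst mdist_cfunspace_interval_le_iff) auto
      then have "g \<in> mball f r" unfolding in_mball unfolding m using r(1) f g(1) by simp
      with r(2) show "g \<in> U" by blast
    qed (use r in auto)
  next
    assume ?R
    then obtain r where r: "r > 0"
      "\<And>g. g \<in> paths T \<Longrightarrow> (\<forall>t\<in>{0..T}. dist (f t) (g t) \<le> r) \<Longrightarrow> g \<in> U" by blast
    show ?L
    proof (intro exI[of _ r] conjI subsetI)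
      fix g assume "g \<in> mball f r"
      then have g: "g \<in> paths T" "mdist ?m f g \<le> r" unfolding in_mball unfolding m by simp_all
      then show "g \<in> U"
        using r(2)[OF g(1)] mdist_cfunspace_interval_le_iff[OF assms f g(1)] by blast
    qed (use r in auto)
  qed
  then show ?thesis
    unfolding path_space_def mtopology_of_def openin_mtopology unfolding m by blast
qed

text \<open>In a metric space sequential compactness suffices, and uniformly convergent subsequences
  are what the Arzela-Ascoli theorem produces.\<close>

lemma compactin_path_spaceI:
  fixes S :: "(real \<Rightarrow> 'a::euclidean_space) set"
  assumes "0 < T" "S \<subseteq> paths T"
    and "\<And>\<sigma>::nat \<Rightarrow> real \<Rightarrow> 'a. range \<sigma> \<subseteq> S \<Longrightarrow>
      \<exists>l\<in>S. \<exists>r. strict_mono r \<and> uniform_limit {0..T} (\<sigma> \<circ> r) l sequentially"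
  shows "compactin (path_space T) S"
proof -
  let ?m = "cfunspace (top_of_set {0..T}) (euclidean_metric :: 'a metric)"
  interpret Metric_space "mspace ?m" "mdist ?m" by (rule Metric_space_mspace_mdist)
  have m: "mspace ?m = paths T" by (rule mspace_cfunspace_interval)
  have "\<exists>l r. l \<in> S \<and> strict_mono r \<and> limitin mtopology (\<sigma> \<circ> r) l sequentially"
    if \<sigma>: "range \<sigma> \<subseteq> S" for \<sigma> :: "nat \<Rightarrow> real \<Rightarrow> 'a"
  proof -
    obtain l r where l: "l \<in> S" and r: "strict_mono r"
      and lim: "uniform_limit {0..T} (\<sigma> \<circ> r) l sequentially"
      using assms(3)[OF \<sigma>] by blast
    have "limitin mtopology (\<sigma> \<circ> r) l sequentially"
      unfolding limitin_metric
    proof (intro conjI allI impI)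
      show "l \<in> mspace ?m" using l assms(2) m by auto
      fix e :: real assume "0 < e"
      then have "\<forall>\<^sub>F n in sequentially. \<forall>t\<in>{0..T}. dist ((\<sigma> \<circ> r) n t) (l t) < e/2"
        using uniform_limitD[OF lim, of "e/2"] by simp
      then show "\<forall>\<^sub>F n in sequentially. (\<sigma> \<circ> r) n \<in> mspace ?m \<and> mdist ?m ((\<sigma> \<circ> r) n) l < e"
      proof eventually_elim
        case (elim n)
        have a: "(\<sigma> \<circ> r) n \<in> paths T" "l \<in> paths T" using l \<sigma> assms(2) by auto
        have "mdist ?m ((\<sigma> \<circ> r) n) l \<le> e/2"
          unfolding mdist_cfunspace_interval_le_iff[OF \<open>0 < T\<close> a]
          using elim by (auto intro: less_imp_le)
        then show ?case using a m \<open>0 < e\<close> by (auto simp del: mspace_cfunspace)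
      qed
    qed
    with l r show ?thesis by blast
  qed
  then show ?thesis
    unfolding path_space_def mtopology_of_def compactin_sequentially using assms(2) m by blast
qed

lemma compactin_path_space_imp_closedin:
  "compactin (path_space T) S \<Longrightarrow> closedin (path_space T) S"
  unfolding path_space_def mtopology_of_def
  by (rule compactin_imp_closedin[OF Metric_space.Hausdorff_space_mtopology[OF Metric_space_mspace_mdist]])

lemma space_borel_of [simp]: "space (borel_of B) = topspace B"
  by (simp add: borel_of_def space_measure_of_conv)

lemma sets_borel_of: "sets (borel_of B) = sigma_sets (topspace B) {U. openin B U}"
  unfolding borel_of_def by (rule sets_measure_of) (auto dest: openin_subset)

lemma openin_borel_of: "openin B U \<Longrightarrow> U \<in> sets (borel_of B)"
  by (auto simp: sets_borel_of)

lemma closedin_borel_of: "closedin B C \<Longrightarrow> C \<in> sets (borel_of B)"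
proof -
  assume C: "closedin B C"
  then have "topspace B - C \<in> sets (borel_of B)"
    by (intro openin_borel_of) (auto simp: closedin_def)
  then have "space (borel_of B) - (topspace B - C) \<in> sets (borel_of B)"
    by (rule sets.compl_sets)
  moreover have "topspace B - (topspace B - C) = C" using C closedin_subset by blast
  ultimately show ?thesis by simp
qed

section \<open>Approximation by values at finitely many times; measurability of path-valued
  maps\<close>

definition floor_time :: "real \<Rightarrow> nat \<Rightarrow> real \<Rightarrow> nat" where
  "floor_time T n t = nat \<lfloor>t * Suc n / T\<rfloor>"

lemma floor_time_bounds:
  fixes T :: real
  assumes "0 < T" "t \<in> {0..T}"
  shows "floor_time T n t \<le> Suc n" "\<bar>floor_time T n t * T / Suc n - t\<bar> \<le> T / Suc n"
    "floor_time T n t * T / Suc n \<in> {0..T}"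
proof -
  have 0: "0 \<le> t * Suc n / T" using assms by auto
  have "t * Suc n \<le> T * Suc n" using assms by (intro mult_right_mono) auto
  then have "t * Suc n / T \<le> Suc n" using assms by (simp add: divide_le_eq mult.commute)
  then show 1: "floor_time T n t \<le> Suc n"
    unfolding floor_time_def by linarith
  have f: "real (floor_time T n t) = of_int \<lfloor>t * Suc n / T\<rfloor>"
    unfolding floor_time_def using 0 by simp
  have "real (floor_time T n t) \<le> t * Suc n / T" "t * Suc n / T \<le> real (floor_time T n t) + 1"
    unfolding f by linarith+
  then have "floor_time T n t * T \<le> t * Suc n" "t * Suc n \<le> floor_time T n t * T + T"
    using assms by (simp_all add: field_simps del: of_nat_Suc)
  then have "floor_time T n t * T / Suc n \<le> t" "t \<le> (floor_time T n t * T + T) / Suc n"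
    by (simp_all add: divide_le_eq le_divide_eq del: of_nat_Suc)
  then have "floor_time T n t * T / Suc n \<le> t" "t \<le> floor_time T n t * T / Suc n + T / Suc n"
    by (simp_all only: add_divide_distrib)
  then show "\<bar>floor_time T n t * T / Suc n - t\<bar> \<le> T / Suc n"
    using abs_leI by (simp add: abs_le_iff del: of_nat_Suc)
  have "real (floor_time T n t) * T \<le> Suc n * T"
    using 1 assms by (intro mult_right_mono) linarith+
  then show "floor_time T n t * T / Suc n \<in> {0..T}"
    using assms by (auto simp: field_simps)
qed

lemma floor_time_uniform:
  fixes f :: "real \<Rightarrow> 'a::euclidean_space" and T :: real
  assumes "0 < T" "continuous_on {0..T} f" "0 < e"
  shows "\<forall>\<^sub>F n in sequentially. \<forall>t\<in>{0..T}. dist (f (floor_time T n t * T / Suc n)) (f t) < e"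
proof -
  have "uniformly_continuous_on {0..T} f"
    using assms by (intro compact_uniformly_continuous) auto
  then obtain d where d: "d > 0"
    "\<And>s t. s \<in> {0..T} \<Longrightarrow> t \<in> {0..T} \<Longrightarrow> dist s t < d \<Longrightarrow> dist (f s) (f t) < e"
    using \<open>0 < e\<close> unfolding uniformly_continuous_on_def by meson
  have "(\<lambda>n. T / Suc n) \<longlonglongrightarrow> 0"
    using lim_const_over_n[of T] by (rule LIMSEQ_Suc)
  then have "\<forall>\<^sub>F n in sequentially. T / Suc n < d"
    using d(1) by (auto dest!: order_tendstoD)
  then show ?thesis
  proof eventually_elim
    case (elim n)
    show ?case
    proof
      fix t assume t: "t \<in> {0..T}"
      have "dist (floor_time T n t * T / Suc n) t < d"
        unfolding dist_real_def using floor_time_bounds(2)[OF assms(1) t, of n] elim by linarith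
      then show "dist (f (floor_time T n t * T / Suc n)) (f t) < e"
        by (rule d(2)[OF floor_time_bounds(3)[OF assms(1) t] t])
    qed
  qed
qed

text \<open>A path is approximated by its values at finitely many times, so that an open set of paths is
  described by countably many events, each given by an open set of finite families of values.\<close>

lemma measurable_path_map:
  fixes Y :: "'w \<Rightarrow> real \<Rightarrow> 'a::euclidean_space"
  assumes T: "0 < T"
    and meas: "\<And>t. t \<in> {0..T} \<Longrightarrow> (\<lambda>\<omega>. Y \<omega> t) \<in> borel_measurable M"
    and Y: "\<And>\<omega>. \<omega> \<in> space M \<Longrightarrow> Y \<omega> \<in> paths T"
  shows "Y \<in> measurable M (borel_of (path_space T))"
  unfolding borel_of_def
proof (rule measurable_measure_of)
  fix U :: "(real \<Rightarrow> 'a) set" assume "U \<in> {U. openin (path_space T) U}"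
  then have U: "openin (path_space T) U" by simp
  \<comment> \<open>Families of values whose associated step function stays closer than
    \<open>r\<close> to some path outside \<open>U\<close>. The slack \<open>r' < r\<close>,
    together with the fact that only the indices up to \<open>Suc n\<close> occur, makes this set
    open in the product topology although \<open>t\<close> ranges over an uncountable set.\<close>
  define E where "E n r = {v :: nat \<Rightarrow> 'a. \<exists>g\<in>paths T - U. \<exists>r'<r.
     \<forall>t\<in>{0..T}. dist (v (floor_time T n t)) (g t) \<le> r'}" for n r
  \<comment> \<open>The \<open>min\<close> keeps the evaluation times in \<open>{0..T}\<close> for
    large \<open>i\<close>, so that every coordinate of \<open>Z n\<close> is measurable.\<close>
  define Z where "Z n \<omega> i = Y \<omega> (min (i * T / Suc n) T)" for n \<omega> and i :: nat
  have Z [measurable]: "Z n \<in> borel_measurable M" for n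
    unfolding Z_def using T by (intro measurable_coordinatewise_then_product meas) auto
  have Zf: "Z n \<omega> (floor_time T n t) = Y \<omega> (floor_time T n t * T / Suc n)"
    if "t \<in> {0..T}" for n \<omega> t
    using floor_time_bounds[OF T that, of n] by (simp add: Z_def min_absorb1 del: of_nat_Suc)
  have "open (E n r)" for n r
  proof (rule open_subopen[THEN iffD2], rule ballI)
    fix v assume "v \<in> E n r"
    then obtain g r' where g: "g \<in> paths T - U" "r' < r"
      and v: "\<forall>t\<in>{0..T}. dist (v (floor_time T n t)) (g t) \<le> r'"
      by (auto simp: E_def)
    define N where "N = (\<Inter>i\<in>{..Suc n}. (\<lambda>u. u i) -` ball (v i) ((r - r')/2))"
    have "open N"
      unfolding N_def by (intro open_INT ballI open_vimage) auto
    moreover have "v \<in> N" using g by (auto simp: N_def)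
    moreover have "N \<subseteq> E n r"
    proof
      fix u assume u: "u \<in> N"
      have "dist (u (floor_time T n t)) (g t) \<le> (r + r')/2" if t: "t \<in> {0..T}" for t
      proof -
        have "dist (v (floor_time T n t)) (u (floor_time T n t)) < (r - r')/2"
          using u floor_time_bounds(1)[OF T t] by (auto simp: N_def)
        with bspec[OF v t] show ?thesis
          using dist_triangle[of "u (floor_time T n t)" "g t" "v (floor_time T n t)"]
          by (simp add: dist_commute field_simps)
      qed
      moreover have "(r + r')/2 < r" using g by simp
      ultimately show "u \<in> E n r"
        unfolding E_def mem_Collect_eq using g by (intro bexI[of _ g] exI[of _ "(r + r')/2"]) auto
    qed
    ultimately show "\<exists>N. open N \<and> v \<in> N \<and> N \<subseteq> E n r" by blast
  qed
  then have E [measurable]: "E n r \<in> sets borel" for n r by auto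
  \<comment> \<open>A path lies in the open set \<open>U\<close> iff it has positive distance to the
    complement, which its step approximations detect with only countable quantifiers.\<close>
  have "Y \<omega> \<in> U \<longleftrightarrow> (\<exists>k N. \<forall>n\<ge>N. Z n \<omega> \<notin> E n (1 / Suc k))" if \<omega>: "\<omega> \<in> space M" for \<omega>
  proof
    have cont: "continuous_on {0..T} (Y \<omega>)" using Y[OF \<omega>] by (simp add: paths_def)
    {
      assume "Y \<omega> \<in> U"
      then obtain r where r: "r > 0"
        "\<And>g. g \<in> paths T \<Longrightarrow> (\<forall>t\<in>{0..T}. dist (Y \<omega> t) (g t) \<le> r) \<Longrightarrow> g \<in> U"
        using U unfolding openin_path_space_iff[OF T] by meson
      obtain k where k: "1 / Suc k < r/2"
        using nat_approx_posE[of "r/2"] r(1) by auto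
      have "\<forall>\<^sub>F n in sequentially. \<forall>t\<in>{0..T}.
          dist (Y \<omega> (floor_time T n t * T / Suc n)) (Y \<omega> t) < r/2"
        using r(1) by (intro floor_time_uniform[OF T cont]) simp
      then obtain N where N: "\<forall>n\<ge>N. \<forall>t\<in>{0..T}.
          dist (Y \<omega> (floor_time T n t * T / Suc n)) (Y \<omega> t) < r/2"
        unfolding eventually_sequentially by blast
      have "Z n \<omega> \<notin> E n (1 / Suc k)" if n: "n \<ge> N" for n
      proof
        assume "Z n \<omega> \<in> E n (1 / Suc k)"
        then obtain g r' where g: "g \<in> paths T - U" "r' < 1 / Suc k"
          and le: "\<forall>t\<in>{0..T}. dist (Z n \<omega> (floor_time T n t)) (g t) \<le> r'"
          by (auto simp: E_def)
        have "dist (Y \<omega> t) (g t) \<le> r" if t: "t \<in> {0..T}" for t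
          using N[rule_format, OF n t] bspec[OF le t] g(2) k Zf[OF t, of n \<omega>]
            dist_triangle[of "Y \<omega> t" "g t" "Z n \<omega> (floor_time T n t)"]
          by (simp add: dist_commute)
        with r(2)[of g] g show False by auto
      qed
      then show "\<exists>k N. \<forall>n\<ge>N. Z n \<omega> \<notin> E n (1 / Suc k)" by blast
    }
    assume "\<exists>k N. \<forall>n\<ge>N. Z n \<omega> \<notin> E n (1 / Suc k)"
    then obtain k N where kN: "\<And>n. n \<ge> N \<Longrightarrow> Z n \<omega> \<notin> E n (1 / Suc k)" by blast
    have "\<forall>\<^sub>F n in sequentially. \<forall>t\<in>{0..T}.
        dist (Y \<omega> (floor_time T n t * T / Suc n)) (Y \<omega> t) < 1 / Suc k / 2"
      by (intro floor_time_uniform[OF T cont]) simp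
    then obtain N' where N': "\<forall>n\<ge>N'. \<forall>t\<in>{0..T}.
        dist (Y \<omega> (floor_time T n t * T / Suc n)) (Y \<omega> t) < 1 / Suc k / 2"
      unfolding eventually_sequentially by blast
    show "Y \<omega> \<in> U"
    \<comment> \<open>A path outside \<open>U\<close> is itself a witness that its own
      approximations belong to \<open>E\<close>.\<close>
    proof (rule ccontr)
      assume "Y \<omega> \<notin> U"
      then have "Y \<omega> \<in> paths T - U" using Y[OF \<omega>] by blast
      moreover have "1 / Suc k / 2 < 1 / Suc k" by (simp add: field_simps)
      moreover have "dist (Z (max N N') \<omega> (floor_time T (max N N') t)) (Y \<omega> t) \<le> 1 / Suc k / 2"
        if "t \<in> {0..T}" for t
        unfolding Zf[OF that] using N'[rule_format, OF max.cobounded2 that] by (rule less_imp_le)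
      ultimately have "Z (max N N') \<omega> \<in> E (max N N') (1 / Suc k)"
        unfolding E_def mem_Collect_eq by blast
      with kN[of "max N N'"] show False by simp
    qed
  qed
  then have "Y -` U \<inter> space M = {\<omega>\<in>space M. \<exists>k N. \<forall>n\<ge>N. Z n \<omega> \<notin> E n (1 / Suc k)}"
    by auto
  also have "\<dots> \<in> sets M" by measurable
  finally show "Y -` U \<inter> space M \<in> sets M" .
next
  show "{U. openin (path_space T) U} \<subseteq> Pow (topspace (path_space T :: (real \<Rightarrow> 'a) topology))"
    by (auto simp del: topspace_path_space dest: openin_subset)
qed (use Y in simp)


section \<open>Square integrable functions on an interval\<close>

lemma L2_fun_iff:
  "g \<in> L2_fun T \<longleftrightarrow> set_borel_measurable lborel {0..T} g \<and> set_integrable lborel {0..T} (\<lambda>s. (norm (g s))\<^sup>2)"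
  by (simp add: L2_fun_def)

text \<open>The norm is dominated by \<open>1 + (norm (g s))\<^sup>2\<close>, and constants are
  integrable over a bounded interval.\<close>

lemma set_integrable_square_imp:
  fixes g :: "real \<Rightarrow> 'a::euclidean_space"
  assumes "set_borel_measurable lborel {a..b} g" "set_integrable lborel {a..b} (\<lambda>s. (norm (g s))\<^sup>2)"
  shows "set_integrable lborel {a..b} g"
  unfolding set_integrable_def
proof (rule Bochner_Integration.integrable_bound)
  have "set_integrable lborel {a..b} (\<lambda>_. 1 :: real)"
    by (simp add: set_integrable_def integrable_real_indicator emeasure_lborel_Icc_eq)
  then have "set_integrable lborel {a..b} (\<lambda>s. 1 + (norm (g s))\<^sup>2)"
    using assms by (intro set_integral_add) auto
  then show "integrable lborel (\<lambda>s. indicator {a..b} s *\<^sub>R (1 + (norm (g s))\<^sup>2))"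
    by (simp add: set_integrable_def)
  show "(\<lambda>x. indicator {a..b} x *\<^sub>R g x) \<in> borel_measurable lborel"
    using assms by (simp add: set_borel_measurable_def)
  have "norm (g s) \<le> 1 + (norm (g s))\<^sup>2" for s
    using zero_le_power2[of "norm (g s) - 1"] by (simp add: power2_diff) (smt (verit) norm_ge_zero)
  then show "AE s in lborel. norm (indicator {a..b} s *\<^sub>R g s)
      \<le> norm (indicator {a..b} s *\<^sub>R (1 + (norm (g s))\<^sup>2))"
    by (intro AE_I2) (auto simp: indicator_def)
qed

lemma L2_fun_imp_set_integrable: "g \<in> L2_fun T \<Longrightarrow> set_integrable lborel {0..T} g"
  by (auto simp: L2_fun_def intro: set_integrable_square_imp)

text \<open>Cauchy-Schwarz against the indicator of the interval, carried out for nonnegative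
  integrals and then transferred to the reals.\<close>

lemma norm_LINT_square_le:
  fixes g :: "real \<Rightarrow> 'a::euclidean_space"
  assumes "a \<le> b" and m: "set_borel_measurable lborel {a..b} g"
    and i: "set_integrable lborel {a..b} (\<lambda>s. (norm (g s))\<^sup>2)"
  shows "(norm (LINT s:{a..b}|lborel. g s))\<^sup>2 \<le> (b - a) * (LINT s:{a..b}|lborel. (norm (g s))\<^sup>2)"
proof -
  have int: "set_integrable lborel {a..b} g" using m i by (rule set_integrable_square_imp)
  have m' [measurable]: "(\<lambda>s. indicator {a..b} s *\<^sub>R g s) \<in> borel_measurable lborel"
    using m by (simp add: set_borel_measurable_def)
  have "ennreal ((norm (LINT s:{a..b}|lborel. g s))\<^sup>2)
      \<le> (\<integral>\<^sup>+s. ennreal (norm (indicator {a..b} s *\<^sub>R g s)) \<partial>lborel)\<^sup>2"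
    using integral_norm_bound_ennreal[OF int[unfolded set_integrable_def]]
    unfolding set_lebesgue_integral_def ennreal_power[OF norm_ge_zero, symmetric]
    by (intro power_mono) auto
  also have "\<dots> = (\<integral>\<^sup>+s. ennreal (norm (indicator {a..b} s *\<^sub>R g s)) * indicator {a..b} s \<partial>lborel)\<^sup>2"
    by (intro arg_cong[where f = "\<lambda>x. x\<^sup>2"] nn_integral_cong) (auto simp: indicator_def)
  also have "\<dots> \<le> (\<integral>\<^sup>+s. (ennreal (norm (indicator {a..b} s *\<^sub>R g s)))\<^sup>2 \<partial>lborel)
      * (\<integral>\<^sup>+s. (indicator {a..b} s)\<^sup>2 \<partial>lborel)"
    by (rule Cauchy_Schwarz_nn_integral) measurable
  also have "(\<integral>\<^sup>+s. (indicator {a..b} s)\<^sup>2 \<partial>lborel) = (\<integral>\<^sup>+s. indicator {a..b} s \<partial>lborel)"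
    by (intro nn_integral_cong) (auto simp: indicator_def)
  also have "\<dots> = ennreal (b - a)" using assms(1) by simp
  also have "(\<integral>\<^sup>+s. (ennreal (norm (indicator {a..b} s *\<^sub>R g s)))\<^sup>2 \<partial>lborel)
      = (\<integral>\<^sup>+s. ennreal (indicator {a..b} s *\<^sub>R (norm (g s))\<^sup>2) \<partial>lborel)"
    by (intro nn_integral_cong) (auto simp: indicator_def ennreal_power)
  also have "\<dots> = ennreal (LINT s:{a..b}|lborel. (norm (g s))\<^sup>2)"
    unfolding set_lebesgue_integral_def using i unfolding set_integrable_def
    by (intro nn_integral_eq_integral) auto
  finally have "ennreal ((norm (LINT s:{a..b}|lborel. g s))\<^sup>2)
     \<le> ennreal ((b - a) * (LINT s:{a..b}|lborel. (norm (g s))\<^sup>2))"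
    using assms(1) by (simp add: ennreal_mult' mult.commute)
  moreover have "0 \<le> (LINT s:{a..b}|lborel. (norm (g s))\<^sup>2)"
    unfolding set_lebesgue_integral_def by (intro integral_nonneg_AE) auto
  ultimately show ?thesis
    using assms(1) by (subst (asm) ennreal_le_iff) auto
qed

lemma LINT_singleton: "(LINT s:{a..a::real}|lborel. g s) = (0 :: 'a::euclidean_space)"
  unfolding set_lebesgue_integral_def
  by (intro integral_eq_zero_AE) (use AE_lborel_singleton[of a] in \<open>auto elim!: eventually_mono\<close>)

lemma LINT_interval_diff:
  fixes g :: "real \<Rightarrow> 'a::euclidean_space"
  assumes "set_integrable lborel {0..T} g" "0 \<le> s" "s \<le> t" "t \<le> T"
  shows "(LINT u:{0..t}|lborel. g u) - (LINT u:{0..s}|lborel. g u) = (LINT u:{s..t}|lborel. g u)"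
proof -
  have i: "set_integrable lborel {a..b} g" if "0 \<le> a" "b \<le> T" for a b
    using assms(1) by (rule set_integrable_subset) (use that in auto)
  have "(LINT u:{0..s} \<union> {s..t}|lborel. g u) = (LINT u:{0..s}|lborel. g u) + (LINT u:{s..t}|lborel. g u)"
  proof (rule set_integral_Un_AE)
    show "AE x in lborel. \<not> (x \<in> {0..s} \<and> x \<in> {s..t})"
      using AE_lborel_singleton[of s] by eventually_elim auto
  qed (use i assms in auto)
  moreover have "{0..s} \<union> {s..t} = {0..t}" using assms by auto
  ultimately show ?thesis by simp
qed

section \<open>The energy of a path on dyadic grids\<close>

definition grid :: "real \<Rightarrow> nat \<Rightarrow> nat \<Rightarrow> real" where
  "grid T m i = real i * T / 2 ^ m"

definition incr :: "real \<Rightarrow> nat \<Rightarrow> (real \<Rightarrow> 'a::euclidean_space) \<Rightarrow> nat \<Rightarrow> 'a" where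
  "incr T m w i = w (grid T m (Suc i)) - w (grid T m i)"

text \<open>The squared L2 norm of the derivative of the piecewise linear interpolation of
  \<open>w\<close> on the grid of level \<open>m\<close>.\<close>

definition energy :: "real \<Rightarrow> nat \<Rightarrow> (real \<Rightarrow> 'a::euclidean_space) \<Rightarrow> real" where
  "energy T m w = (\<Sum>i<2 ^ m. (norm (incr T m w i))\<^sup>2 / (T / 2 ^ m))"

lemma grid_0 [simp]: "grid T m 0 = 0"
  by (simp add: grid_def)

lemma grid_last [simp]: "grid T m (2 ^ m) = T"
  by (simp add: grid_def)

lemma grid_mono: "0 < T \<Longrightarrow> i \<le> j \<Longrightarrow> grid T m i \<le> grid T m j"
  by (auto simp: grid_def intro!: divide_right_mono mult_right_mono)

lemma grid_Suc: "grid T m (Suc i) = grid T m i + T / 2 ^ m"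
  by (simp add: grid_def field_simps)

lemma grid_in: "0 < T \<Longrightarrow> i \<le> 2 ^ m \<Longrightarrow> grid T m i \<in> {0..T}"
  using grid_mono[of T 0 i m] grid_mono[of T i "2 ^ m" m] by simp

lemma grid_refine: "grid T (Suc m) (2 * i) = grid T m i"
  by (simp add: grid_def)

lemma energy_nonneg: "0 < T \<Longrightarrow> 0 \<le> energy T m w"
  by (auto simp: energy_def intro!: sum_nonneg)

text \<open>At \<open>t = T\<close> the value is \<open>2 ^ m\<close>, the index of the last grid
  point but of no cell; this case is treated separately wherever a cell is required.\<close>

definition dyadic_floor :: "real \<Rightarrow> nat \<Rightarrow> real \<Rightarrow> nat" where
  "dyadic_floor T m t = nat \<lfloor>t * 2 ^ m / T\<rfloor>"

lemma dyadic_floor_bounds: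
  assumes T: "0 < T" and t: "t \<in> {0..T}"
  shows "dyadic_floor T m t \<le> 2 ^ m" "grid T m (dyadic_floor T m t) \<le> t"
    "t \<le> grid T m (dyadic_floor T m t) + T / 2 ^ m"
proof -
  let ?n = "dyadic_floor T m t"
  have "t * 2 ^ m \<le> T * 2 ^ m" using t by (intro mult_right_mono) auto
  then have le: "t * 2 ^ m / T \<le> 2 ^ m" using T by (simp add: divide_le_eq mult.commute)
  have ge: "0 \<le> t * 2 ^ m / T" using t T by auto
  have f: "real ?n = of_int \<lfloor>t * 2 ^ m / T\<rfloor>" using ge by (simp add: dyadic_floor_def)
  have b: "real ?n \<le> t * 2 ^ m / T" "t * 2 ^ m / T \<le> real ?n + 1"
    unfolding f by linarith+
  then show "grid T m ?n \<le> t" "t \<le> grid T m ?n + T / 2 ^ m"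
    unfolding grid_def using T by (simp_all add: field_simps)
  have "real ?n \<le> real (2 ^ m)"
    by (rule order_trans[OF b(1)]) (use le in simp)
  then show "?n \<le> 2 ^ m" unfolding of_nat_le_iff .
qed

lemma dyadic_floor_tendsto:
  assumes T: "0 < T" and t: "t \<in> {0..T}"
  shows "(\<lambda>m. grid T m (dyadic_floor T m t)) \<longlonglongrightarrow> t"
proof -
  have "(\<lambda>m. T / 2 ^ m) \<longlonglongrightarrow> 0"
    by (rule LIMSEQ_divide_realpow_zero) simp
  then have "(\<lambda>m. t - T / 2 ^ m) \<longlonglongrightarrow> t - 0" by (intro tendsto_intros)
  then have lower: "(\<lambda>m. t - T / 2 ^ m) \<longlonglongrightarrow> t" by simp
  show ?thesis
  proof (rule tendsto_sandwich[OF _ _ lower tendsto_const])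
    show "\<forall>\<^sub>F m in sequentially. t - T / 2 ^ m \<le> grid T m (dyadic_floor T m t)"
      using dyadic_floor_bounds(3)[OF T t] by (simp add: diff_le_eq)
    show "\<forall>\<^sub>F m in sequentially. grid T m (dyadic_floor T m t) \<le> t"
      using dyadic_floor_bounds(2)[OF T t] by simp
  qed
qed

text \<open>Refinement halves each cell. Hence consecutive dyadic approximations of \<open>t\<close>
  agree or differ by a single cell of the finer grid, which is what makes chaining possible.\<close>

lemma dyadic_floor_Suc:
  assumes T: "0 < T" and t: "t \<in> {0..T}"
  shows "dyadic_floor T (Suc m) t = 2 * dyadic_floor T m t
    \<or> dyadic_floor T (Suc m) t = Suc (2 * dyadic_floor T m t)"
proof -
  have "0 \<le> t * 2 ^ m / T" using t T by auto
  moreover have "t * 2 ^ Suc m / T = 2 * (t * 2 ^ m / T)" by simp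
  ultimately show ?thesis unfolding dyadic_floor_def by linarith
qed

lemma norm_sum_square_le:
  fixes f :: "'i \<Rightarrow> 'a::real_normed_vector"
  shows "(norm (sum f A))\<^sup>2 \<le> card A * (\<Sum>i\<in>A. (norm (f i))\<^sup>2)"
proof -
  have "(norm (sum f A))\<^sup>2 \<le> (\<Sum>i\<in>A. norm (f i))\<^sup>2"
    by (intro power_mono norm_sum) auto
  also have "\<dots> = (\<Sum>i\<in>A. 1 * norm (f i))\<^sup>2" by simp
  also have "\<dots> \<le> (\<Sum>i\<in>A. 1\<^sup>2) * (\<Sum>i\<in>A. (norm (f i))\<^sup>2)"
    by (rule Cauchy_Schwarz_ineq_sum)
  finally show ?thesis by simp
qed

lemma sum_incr: "i \<le> j \<Longrightarrow> (\<Sum>k=i..<j. incr T m w k) = w (grid T m j) - w (grid T m i)"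
  unfolding incr_def by (rule sum_Suc_diff')

text \<open>Cauchy-Schwarz over the \<open>j - i\<close> cells in between: the discrete form of the
  Hoelder-1/2 bound for paths of finite energy.\<close>

lemma grid_increment_le_energy:
  fixes w :: "real \<Rightarrow> 'a::euclidean_space"
  assumes "0 < T" "i \<le> j" "j \<le> 2 ^ m"
  shows "(norm (w (grid T m j) - w (grid T m i)))\<^sup>2 \<le> (grid T m j - grid T m i) * energy T m w"
proof -
  have "(norm (w (grid T m j) - w (grid T m i)))\<^sup>2 \<le> (j - i) * (\<Sum>k=i..<j. (norm (incr T m w k))\<^sup>2)"
    unfolding sum_incr[OF assms(2), symmetric] using norm_sum_square_le[of _ "{i..<j}"] by simp
  also have "\<dots> \<le> (j - i) * (\<Sum>k<2^m. (norm (incr T m w k))\<^sup>2)"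
    using assms by (intro mult_left_mono sum_mono2) auto
  also have "\<dots> = ((j - i) * (T / 2 ^ m)) * energy T m w"
    unfolding energy_def sum_divide_distrib[symmetric] using assms(1) by simp
  also have "(j - i) * (T / 2 ^ m) = grid T m j - grid T m i"
    using assms by (simp add: grid_def of_nat_diff field_simps)
  finally show ?thesis .
qed

text \<open>Cauchy-Schwarz on each cell bounds its term by the integral of the squared density over
  that cell; the sum then telescopes.\<close>

lemma energy_le_LINT:
  fixes w g :: "real \<Rightarrow> 'a::euclidean_space"
  assumes T: "0 < T" and g: "g \<in> L2_fun T"
    and w: "\<And>t. t \<in> {0..T} \<Longrightarrow> w t = (LINT s:{0..t}|lborel. g s)"
  shows "energy T m w \<le> (LINT s:{0..T}|lborel. (norm (g s))\<^sup>2)"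
proof -
  have g1: "set_borel_measurable lborel {0..T} g" "set_integrable lborel {0..T} (\<lambda>s. (norm (g s))\<^sup>2)"
    using g by (auto simp: L2_fun_def)
  have gi: "set_integrable lborel {0..T} g" using g by (rule L2_fun_imp_set_integrable)
  let ?G = "\<lambda>t. LINT s:{0..t}|lborel. (norm (g s))\<^sup>2"
  have "(norm (incr T m w i))\<^sup>2 / (T / 2 ^ m) \<le> ?G (grid T m (Suc i)) - ?G (grid T m i)"
    if i: "i < 2 ^ m" for i
  proof -
    have in1: "grid T m i \<in> {0..T}" "grid T m (Suc i) \<in> {0..T}" "grid T m i \<le> grid T m (Suc i)"
      using T i by (auto intro!: grid_in grid_mono simp del: atLeastAtMost_iff)
    then have sub: "{grid T m i..grid T m (Suc i)} \<subseteq> {0..T}" by auto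
    have m: "set_borel_measurable lborel {grid T m i..grid T m (Suc i)} g"
      using g1(1) by (rule set_borel_measurable_subset) (use sub in auto)
    have ii: "set_integrable lborel {grid T m i..grid T m (Suc i)} (\<lambda>s. (norm (g s))\<^sup>2)"
      using g1(2) by (rule set_integrable_subset) (use sub in auto)
    have "incr T m w i = (LINT u:{grid T m i..grid T m (Suc i)}|lborel. g u)"
      unfolding incr_def w[OF in1(1)] w[OF in1(2)]
      using in1 by (intro LINT_interval_diff[OF gi]) auto
    then have "(norm (incr T m w i))\<^sup>2 \<le> (T / 2 ^ m) * (LINT s:{grid T m i..grid T m (Suc i)}|lborel. (norm (g s))\<^sup>2)"
      using norm_LINT_square_le[OF in1(3) m ii] by (simp add: grid_Suc)
    also have "(LINT s:{grid T m i..grid T m (Suc i)}|lborel. (norm (g s))\<^sup>2)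
       = ?G (grid T m (Suc i)) - ?G (grid T m i)"
      using in1 LINT_interval_diff[OF g1(2), of "grid T m i" "grid T m (Suc i)"] by auto
    finally show ?thesis using T by (simp add: field_simps)
  qed
  then have "energy T m w \<le> (\<Sum>i<2 ^ m. ?G (grid T m (Suc i)) - ?G (grid T m i))"
    unfolding energy_def by (intro sum_mono) auto
  also have "\<dots> = ?G T - ?G 0"
    using sum_lessThan_telescope[of "\<lambda>i. ?G (grid T m i)" "2 ^ m"] by simp
  also have "?G 0 = 0"
    by (rule LINT_singleton)
  finally show ?thesis by simp
qed

section \<open>Step functions: the derivative of the dyadic linear interpolation\<close>

definition step :: "real \<Rightarrow> nat \<Rightarrow> (real \<Rightarrow> 'a::euclidean_space) \<Rightarrow> real \<Rightarrow> 'a" where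
  "step T m w t = (\<Sum>i<2 ^ m. indicator {grid T m i<..grid T m (Suc i)} t *\<^sub>R (incr T m w i /\<^sub>R (T / 2 ^ m)))"

lemma measurable_step [measurable]: "step T m w \<in> borel_measurable borel"
  unfolding step_def by measurable

text \<open>The cells are open on the left, hence disjoint, so exactly one indicator in the sum
  contributes at \<open>t\<close>.\<close>

lemma step_eq:
  assumes T: "0 < T" and i: "i < 2 ^ m" and t: "t \<in> {grid T m i<..grid T m (Suc i)}"
  shows "step T m w t = incr T m w i /\<^sub>R (T / 2 ^ m)"
proof -
  have "indicator {grid T m j<..grid T m (Suc j)} t = (if j = i then 1 else 0 :: real)" for j
  proof (cases j i rule: linorder_cases)
    case less
    then show ?thesis using grid_mono[OF T, of "Suc j" i m] t by auto
  next
    case greater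
    then show ?thesis using grid_mono[OF T, of "Suc i" j m] t by auto
  qed (use t in auto)
  then have "step T m w t = (\<Sum>j<2 ^ m. if j = i then incr T m w i /\<^sub>R (T / 2 ^ m) else 0)"
    unfolding step_def by (intro sum.cong) auto
  then show ?thesis using i by simp
qed

lemma step_outside:
  assumes T: "0 < T" and t: "t \<notin> {0<..T}"
  shows "step T m w t = 0"
proof -
  have "t \<notin> {grid T m i<..grid T m (Suc i)}" if "i < 2 ^ m" for i
    using t grid_in[OF T, of i m] grid_in[OF T, of "Suc i" m] that by auto
  then show ?thesis unfolding step_def by (intro sum.neutral) auto
qed

lemma emeasure_lborel_Ioc_less_top [simp]: "emeasure lborel {a<..b::real} < top"
  by (rule le_less_trans[OF emeasure_mono[of _ "{a..b}"]]) (auto simp: emeasure_lborel_Icc_eq)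

lemma integrable_step [simp]: "integrable lborel (step T m w)"
  unfolding step_def
  by (intro Bochner_Integration.integrable_sum integrable_scaleR_left impI integrable_real_indicator) auto

lemma LINT_step_cell:
  assumes T: "0 < T" and i: "i < 2 ^ m" and t: "t \<in> {grid T m i..grid T m (Suc i)}"
  shows "(LINT s:{grid T m i..t}|lborel. step T m w s) = ((t - grid T m i) / (T / 2 ^ m)) *\<^sub>R incr T m w i"
proof -
  have "(LINT s:{grid T m i..t}|lborel. step T m w s)
     = (LINT s|lborel. indicator {grid T m i..t} s *\<^sub>R (incr T m w i /\<^sub>R (T / 2 ^ m)))"
    unfolding set_lebesgue_integral_def
  proof (rule integral_cong_AE)
    show "AE s in lborel. indicator {grid T m i..t} s *\<^sub>R step T m w s =
       indicator {grid T m i..t} s *\<^sub>R (incr T m w i /\<^sub>R (T / 2 ^ m))"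
      using AE_lborel_singleton[of "grid T m i"]
    proof eventually_elim
      case (elim s)
      then show ?case using step_eq[OF T i, of s w] t by (cases "s \<in> {grid T m i..t}") auto
    qed
  qed measurable
  also have "\<dots> = (t - grid T m i) *\<^sub>R (incr T m w i /\<^sub>R (T / 2 ^ m))"
    using t by simp
  finally show ?thesis by (simp add: divide_inverse)
qed

lemma LINT_step_grid:
  assumes T: "0 < T" and i: "i \<le> 2 ^ m"
  shows "(LINT s:{0..grid T m i}|lborel. step T m w s) = w (grid T m i) - w 0"
  using i
proof (induction i)
  case 0
  have "(LINT s:{0..0}|lborel. step T m w s) = 0"
    by (rule LINT_singleton)
  then show ?case by simp
next
  case (Suc i)
  have si: "set_integrable lborel A (step T m w)" if "A \<in> sets borel" for A
    using set_integrable_subset[of lborel UNIV "step T m w" A] that by (simp add: set_integrable_def)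
  have g: "grid T m i \<in> {0..T}" "grid T m (Suc i) \<in> {0..T}" "grid T m i \<le> grid T m (Suc i)"
    using T Suc.prems by (auto intro!: grid_in grid_mono simp del: atLeastAtMost_iff)
  have "(LINT s:{0..grid T m (Suc i)}|lborel. step T m w s) - (LINT s:{0..grid T m i}|lborel. step T m w s)
      = (LINT s:{grid T m i..grid T m (Suc i)}|lborel. step T m w s)"
    using g si by (intro LINT_interval_diff[where T = T]) auto
  also have "\<dots> = incr T m w i"
    using Suc.prems g T by (subst LINT_step_cell) (auto simp: grid_Suc)
  finally show ?case using Suc by (simp add: incr_def algebra_simps)
qed

text \<open>The step functions form a martingale, so that their distances in \<open>L2\<close> are differences of energies.\<close>

lemma grid_refine_power: "grid T (m + k) (i * 2 ^ k) = grid T m i"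
  by (simp add: grid_def power_add)

lemma set_integrable_step [simp]: "A \<in> sets borel \<Longrightarrow> set_integrable lborel A (step T m w)"
  using set_integrable_subset[of lborel UNIV "step T m w" A] by (simp add: set_integrable_def)

text \<open>The martingale property: coarse grid points are also fine grid points, where the
  primitives of both step functions agree with \<open>w\<close> up to the constant
  \<open>w 0\<close>. So both have the same integral over a coarse cell.\<close>

lemma LINT_step_coarse_cell:
  assumes T: "0 < T" and i: "i < 2 ^ m" and mn: "m \<le> n"
  shows "(LINT s|lborel. indicator {grid T m i<..grid T m (Suc i)} s *\<^sub>R step T n w s) = incr T m w i"
proof -
  obtain k where n: "n = m + k" using mn le_Suc_ex by blast
  have g: "grid T m i \<in> {0..T}" "grid T m (Suc i) \<in> {0..T}" "grid T m i \<le> grid T m (Suc i)"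
    using T i by (auto intro!: grid_in grid_mono simp del: atLeastAtMost_iff)
  have G: "(LINT s:{0..grid T m j}|lborel. step T n w s) = w (grid T m j) - w 0" if "j \<le> 2 ^ m" for j
    using LINT_step_grid[OF T, of "j * 2 ^ k" n w] that
    unfolding n grid_refine_power by (simp add: power_add)
  have "(LINT s|lborel. indicator {grid T m i<..grid T m (Suc i)} s *\<^sub>R step T n w s)
     = (LINT s:{grid T m i..grid T m (Suc i)}|lborel. step T n w s)"
    unfolding set_lebesgue_integral_def
    by (rule integral_cong_AE)
      (use AE_lborel_singleton[of "grid T m i"] in \<open>auto elim!: eventually_mono simp: indicator_def\<close>)
  also have "\<dots> = incr T m w i"
    using LINT_interval_diff[of T "step T n w" "grid T m i" "grid T m (Suc i)"] g G[of i] G[of "Suc i"] i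
    by (auto simp: incr_def)
  finally show ?thesis .
qed

text \<open>The coarse function is constant on each of its cells, so the inner product sees only the
  cell averages of the fine one. Consequently the difference of two levels is orthogonal to the
  coarser level.\<close>

lemma LINT_inner_step:
  fixes w :: "real \<Rightarrow> 'a::euclidean_space"
  assumes T: "0 < T" and mn: "m \<le> n"
  shows "(LINT t|lborel. inner (step T m w t) (step T n w t)) = energy T m w" (is ?eq)
    and "integrable lborel (\<lambda>t. inner (step T m w t) (step T n w t))" (is ?int)
proof -
  define c where "c i = incr T m w i /\<^sub>R (T / 2 ^ m)" for i
  define X where "X i t = indicator {grid T m i<..grid T m (Suc i)} t *\<^sub>R step T n w t" for i t
  have X: "integrable lborel (X i)" for i
    unfolding X_def by (intro integrable_mult_indicator) auto
  have eq: "inner (step T m w t) (step T n w t) = (\<Sum>i<2 ^ m. inner (c i) (X i t))" for t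
    unfolding step_def[of T m] inner_sum_left X_def c_def by (intro sum.cong) auto
  show ?int unfolding eq using X by (intro Bochner_Integration.integrable_sum integrable_inner_right) auto
  have "(LINT t|lborel. inner (step T m w t) (step T n w t)) = (\<Sum>i<2 ^ m. inner (c i) (incr T m w i))"
  proof -
    have "(LINT t|lborel. X i t) = incr T m w i" if "i < 2 ^ m" for i
      unfolding X_def by (rule LINT_step_coarse_cell[OF T that mn])
    then show ?thesis unfolding eq using X
      by (subst Bochner_Integration.integral_sum) (auto intro!: sum.cong)
  qed
  also have "\<dots> = energy T m w"
    unfolding energy_def c_def by (intro sum.cong refl) (simp add: power2_norm_eq_inner divide_inverse mult.commute)
  finally show ?eq .
qed

text \<open>Pythagoras, with the orthogonality contained in \<open>LINT_inner_step\<close>.\<close>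

lemma LINT_norm_step_diff:
  fixes w :: "real \<Rightarrow> 'a::euclidean_space"
  assumes T: "0 < T" and mn: "m \<le> n"
  shows "(LINT t|lborel. (norm (step T n w t - step T m w t))\<^sup>2) = energy T n w - energy T m w" (is ?eq)
    and "integrable lborel (\<lambda>t. (norm (step T n w t - step T m w t))\<^sup>2)" (is ?int)
proof -
  have eq: "(norm (step T n w t - step T m w t))\<^sup>2 = inner (step T n w t) (step T n w t)
     - 2 * inner (step T m w t) (step T n w t) + inner (step T m w t) (step T m w t)" for t
    by (simp add: power2_norm_eq_inner inner_diff_left inner_diff_right inner_commute)
  show ?int unfolding eq using LINT_inner_step(2)[OF T] mn
    by (intro Bochner_Integration.integrable_add Bochner_Integration.integrable_diff integrable_mult_right) auto
  show ?eq unfolding eq using LINT_inner_step[OF T mn, of w] LINT_inner_step[OF T order_refl, of m w]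
      LINT_inner_step[OF T order_refl, of n w] by simp
qed

section \<open>From bounded energies to a square integrable density\<close>

lemma energy_mono:
  assumes "0 < T" "m \<le> n" shows "energy T m w \<le> energy T n w"
proof -
  have "0 \<le> (LINT t|lborel. (norm (step T n w t - step T m w t))\<^sup>2)"
    by (intro integral_nonneg_AE) auto
  then show ?thesis using LINT_norm_step_diff(1)[OF assms, of w] by simp
qed

text \<open>Both functions vanish outside \<open>{0<..T}\<close>, so Cauchy-Schwarz turns the L2
  distance into an L1 bound, the form in which \<open>L1_Cauchy_subseq\<close> takes the
  limit.\<close>

lemma LINT_norm_step_diff_L1:
  fixes w :: "real \<Rightarrow> 'a::euclidean_space"
  assumes T: "0 < T" and mn: "m \<le> n"
  shows "(LINT t|lborel. norm (step T n w t - step T m w t)) \<le> sqrt (T * (energy T n w - energy T m w))"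
proof -
  let ?h = "\<lambda>t. norm (step T n w t - step T m w t)"
  have supp: "?h t = indicator {0..T} t * ?h t" for t
    using step_outside[OF T, of t m w] step_outside[OF T, of t n w]
    by (cases "t \<in> {0<..T}") (auto simp: indicator_def)
  have sq: "(?h t)\<^sup>2 = indicator {0..T} t * (?h t)\<^sup>2" for t
    using step_outside[OF T, of t m w] step_outside[OF T, of t n w]
    by (cases "t \<in> {0<..T}") (auto simp: indicator_def)
  have "(norm (LINT s:{0..T}|lborel. ?h s))\<^sup>2 \<le> (T - 0) * (LINT s:{0..T}|lborel. (norm (?h s))\<^sup>2)"
  proof (rule norm_LINT_square_le)
    show "set_integrable lborel {0..T} (\<lambda>s. (norm (?h s))\<^sup>2)"
      using LINT_norm_step_diff(2)[OF T mn, of w] unfolding set_integrable_def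
      by (intro integrable_mult_indicator) auto
  qed (use T in \<open>auto simp: set_borel_measurable_def\<close>)
  also have "(LINT s:{0..T}|lborel. (norm (?h s))\<^sup>2) = energy T n w - energy T m w"
    unfolding set_lebesgue_integral_def real_scaleR_def real_norm_def abs_norm_cancel sq[symmetric]
    by (rule LINT_norm_step_diff(1)[OF T mn])
  also have "(LINT s:{0..T}|lborel. ?h s) = (LINT s|lborel. ?h s)"
    unfolding set_lebesgue_integral_def real_scaleR_def supp[symmetric] ..
  finally show ?thesis by (intro real_le_rsqrt) simp
qed

text \<open>Completeness of L1. The limit is taken pointwise along an almost everywhere Cauchy
  subsequence; Fatou's lemma in the second index \<open>j\<close> turns the Cauchy estimate into
  convergence in mean.\<close>

lemma L1_Cauchy_subseq:
  fixes s :: "nat \<Rightarrow> 'b \<Rightarrow> 'a::euclidean_space"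
  assumes s: "\<And>n. integrable M (s n)"
    and C: "\<And>e. e > 0 \<Longrightarrow> \<exists>N. \<forall>i\<ge>N. \<forall>j\<ge>N. (LINT x|M. norm (s i x - s j x)) < e"
  obtains g r where "integrable M g" "strict_mono r" "AE x in M. (\<lambda>i. s (r i) x) \<longlonglongrightarrow> g x"
    "(\<lambda>i. \<integral>\<^sup>+x. norm (s (r i) x - g x) \<partial>M) \<longlonglongrightarrow> 0"
proof -
  note [measurable] = borel_measurable_integrable[OF s]
  obtain r where r: "strict_mono r" "AE x in M. Cauchy (\<lambda>i. s (r i) x)"
    using cauchy_L1_AE_cauchy_subseq[OF s C] by blast
  define g where "g x = lim (\<lambda>i. s (r i) x)" for x
  have [measurable]: "g \<in> borel_measurable M" unfolding g_def by measurable
  have lim: "AE x in M. (\<lambda>i. s (r i) x) \<longlonglongrightarrow> g x"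
    using r(2) by eventually_elim (simp add: g_def Cauchy_convergent convergent_LIMSEQ_iff[symmetric])
  have bound: "\<exists>N. \<forall>i\<ge>N. (\<integral>\<^sup>+x. norm (s (r i) x - g x) \<partial>M) \<le> ennreal e" if e: "e > 0" for e
  proof -
    obtain N where N: "\<And>i j. i \<ge> N \<Longrightarrow> j \<ge> N \<Longrightarrow> (LINT x|M. norm (s i x - s j x)) < e"
      using C[OF e] by blast
    have "(\<integral>\<^sup>+x. norm (s (r i) x - g x) \<partial>M) \<le> ennreal e" if i: "i \<ge> N" for i
    proof -
      have "(\<integral>\<^sup>+x. norm (s (r i) x - g x) \<partial>M) = (\<integral>\<^sup>+x. liminf (\<lambda>j. ennreal (norm (s (r i) x - s (r j) x))) \<partial>M)"
      proof (rule nn_integral_cong_AE)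
        show "AE x in M. ennreal (norm (s (r i) x - g x)) = liminf (\<lambda>j. ennreal (norm (s (r i) x - s (r j) x)))"
          using lim
        proof eventually_elim
          case (elim x)
          then have "(\<lambda>j. ennreal (norm (s (r i) x - s (r j) x))) \<longlonglongrightarrow> ennreal (norm (s (r i) x - g x))"
            by (intro tendsto_intros)
          then show ?case by (rule lim_imp_Liminf[OF sequentially_bot, THEN sym])
        qed
      qed
      also have "\<dots> \<le> liminf (\<lambda>j. \<integral>\<^sup>+x. ennreal (norm (s (r i) x - s (r j) x)) \<partial>M)"
        by (rule nn_integral_liminf) measurable
      also have "\<dots> \<le> ennreal e"
      proof (rule Liminf_le)
        show "\<forall>\<^sub>F j in sequentially. (\<integral>\<^sup>+x. ennreal (norm (s (r i) x - s (r j) x)) \<partial>M) \<le> ennreal e"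
          using eventually_ge_at_top[of N]
        proof eventually_elim
          case (elim j)
          have "(\<integral>\<^sup>+x. ennreal (norm (s (r i) x - s (r j) x)) \<partial>M) = ennreal (LINT x|M. norm (s (r i) x - s (r j) x))"
            using s by (intro nn_integral_eq_integral) auto
          also have "\<dots> \<le> ennreal e"
            using N[of "r i" "r j"] i elim seq_suble[OF r(1), of i] seq_suble[OF r(1), of j]
            by (intro ennreal_leI less_imp_le) auto
          finally show ?case .
        qed
      qed simp
      finally show ?thesis .
    qed
    then show ?thesis by blast
  qed
  have "integrable M g"
  proof -
    obtain N where N: "(\<integral>\<^sup>+x. norm (s (r N) x - g x) \<partial>M) \<le> ennreal 1"
      using bound[of 1] by auto
    have "integrable M (\<lambda>x. s (r N) x - g x)"
      by (rule integrableI_bounded) (use N le_less_trans[OF N] in auto)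
    from Bochner_Integration.integrable_diff[OF s[of "r N"] this] show ?thesis by simp
  qed
  moreover have "(\<lambda>i. \<integral>\<^sup>+x. norm (s (r i) x - g x) \<partial>M) \<longlonglongrightarrow> 0"
  proof (rule order_tendstoI)
    fix a :: ennreal assume "0 < a"
    then obtain e :: real where e: "0 < e" "ennreal e < a"
    proof (cases a)
      case (real x)
      then show ?thesis using \<open>0 < a\<close> that[of "x/2"] by (auto simp: ennreal_less_iff)
    next
      case top
      then show ?thesis using that[of 1] by auto
    qed
    show "\<forall>\<^sub>F i in sequentially. (\<integral>\<^sup>+x. norm (s (r i) x - g x) \<partial>M) < a"
      using bound[OF e(1)] unfolding eventually_sequentially
      by (elim ex_forward all_forward imp_forward) (auto intro: le_less_trans[OF _ e(2)])
  qed auto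
  ultimately show ?thesis using that r(1) lim by blast
qed

text \<open>Converse of \<open>energy_le_LINT\<close>. Bounded increasing energies converge, so the
  step functions are Cauchy, and their limit is the density of \<open>w\<close>.\<close>

lemma bounded_energy_imp_L2_density:
  fixes w :: "real \<Rightarrow> 'a::euclidean_space"
  assumes T: "0 < T" and w: "continuous_on {0..T} w" "w 0 = 0" and a: "\<And>m. energy T m w \<le> a"
  obtains g where "g \<in> L2_fun T" "\<And>t. t \<in> {0..T} \<Longrightarrow> w t = (LINT s:{0..t}|lborel. g s)"
    "(LINT s:{0..T}|lborel. (norm (g s))\<^sup>2) \<le> a"
proof -
  have a0: "0 \<le> a" using energy_nonneg[OF T, of 0 w] a[of 0] by simp
  have "convergent (\<lambda>m. energy T m w)"
    using energy_mono[OF T] a by (intro Bseq_monoseq_convergent BseqI'[of "\<lambda>m. energy T m w" a] monoI1)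
      (auto simp: energy_nonneg[OF T])
  then have Cau: "Cauchy (\<lambda>m. energy T m w)" by (rule convergent_Cauchy)
  have L1: "\<exists>N. \<forall>i\<ge>N. \<forall>j\<ge>N. (LINT x|lborel. norm (step T i w x - step T j w x)) < e" if e: "e > 0" for e
  proof -
    \<comment> \<open>The tolerance is chosen so that the bound \<open>sqrt (T * \<dots>)\<close> of
      \<open>LINT_norm_step_diff_L1\<close> falls below \<open>e\<close>.\<close>
    obtain N where N: "\<And>i j. i \<ge> N \<Longrightarrow> j \<ge> N \<Longrightarrow> \<bar>energy T i w - energy T j w\<bar> < e\<^sup>2 / T"
      using CauchyD[OF Cau, of "e\<^sup>2 / T"] e T by auto
    have *: "(LINT x|lborel. norm (step T j w x - step T i w x)) < e" if "N \<le> i" "i \<le> j" for i j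
    proof -
      have "T * (energy T j w - energy T i w) < T * (e\<^sup>2 / T)"
        using N[of j i] that T by (intro mult_strict_left_mono) auto
      then have "sqrt (T * (energy T j w - energy T i w)) < e"
        using T e by (intro real_less_lsqrt) (auto intro!: mult_nonneg_nonneg energy_mono that)
      then show ?thesis using LINT_norm_step_diff_L1[OF T that(2), of w] by simp
    qed
    show ?thesis
    proof (intro exI[of _ N] allI impI)
      fix i j assume "N \<le> i" "N \<le> j"
      then show "(LINT x|lborel. norm (step T i w x - step T j w x)) < e"
        using *[of i j] *[of j i] by (cases "i \<le> j") (simp_all add: norm_minus_commute)
    qed
  qed
  obtain g r where g: "integrable lborel g" and r: "strict_mono r"
    and lim: "AE x in lborel. (\<lambda>i. step T (r i) w x) \<longlonglongrightarrow> g x"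
    and L1lim: "(\<lambda>i. \<integral>\<^sup>+x. norm (step T (r i) w x - g x) \<partial>lborel) \<longlonglongrightarrow> 0"
    by (rule L1_Cauchy_subseq[where s = "\<lambda>n. step T n w" and M = lborel, OF integrable_step L1])
  note [measurable] = borel_measurable_integrable[OF g]
  \<comment> \<open>Fatou's lemma: the L2 bound passes to the limit although the convergence
    obtained is only almost everywhere and in L1.\<close>
  have "(\<integral>\<^sup>+x. ennreal ((norm (g x))\<^sup>2) \<partial>lborel)
      = (\<integral>\<^sup>+x. liminf (\<lambda>i. ennreal ((norm (step T (r i) w x))\<^sup>2)) \<partial>lborel)"
  proof (rule nn_integral_cong_AE)
    show "AE x in lborel. ennreal ((norm (g x))\<^sup>2) = liminf (\<lambda>i. ennreal ((norm (step T (r i) w x))\<^sup>2))"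
      using lim
    proof eventually_elim
      case (elim x)
      then have "(\<lambda>i. ennreal ((norm (step T (r i) w x))\<^sup>2)) \<longlonglongrightarrow> ennreal ((norm (g x))\<^sup>2)"
        by (intro tendsto_intros)
      then show ?case by (rule lim_imp_Liminf[OF sequentially_bot, THEN sym])
    qed
  qed
  also have "\<dots> \<le> liminf (\<lambda>i. \<integral>\<^sup>+x. ennreal ((norm (step T (r i) w x))\<^sup>2) \<partial>lborel)"
    by (rule nn_integral_liminf) measurable
  also have "\<dots> \<le> ennreal a"
  proof (rule Liminf_le)
    have "(\<integral>\<^sup>+x. ennreal ((norm (step T m w x))\<^sup>2) \<partial>lborel) \<le> ennreal a" for m
    proof -
      have "(\<integral>\<^sup>+x. ennreal ((norm (step T m w x))\<^sup>2) \<partial>lborel) = ennreal (energy T m w)"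
        unfolding power2_norm_eq_inner using LINT_inner_step[OF T order_refl, of m w]
        by (subst nn_integral_eq_integral) auto
      then show ?thesis using a[of m] by (simp add: ennreal_leI)
    qed
    then show "\<forall>\<^sub>F i in sequentially. (\<integral>\<^sup>+x. ennreal ((norm (step T (r i) w x))\<^sup>2) \<partial>lborel) \<le> ennreal a"
      by simp
  qed simp
  finally have ga: "(\<integral>\<^sup>+x. ennreal ((norm (g x))\<^sup>2) \<partial>lborel) \<le> ennreal a" .
  then have g2: "integrable lborel (\<lambda>x. (norm (g x))\<^sup>2)"
    by (intro integrableI_bounded) (auto intro: le_less_trans)
  have "(LINT s:{0..T}|lborel. (norm (g s))\<^sup>2) \<le> (LINT s|lborel. (norm (g s))\<^sup>2)"
    unfolding set_lebesgue_integral_def using g2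
    by (intro integral_mono integrable_mult_indicator) (auto simp: indicator_def)
  also have "\<dots> \<le> a"
    using ga a0 nn_integral_eq_integral[OF g2] by simp
  finally have 3: "(LINT s:{0..T}|lborel. (norm (g s))\<^sup>2) \<le> a" .
  have 1: "g \<in> L2_fun T"
    unfolding L2_fun_iff set_integrable_def set_borel_measurable_def
    using g2 by (auto intro!: integrable_mult_indicator simp del: real_scaleR_def)
  \<comment> \<open>At a grid point of level \<open>m\<close> the primitives of all step functions
    of level at least \<open>m\<close> already have the correct value, so the sequence of integrals
    is eventually constant.\<close>
  have dyadic: "w (grid T m i) = (LINT s:{0..grid T m i}|lborel. g s)" if i: "i \<le> 2 ^ m" for m i
  proof -
    let ?A = "{0..grid T m i}"
    have "(\<lambda>k. LINT s:?A|lborel. step T (r k) w s) \<longlonglongrightarrow> (LINT s:?A|lborel. g s)"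
      unfolding set_lebesgue_integral_def
    proof (rule tendsto_L1_int)
      show "(\<lambda>k. \<integral>\<^sup>+x. norm (indicator ?A x *\<^sub>R step T (r k) w x - indicator ?A x *\<^sub>R g x) \<partial>lborel) \<longlonglongrightarrow> 0"
        by (rule tendsto_sandwich[OF _ _ tendsto_const L1lim])
          (auto intro!: always_eventually nn_integral_mono simp: indicator_def)
    qed (use g in \<open>auto intro!: integrable_mult_indicator\<close>)
    moreover have "\<forall>\<^sub>F k in sequentially. (LINT s:?A|lborel. step T (r k) w s) = w (grid T m i)"
      using eventually_ge_at_top[of m]
    proof eventually_elim
      case (elim k)
      then have "m \<le> r k" using seq_suble[OF r, of k] by simp
      then obtain j where j: "r k = m + j" using le_Suc_ex by blast
      then show ?case using LINT_step_grid[OF T, of "i * 2 ^ j" "r k" w] i w(2)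
        unfolding j grid_refine_power by (simp add: power_add)
    qed
    ultimately have "(\<lambda>k. w (grid T m i)) \<longlonglongrightarrow> (LINT s:?A|lborel. g s)"
      by (rule Lim_transform_eventually)
    then show ?thesis by (simp add: LIMSEQ_const_iff)
  qed
  \<comment> \<open>The dyadic times \<open>q m\<close> approach \<open>t\<close> from the left. The
    left side converges by continuity of \<open>w\<close>, the right side by dominated convergence
    with majorant \<open>norm (g s)\<close>.\<close>
  have 2: "w t = (LINT s:{0..t}|lborel. g s)" if t: "t \<in> {0..T}" for t
  proof -
    define q where "q m = grid T m (dyadic_floor T m t)" for m
    note fl = dyadic_floor_bounds[OF T t]
    note qt = dyadic_floor_tendsto[OF T t, folded q_def]
    have q_in: "q m \<in> {0..T}" for m unfolding q_def by (rule grid_in[OF T fl(1)])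
    have "(\<lambda>m. w (q m)) \<longlonglongrightarrow> w t"
      using w(1) t q_in qt by (auto simp: continuous_on_sequentially comp_def)
    moreover have "(\<lambda>m. w (q m)) \<longlonglongrightarrow> (LINT s:{0..t}|lborel. g s)"
    proof -
      have "(\<lambda>m. LINT s|lborel. indicator {0..q m} s *\<^sub>R g s) \<longlonglongrightarrow> (LINT s|lborel. indicator {0..t} s *\<^sub>R g s)"
      proof (rule integral_dominated_convergence[where w = "\<lambda>s. norm (g s)"])
        show "AE s in lborel. (\<lambda>m. indicator {0..q m} s *\<^sub>R g s) \<longlonglongrightarrow> indicator {0..t} s *\<^sub>R g s"
          using AE_lborel_singleton[of t]
        proof eventually_elim
          case (elim s)
          have "\<forall>\<^sub>F m in sequentially. indicator {0..q m} s = (indicator {0..t} s :: real)"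
          proof (cases "s < t")
            case True
            then show ?thesis using order_tendstoD(1)[OF qt True]
              by (auto elim!: eventually_mono simp: indicator_def)
          next
            case False
            then have "q m < s" for m using fl(2)[of m] elim unfolding q_def by linarith
            then show ?thesis using False elim by (auto simp: indicator_def not_le)
          qed
          then show ?case
            by (intro tendsto_eventually) (auto elim!: eventually_mono)
        qed
      qed (use g in \<open>auto simp: indicator_def\<close>)
      then show ?thesis
        unfolding set_lebesgue_integral_def[symmetric] using dyadic[OF fl(1)] unfolding q_def by simp
    qed
    ultimately show ?thesis by (rule LIMSEQ_unique)
  qed
  show ?thesis using that 1 2 3 by blast
qed

text \<open>The integral of the function, extended by zero, vanishes over every half-line.
  Half-lines form an intersection-stable generator of the Borel sets, so by Dynkin's argument it
  vanishes over every Borel set. This gives the uniqueness of L2 densities.\<close>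

lemma AE_eq_0_if_primitive_eq_0:
  fixes h :: "real \<Rightarrow> 'a::euclidean_space"
  assumes h: "set_integrable lborel {0..T} h" and T: "0 < T"
    and z: "\<And>t. t \<in> {0..T} \<Longrightarrow> (LINT s:{0..t}|lborel. h s) = 0"
  shows "AE s in lborel. s \<in> {0..T} \<longrightarrow> h s = 0"
proof -
  define k where "k s = indicator {0..T} s *\<^sub>R h s" for s
  have k: "integrable lborel k" using h by (simp add: set_integrable_def k_def[abs_def])
  have atMost: "(LINT s:{..a}|lborel. k s) = 0" for a
  proof (cases "a < 0")
    case True
    then have "(\<lambda>s. indicator {..a} s *\<^sub>R k s) = (\<lambda>_. 0)" by (auto simp: k_def indicator_def)
    then show ?thesis unfolding set_lebesgue_integral_def by (simp only: integral_zero)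
  next
    case False
    then have "indicator {..a} s *\<^sub>R k s = indicator {0..min a T} s *\<^sub>R h s" for s
      by (auto simp: k_def indicator_def)
    then show ?thesis using z[of "min a T"] False T by (simp add: set_lebesgue_integral_def)
  qed
  have UNIV: "(LINT s|lborel. k s) = 0"
    using z[of T] T by (simp add: set_lebesgue_integral_def k_def)
  have "(LINT s:A|lborel. k s) = 0" if A: "A \<in> sets lborel" for A
  proof -
    have A': "A \<in> sigma_sets UNIV (range (\<lambda>a::real. {..a}))"
      using A unfolding sets_lborel borel_eq_atMost by (subst (asm) sets_measure_of) auto
    have gen: "Int_stable (range (\<lambda>a::real. {..a}))" "range (\<lambda>a::real. {..a}) \<subseteq> Pow UNIV"
      by (auto simp: Int_stable_def)
    from gen A' show ?thesis
    proof (induction rule: sigma_sets_induct_disjoint)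
      case (compl A)
      have A: "A \<in> sets lborel"
        using compl unfolding sets_lborel borel_eq_atMost by (subst sets_measure_of) auto
      have "indicator (UNIV - A) s *\<^sub>R k s = k s - indicator A s *\<^sub>R k s" for s by (auto simp: indicator_def)
      then show ?case using compl A k UNIV
        by (simp add: set_lebesgue_integral_def integrable_mult_indicator)
    next
      case (union A)
      have A: "A i \<in> sets lborel" for i
        using union unfolding sets_lborel borel_eq_atMost by (subst sets_measure_of) auto
      have "(LINT s:(\<Union>i. A i)|lborel. k s) = (\<Sum>i. LINT s:A i|lborel. k s)"
      proof (rule lebesgue_integral_countable_add)
        show "set_integrable lborel (\<Union>i. A i) k"
          unfolding set_integrable_def using k A by (intro integrable_mult_indicator) auto
        show "A i \<inter> A j = {}" if "i \<noteq> j" for i j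
          using union.hyps(1) that by (auto simp: disjoint_family_on_def)
      qed (use A in auto)
      then show ?case using union by simp
    qed (use atMost in \<open>auto simp: set_lebesgue_integral_def\<close>)
  qed
  then have "AE s in lborel. k s = 0" by (intro sigma_finite_measure.density_zero[OF lborel.sigma_finite_measure_axioms] k) auto
  then show ?thesis by eventually_elim (auto simp: k_def)
qed

text \<open>Chaining along the dyadic approximations of \<open>t\<close>: the levels above
  \<open>m\<close> contribute at most the sum of \<open>c * (3 / 4) ^ j\<close> over j \<ge> 1,
  which is \<open>3 * c\<close>, and the position inside the cell of level \<open>m\<close> at most
  one further \<open>c\<close>.\<close>

lemma interpolation_error_le:
  fixes w :: "real \<Rightarrow> 'a::euclidean_space"
  assumes T: "0 < T" and w: "continuous_on {0..T} w" and c: "0 \<le> c"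
    and small: "\<And>j i. i < 2 ^ (m + j) \<Longrightarrow> norm (incr T (m + j) w i) \<le> c * (3 / 4) ^ j"
    and t: "t \<in> {0..T}"
  shows "norm (w t - (w 0 + (LINT s:{0..t}|lborel. step T m w s))) \<le> 4 * c"
proof -
  define q where "q k = grid T k (dyadic_floor T k t)" for k
  note fl = dyadic_floor_bounds[OF T t]
  note qt = dyadic_floor_tendsto[OF T t, folded q_def]
  have q_in: "q k \<in> {0..T}" for k unfolding q_def by (rule grid_in[OF T fl(1)])
  have one: "norm (w (q (m + Suc j)) - w (q (m + j))) \<le> c * (3 / 4) ^ Suc j" for j
  proof -
    let ?i = "dyadic_floor T (m + j) t"
    from dyadic_floor_Suc[OF T t, of "m + j"] show ?thesis
    proof
      assume "dyadic_floor T (Suc (m + j)) t = 2 * ?i"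
      then have "q (m + Suc j) = q (m + j)" by (simp add: q_def grid_refine)
      then show ?thesis using c by simp
    next
      assume e: "dyadic_floor T (Suc (m + j)) t = Suc (2 * ?i)"
      then have "2 * ?i < 2 ^ (m + Suc j)" using fl(1)[of "Suc (m + j)"] by simp
      then have "norm (incr T (m + Suc j) w (2 * ?i)) \<le> c * (3 / 4) ^ Suc j" by (rule small)
      moreover have "w (q (m + Suc j)) - w (q (m + j)) = incr T (m + Suc j) w (2 * ?i)"
        using e by (simp add: q_def incr_def grid_refine)
      ultimately show ?thesis by simp
    qed
  qed
  \<comment> \<open>The right side is the partial sum of the geometric series from 1 to
    \<open>n\<close>.\<close>
  have "norm (w (q (m + n)) - w (q m)) \<le> 3 * c * (1 - (3 / 4) ^ n)" for n
  proof (induction n)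
    case (Suc n)
    have "norm (w (q (m + Suc n)) - w (q m))
        \<le> norm (w (q (m + Suc n)) - w (q (m + n))) + norm (w (q (m + n)) - w (q m))"
      using norm_triangle_ineq[of "w (q (m + Suc n)) - w (q (m + n))" "w (q (m + n)) - w (q m)"] by simp
    also have "\<dots> \<le> c * (3 / 4) ^ Suc n + 3 * c * (1 - (3 / 4) ^ n)"
      by (intro add_mono one Suc)
    also have "\<dots> = 3 * c * (1 - (3 / 4) ^ Suc n)" by (simp add: field_simps)
    finally show ?case .
  qed simp
  moreover have "3 * c * (1 - (3 / 4) ^ n) \<le> 3 * c" for n :: nat
    using c by (simp add: mult_left_le)
  ultimately have *: "norm (w (q (m + n)) - w (q m)) \<le> 3 * c" for n by (meson order_trans)
  have "(\<lambda>k. w (q k)) \<longlonglongrightarrow> w t"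
    using w t q_in qt by (auto simp: continuous_on_sequentially comp_def)
  then have "(\<lambda>n. w (q (n + m))) \<longlonglongrightarrow> w t" by (rule LIMSEQ_ignore_initial_segment)
  then have "(\<lambda>n. norm (w (q (m + n)) - w (q m))) \<longlonglongrightarrow> norm (w t - w (q m))"
    by (intro tendsto_intros) (simp add: add.commute)
  then have 1: "norm (w t - w (q m)) \<le> 3 * c"
    by (rule LIMSEQ_le_const2) (use * in blast)
  have 2: "norm (w (q m) - (w 0 + (LINT s:{0..t}|lborel. step T m w s))) \<le> c"
  proof (cases "dyadic_floor T m t < 2 ^ m")
    case True
    let ?i = "dyadic_floor T m t"
    have "(LINT s:{0..t}|lborel. step T m w s) - (LINT s:{0..q m}|lborel. step T m w s)
        = (LINT s:{q m..t}|lborel. step T m w s)"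
      using q_in[of m] t fl(2)[of m] unfolding q_def
      by (intro LINT_interval_diff[where T = T]) auto
    also have "\<dots> = ((t - q m) / (T / 2 ^ m)) *\<^sub>R incr T m w ?i"
      unfolding q_def using True fl[of m] by (intro LINT_step_cell[OF T]) (auto simp: grid_Suc)
    finally have "w (q m) - (w 0 + (LINT s:{0..t}|lborel. step T m w s))
        = - (((t - q m) / (T / 2 ^ m)) *\<^sub>R incr T m w ?i)"
      using LINT_step_grid[OF T fl(1), of m w] by (simp add: q_def algebra_simps)
    then have "norm (w (q m) - (w 0 + (LINT s:{0..t}|lborel. step T m w s)))
        = \<bar>(t - q m) / (T / 2 ^ m)\<bar> * norm (incr T m w ?i)"
      by simp
    also have "\<dots> \<le> 1 * c"
    proof (intro mult_mono)
      show "\<bar>(t - q m) / (T / 2 ^ m)\<bar> \<le> 1"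
        using fl(2,3)[of m] T by (simp add: q_def field_simps)
      show "norm (incr T m w ?i) \<le> c" using small[of ?i 0] True by simp
    qed auto
    finally show ?thesis by simp
  next
    \<comment> \<open>This happens only at \<open>t = T\<close>, where the interpolation is
      exact.\<close>
    case False
    then have e: "dyadic_floor T m t = 2 ^ m" using fl(1)[of m] by simp
    then have "t = T" using fl(2)[of m] t by simp
    then show ?thesis using LINT_step_grid[OF T, of "2 ^ m" m w] e c by (simp add: q_def)
  qed
  have "norm (w t - (w 0 + (LINT s:{0..t}|lborel. step T m w s)))
     \<le> norm (w t - w (q m)) + norm (w (q m) - (w 0 + (LINT s:{0..t}|lborel. step T m w s)))"
    using norm_triangle_ineq[of "w t - w (q m)" "w (q m) - (w 0 + (LINT s:{0..t}|lborel. step T m w s))"]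
    by (simp add: algebra_simps)
  with 1 2 show ?thesis by linarith
qed

lemma step_in_L2_fun:
  assumes "0 < T" shows "step T m w \<in> L2_fun T"
  unfolding L2_fun_iff
proof
  show "set_borel_measurable lborel {0..T} (step T m w)"
    by (simp add: set_borel_measurable_def)
  show "set_integrable lborel {0..T} (\<lambda>s. (norm (step T m w s))\<^sup>2)"
    unfolding set_integrable_def power2_norm_eq_inner using LINT_inner_step(2)[OF assms order_refl, of m w]
    by (intro integrable_mult_indicator) auto
qed

lemma LINT_norm_step_le_energy:
  fixes w :: "real \<Rightarrow> 'a::euclidean_space"
  assumes T: "0 < T"
  shows "(LINT s:{0..T}|lborel. (norm (step T m w s))\<^sup>2) \<le> energy T m w"
proof -
  have "(LINT s:{0..T}|lborel. (norm (step T m w s))\<^sup>2) \<le> (LINT s|lborel. (norm (step T m w s))\<^sup>2)"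
    unfolding set_lebesgue_integral_def power2_norm_eq_inner using LINT_inner_step(2)[OF T order_refl, of m w]
    by (intro integral_mono integrable_mult_indicator) (auto simp: indicator_def)
  also have "\<dots> = energy T m w"
    unfolding power2_norm_eq_inner by (rule LINT_inner_step(1)[OF T order_refl])
  finally show ?thesis .
qed

text \<open>The interpolation has density \<open>step T m w\<close>, whose squared L2 norm is
  \<open>energy T m w\<close>. Thus a bound on one energy of \<open>w\<close> controls the energies
  of its interpolation on all levels, also the finer ones.\<close>

lemma energy_interpolation_le:
  assumes "0 < T"
  shows "energy T n (\<lambda>t. LINT s:{0..t}|lborel. step T m w s) \<le> energy T m w"
  by (rule order_trans[OF energy_le_LINT[OF assms step_in_L2_fun[OF assms]] LINT_norm_step_le_energy[OF assms]]) simp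


section \<open>Gaussian estimates\<close>

text \<open>Since 1/(2 s) - (1 - \<eta>)/(2 s) = \<eta>/(2 s), the tilted density is again Gaussian,
  with variance s/\<eta>; the factor accounts for the changed normalization.\<close>

lemma normal_density_times_exp:
  assumes "0 < s" "0 < \<eta>"
  shows "normal_density 0 (sqrt s) x * exp ((1 - \<eta>) * x\<^sup>2 / (2 * s))
    = (1 / sqrt \<eta>) * normal_density 0 (sqrt (s / \<eta>)) x"
proof -
  have "exp (- x\<^sup>2 / (2 * s)) * exp ((1 - \<eta>) * x\<^sup>2 / (2 * s)) = exp (- x\<^sup>2 / (2 * (s / \<eta>)))"
    using assms unfolding mult_exp_exp by (simp add: field_simps)
  moreover have "1 / sqrt (2 * pi * s) = (1 / sqrt \<eta>) * (1 / sqrt (2 * pi * (s / \<eta>)))"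
    using assms by (simp add: real_sqrt_mult real_sqrt_divide)
  ultimately show ?thesis
    using assms by (simp add: normal_density_def)
qed

text \<open>The squared norm is a sum over the orthonormal basis, so the integral factorizes into
  one-dimensional Gaussian integrals. Positivity of \<eta> keeps the exponent below the critical
  value 1/(2 s).\<close>

lemma gaussian_exp_moment:
  assumes "0 < s" "0 < \<eta>"
  shows "(\<integral>\<^sup>+y. ennreal (\<Prod>b\<in>Basis. normal_density 0 (sqrt s) (y \<bullet> b))
      * ennreal (exp ((1 - \<eta>) * (norm (y::'a::euclidean_space))\<^sup>2 / (2 * s))) \<partial>lborel)
    = ennreal ((1 / sqrt \<eta>) ^ DIM('a))"
proof -
  let ?f = "\<lambda>x. (1 / sqrt \<eta>) * normal_density 0 (sqrt (s / \<eta>)) x"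
  have "ennreal (\<Prod>b\<in>Basis. normal_density 0 (sqrt s) (y \<bullet> b)) * ennreal (exp ((1 - \<eta>) * (norm y)\<^sup>2 / (2 * s)))
      = (\<Prod>b\<in>Basis. ennreal (?f (y \<bullet> b)))" for y :: 'a
  proof -
    have "(norm y)\<^sup>2 = (\<Sum>b\<in>Basis. (y \<bullet> b)\<^sup>2)"
      unfolding power2_norm_eq_inner by (subst euclidean_inner) (simp add: power2_eq_square)
    then have "exp ((1 - \<eta>) * (norm y)\<^sup>2 / (2 * s)) = (\<Prod>b\<in>Basis. exp ((1 - \<eta>) * (y \<bullet> b)\<^sup>2 / (2 * s)))"
      by (simp add: exp_sum[symmetric] sum_distrib_left sum_divide_distrib)
    then have "(\<Prod>b\<in>Basis. normal_density 0 (sqrt s) (y \<bullet> b)) * exp ((1 - \<eta>) * (norm y)\<^sup>2 / (2 * s))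
      = (\<Prod>b\<in>Basis. ?f (y \<bullet> b))"
      by (simp only: prod.distrib[symmetric] normal_density_times_exp[OF assms])
    then show ?thesis using assms
      by (simp add: ennreal_mult'[symmetric] prod_ennreal prod_nonneg)
  qed
  then have "(\<integral>\<^sup>+y. ennreal (\<Prod>b\<in>Basis. normal_density 0 (sqrt s) (y \<bullet> b))
      * ennreal (exp ((1 - \<eta>) * (norm y)\<^sup>2 / (2 * s))) \<partial>(lborel :: 'a measure))
    = (\<integral>\<^sup>+y. (\<Prod>b\<in>Basis. ennreal (?f (y \<bullet> b))) \<partial>(lborel :: 'a measure))"
    by simp
  also have "\<dots> = (\<Prod>b\<in>(Basis :: 'a set). \<integral>\<^sup>+x. ennreal (?f x) \<partial>lborel)"
    by (rule nn_integral_lborel_prod) auto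
  also have "(\<integral>\<^sup>+x. ennreal (?f x) \<partial>lborel) = ennreal (1 / sqrt \<eta>)"
    using assms by (subst nn_integral_eq_integral) auto
  finally show ?thesis using assms by (simp add: ennreal_power)
qed

section \<open>Brownian increments on a dyadic grid\<close>

lemma
  assumes "brownian_motion M W"
  shows brownian_motion_prob_space: "prob_space M"
    and brownian_motion_measurable: "\<And>t. 0 \<le> t \<Longrightarrow> W t \<in> borel_measurable M"
    and brownian_motion_AE: "AE \<omega> in M. W 0 \<omega> = 0 \<and> continuous_on {0..} (\<lambda>t. W t \<omega>)"
    and brownian_motion_distributed: "\<And>s t. 0 \<le> s \<Longrightarrow> s < t \<Longrightarrow>
        distributed M lborel (\<lambda>\<omega>. W t \<omega> - W s \<omega>)
          (\<lambda>y. ennreal (\<Prod>b\<in>Basis. normal_density 0 (sqrt (t - s)) (y \<bullet> b)))"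
  using assms unfolding brownian_motion_def by auto

lemma grid_nonneg: "0 < T \<Longrightarrow> 0 \<le> grid T m i"
  by (simp add: grid_def)

lemma brownian_motion_incr_measurable [measurable (raw)]:
  assumes "brownian_motion M W" "0 < T"
  shows "(\<lambda>\<omega>. incr T m (\<lambda>t. W t \<omega>) i) \<in> borel_measurable M"
  unfolding incr_def using brownian_motion_measurable[OF assms(1)] grid_nonneg[OF assms(2)] by measurable

lemma brownian_motion_incr_indep:
  assumes "brownian_motion M W" "0 < T"
  shows "prob_space.indep_vars M (\<lambda>_. borel) (\<lambda>i \<omega>. incr T m (\<lambda>t. W t \<omega>) i) {..<n}"
proof -
  have "\<forall>(n::nat) (\<tau> :: nat \<Rightarrow> real). 0 \<le> \<tau> 0 \<and> (\<forall>i<n. \<tau> i \<le> \<tau> (Suc i)) \<longrightarrow>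
        prob_space.indep_vars M (\<lambda>_. borel) (\<lambda>i \<omega>. W (\<tau> (Suc i)) \<omega> - W (\<tau> i) \<omega>) {..<n}"
    using assms(1) by (simp add: brownian_motion_def)
  from this[rule_format, of "grid T m" n] show ?thesis
    unfolding incr_def using grid_mono[OF assms(2)] by simp
qed

lemma brownian_motion_incr_distributed:
  assumes "brownian_motion M (W :: real \<Rightarrow> 'w \<Rightarrow> 'a::euclidean_space)" "0 < T"
  shows "distributed M lborel (\<lambda>\<omega>. incr T m (\<lambda>t. W t \<omega>) i)
          (\<lambda>y. ennreal (\<Prod>b\<in>Basis. normal_density 0 (sqrt (T / 2 ^ m)) (y \<bullet> b)))"
  using brownian_motion_distributed[OF assms(1), of "grid T m i" "grid T m (Suc i)"] grid_nonneg[OF assms(2)] assms(2)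
  by (simp add: incr_def grid_Suc)

lemma incr_exp_moment:
  assumes "brownian_motion M (W :: real \<Rightarrow> 'w \<Rightarrow> 'a::euclidean_space)" "0 < T" "0 < \<eta>"
  shows "(\<integral>\<^sup>+\<omega>. ennreal (exp ((1 - \<eta>) * (norm (incr T m (\<lambda>t. W t \<omega>) i))\<^sup>2 / (2 * (T / 2 ^ m)))) \<partial>M)
    = ennreal ((1 / sqrt \<eta>) ^ DIM('a))"
  using distributed_nn_integral[OF brownian_motion_incr_distributed[OF assms(1,2)],
      of "\<lambda>y. ennreal (exp ((1 - \<eta>) * (norm y)\<^sup>2 / (2 * (T / 2 ^ m))))" m i]
    gaussian_exp_moment[of "T / 2 ^ m" \<eta>, where 'a = 'a] assms
  by simp

text \<open>Chernoff's bound; \<open>c\<close> may have any sign.\<close>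

lemma exp_Markov:
  assumes [measurable]: "Z \<in> borel_measurable M" and "0 \<le> \<theta>"
  shows "emeasure M {\<omega>\<in>space M. c \<le> Z \<omega>} \<le> ennreal (exp (- (\<theta> * c))) * (\<integral>\<^sup>+\<omega>. ennreal (exp (\<theta> * Z \<omega>)) \<partial>M)"
proof -
  have "emeasure M {\<omega>\<in>space M. c \<le> Z \<omega>} = (\<integral>\<^sup>+\<omega>. indicator {\<omega>\<in>space M. c \<le> Z \<omega>} \<omega> \<partial>M)"
    by simp
  also have "\<dots> \<le> (\<integral>\<^sup>+\<omega>. ennreal (exp (- (\<theta> * c))) * ennreal (exp (\<theta> * Z \<omega>)) \<partial>M)"
  proof (rule nn_integral_mono)
    fix \<omega>
    have "1 \<le> exp (- (\<theta> * c)) * exp (\<theta> * Z \<omega>)" if "c \<le> Z \<omega>"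
      using mult_left_mono[OF that assms(2)] unfolding mult_exp_exp by simp
    then show "indicator {\<omega>\<in>space M. c \<le> Z \<omega>} \<omega> \<le> ennreal (exp (- (\<theta> * c))) * ennreal (exp (\<theta> * Z \<omega>))"
      by (auto simp: indicator_def ennreal_mult'[symmetric])
  qed
  also have "\<dots> = ennreal (exp (- (\<theta> * c))) * (\<integral>\<^sup>+\<omega>. ennreal (exp (\<theta> * Z \<omega>)) \<partial>M)"
    by (rule nn_integral_cmult) measurable
  finally show ?thesis .
qed

text \<open>Chernoff's bound at half the critical exponent, that is with \<eta> = 1/2, where the
  moment equals \<open>sqrt 2 ^ DIM('a)\<close>.\<close>

lemma incr_tail:
  assumes "brownian_motion M (W :: real \<Rightarrow> 'w \<Rightarrow> 'a::euclidean_space)" "0 < T" "0 \<le> c"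
  shows "emeasure M {\<omega>\<in>space M. c \<le> norm (incr T m (\<lambda>t. W t \<omega>) i)}
    \<le> ennreal (sqrt 2 ^ DIM('a) * exp (- (c\<^sup>2 / (4 * (T / 2 ^ m)))))"
proof -
  note [measurable] = brownian_motion_incr_measurable[OF assms(1,2)]
  let ?\<theta> = "1 / (4 * (T / 2 ^ m))"
  have "{\<omega>\<in>space M. c \<le> norm (incr T m (\<lambda>t. W t \<omega>) i)} = {\<omega>\<in>space M. c\<^sup>2 \<le> (norm (incr T m (\<lambda>t. W t \<omega>) i))\<^sup>2}"
    using assms(3) abs_le_square_iff[of c] by auto
  also have "emeasure M \<dots> \<le> ennreal (exp (- (?\<theta> * c\<^sup>2)))
      * (\<integral>\<^sup>+\<omega>. ennreal (exp (?\<theta> * (norm (incr T m (\<lambda>t. W t \<omega>) i))\<^sup>2)) \<partial>M)"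
    using assms(2) by (intro exp_Markov) auto
  also have "(\<integral>\<^sup>+\<omega>. ennreal (exp (?\<theta> * (norm (incr T m (\<lambda>t. W t \<omega>) i))\<^sup>2)) \<partial>M) = ennreal (sqrt 2 ^ DIM('a))"
    using incr_exp_moment[OF assms(1,2), of "1/2" m i] by (simp add: real_sqrt_divide field_simps)
  finally show ?thesis by (simp add: ennreal_mult'[symmetric] mult.commute)
qed

text \<open>The energy is a sum of \<open>2 ^ m\<close> independent terms, so its exponential moment
  is a product. The exponent \<open>(1 - \<eta>) / 2\<close> is just below the critical 1/2; the
  prefactor explodes as \<eta> tends to 0 but depends only on \<eta>, \<open>m\<close> and the
  dimension.\<close>

lemma energy_tail:
  assumes W: "brownian_motion M (W :: real \<Rightarrow> 'w \<Rightarrow> 'a::euclidean_space)" and T: "0 < T" and \<eta>: "0 < \<eta>" "\<eta> < 1"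
  shows "emeasure M {\<omega>\<in>space M. l \<le> energy T m (\<lambda>t. W t \<omega>)}
    \<le> ennreal (((1 / sqrt \<eta>) ^ DIM('a)) ^ (2 ^ m) * exp (- ((1 - \<eta>) / 2 * l)))"
proof -
  interpret prob_space M using brownian_motion_prob_space[OF W] .
  note [measurable] = brownian_motion_incr_measurable[OF W T]
  define Z where "Z i \<omega> = ennreal (exp ((1 - \<eta>) * (norm (incr T m (\<lambda>t. W t \<omega>) i))\<^sup>2 / (2 * (T / 2 ^ m))))" for i \<omega>
  have "indep_vars (\<lambda>_. borel) Z {..<2 ^ m}"
    unfolding Z_def using brownian_motion_incr_indep[OF W T]
    by (rule indep_vars_compose2[where Y = "\<lambda>_ y. ennreal (exp ((1 - \<eta>) * (norm y)\<^sup>2 / (2 * (T / 2 ^ m))))"]) measurable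
  then have Z: "(\<integral>\<^sup>+\<omega>. (\<Prod>i<2 ^ m. Z i \<omega>) \<partial>M) = (\<Prod>i<2 ^ m. \<integral>\<^sup>+\<omega>. Z i \<omega> \<partial>M)"
    by (intro indep_vars_nn_integral) auto
  have "emeasure M {\<omega>\<in>space M. l \<le> energy T m (\<lambda>t. W t \<omega>)}
    \<le> ennreal (exp (- ((1 - \<eta>) / 2 * l))) * (\<integral>\<^sup>+\<omega>. ennreal (exp ((1 - \<eta>) / 2 * energy T m (\<lambda>t. W t \<omega>))) \<partial>M)"
    using \<eta> unfolding energy_def by (intro exp_Markov) auto
  also have "(\<integral>\<^sup>+\<omega>. ennreal (exp ((1 - \<eta>) / 2 * energy T m (\<lambda>t. W t \<omega>))) \<partial>M) = (\<integral>\<^sup>+\<omega>. (\<Prod>i<2 ^ m. Z i \<omega>) \<partial>M)"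
  proof (rule nn_integral_cong)
    fix \<omega>
    have "(1 - \<eta>) / 2 * energy T m (\<lambda>t. W t \<omega>)
      = (\<Sum>i<2 ^ m. (1 - \<eta>) * (norm (incr T m (\<lambda>t. W t \<omega>) i))\<^sup>2 / (2 * (T / 2 ^ m)))"
      unfolding energy_def sum_distrib_left by (intro sum.cong) (auto simp: field_simps)
    then show "ennreal (exp ((1 - \<eta>) / 2 * energy T m (\<lambda>t. W t \<omega>))) = (\<Prod>i<2 ^ m. Z i \<omega>)"
      by (simp add: exp_sum Z_def prod_ennreal)
  qed
  also have "\<dots> = ennreal (((1 / sqrt \<eta>) ^ DIM('a)) ^ (2 ^ m))"
    unfolding Z unfolding Z_def incr_exp_moment[OF W T \<eta>(1)] using \<eta> by (simp add: ennreal_power)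
  finally show ?thesis by (simp add: ennreal_mult'[symmetric] mult.commute)
qed

text \<open>The thresholds \<open>d (3/4)\<^sup>j\<close> decay more slowly than the size \<open>2 powr (- j / 2)\<close> of the increments, so that the union
  bound over all levels is dominated by its first term.\<close>

lemma oscillation_tail:
  assumes W: "brownian_motion M (W :: real \<Rightarrow> 'w \<Rightarrow> 'a::euclidean_space)" and T: "0 < T" and d: "0 < d"
    and \<sigma>: "0 < \<sigma>" "ln 4 \<le> d\<^sup>2 * 2 ^ m / (32 * T * \<sigma>\<^sup>2)"
  shows "emeasure M {\<omega>\<in>space M. \<exists>j. \<exists>i<2 ^ (m + j). d * (3 / 4) ^ j < norm (\<sigma> *\<^sub>R incr T (m + j) (\<lambda>t. W t \<omega>) i)}
    \<le> ennreal (2 * sqrt 2 ^ DIM('a) * 2 ^ m * exp (- (d\<^sup>2 * 2 ^ m / (4 * T)) / \<sigma>\<^sup>2))"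
proof -
  note [measurable] = brownian_motion_incr_measurable[OF W T]
  \<comment> \<open>The exponent of the tail bound at level \<open>j = 0\<close>. At level
    \<open>j\<close> it grows to \<open>B * (9 / 8) ^ j\<close>: the squared threshold shrinks by
    9/16 per level while the variance of an increment halves.\<close>
  define B where "B = d\<^sup>2 * 2 ^ m / (4 * T * \<sigma>\<^sup>2)"
  have B: "ln 4 \<le> B / 8" using \<sigma>(2) by (simp add: B_def mult.assoc)
  define C where "C = sqrt 2 ^ DIM('a) * 2 ^ m * exp (- B)"
  let ?A = "\<lambda>j i. {\<omega>\<in>space M. d * (3 / 4) ^ j / \<sigma> \<le> norm (incr T (m + j) (\<lambda>t. W t \<omega>) i)}"
  have A: "emeasure M (\<Union>i<2 ^ (m + j). ?A j i) \<le> ennreal (C * (1 / 2) ^ j)" for j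
  proof -
    have "emeasure M (\<Union>i<2 ^ (m + j). ?A j i) \<le> (\<Sum>i<2 ^ (m + j). emeasure M (?A j i))"
      by (intro emeasure_subadditive_finite) auto
    also have "\<dots> \<le> (\<Sum>i<(2::nat) ^ (m + j). ennreal (sqrt 2 ^ DIM('a) * exp (- ((d * (3 / 4) ^ j / \<sigma>)\<^sup>2 / (4 * (T / 2 ^ (m + j)))))))"
      using d \<sigma> by (intro sum_mono incr_tail[OF W T]) auto
    also have "(d * (3 / 4) ^ j / \<sigma>)\<^sup>2 / (4 * (T / 2 ^ (m + j))) = B * (9 / 8) ^ j"
    proof -
      have "((3 / 4 :: real) ^ j)\<^sup>2 * 2 ^ j = (9 / 8) ^ j"
      proof -
        have "((3 / 4 :: real) ^ j)\<^sup>2 = ((3 / 4)\<^sup>2) ^ j" by (simp only: power_mult[symmetric] mult.commute)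
        then have "((3 / 4 :: real) ^ j)\<^sup>2 * 2 ^ j = ((3 / 4)\<^sup>2 * 2) ^ j" by (simp only: power_mult_distrib)
        also have "(3 / 4)\<^sup>2 * 2 = (9 / 8 :: real)" by (simp add: power2_eq_square)
        finally show ?thesis .
      qed
      moreover have "(d * p / \<sigma>)\<^sup>2 / (4 * (T / 2 ^ (m + j))) = d\<^sup>2 * 2 ^ m / (4 * T * \<sigma>\<^sup>2) * (p\<^sup>2 * 2 ^ j)" for p
        by (simp add: power_mult_distrib power_divide power_add mult_ac)
      ultimately show ?thesis by (simp add: B_def)
    qed
    also have "(\<Sum>i<(2::nat) ^ (m + j). ennreal (sqrt 2 ^ DIM('a) * exp (- (B * (9 / 8) ^ j))))
        = ennreal (2 ^ (m + j) * (sqrt 2 ^ DIM('a) * exp (- (B * (9 / 8) ^ j))))"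
      by (subst sum_ennreal) auto
    also have "\<dots> \<le> ennreal (C * (1 / 2) ^ j)"
    proof (rule ennreal_leI)
      have B0: "0 \<le> B" using T \<sigma> by (simp add: B_def)
      \<comment> \<open>By Bernoulli, level \<open>j\<close> gains at least the factor exp(- j B /
        8), which is at most \<open>(1 / 4) ^ j\<close> because \<open>ln 4 \<le> B / 8\<close>.
        This beats the \<open>2 ^ j\<close> additional increments and leaves the summable
        \<open>(1 / 2) ^ j\<close>.\<close>
      have "1 + real j * (1 / 8) \<le> (1 + 1 / 8) ^ j" by (rule Bernoulli_inequality) simp
      then have "B * (1 + real j / 8) \<le> B * (9 / 8) ^ j" using B0 by (intro mult_left_mono) auto
      moreover have "B * (1 + real j / 8) = B + real j * (B / 8)" by (simp add: algebra_simps)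
      moreover have "real j * ln 4 \<le> real j * (B / 8)" using B by (intro mult_left_mono) auto
      ultimately have "- (B * (9 / 8) ^ j) \<le> - B + - (real j * ln 4)" by linarith
      then have "exp (- (B * (9 / 8) ^ j)) \<le> exp (- B) * exp (- (real j * ln 4))"
        unfolding mult_exp_exp exp_le_cancel_iff .
      also have "exp (- (real j * ln 4)) = (1 / 4) ^ j"
        by (simp add: exp_minus exp_of_nat_mult power_divide inverse_eq_divide)
      finally have "2 ^ (m + j) * (sqrt 2 ^ DIM('a) * exp (- (B * (9 / 8) ^ j)))
         \<le> 2 ^ (m + j) * (sqrt 2 ^ DIM('a) * (exp (- B) * (1 / 4) ^ j))"
        by (intro mult_left_mono) auto
      also have "\<dots> = C * (2 ^ j * (1 / 4) ^ j)" by (simp add: C_def power_add)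
      also have "2 ^ j * (1 / 4) ^ j = (1 / 2 :: real) ^ j" by (simp add: power_mult_distrib[symmetric])
      finally show "2 ^ (m + j) * (sqrt 2 ^ DIM('a) * exp (- (B * (9 / 8) ^ j))) \<le> C * (1 / 2) ^ j" .
    qed
    finally show ?thesis .
  qed
  have "{\<omega>\<in>space M. \<exists>j. \<exists>i<2 ^ (m + j). d * (3 / 4) ^ j < norm (\<sigma> *\<^sub>R incr T (m + j) (\<lambda>t. W t \<omega>) i)}
     \<subseteq> (\<Union>j. \<Union>i<2 ^ (m + j). ?A j i)"
    using \<sigma> by (force simp: field_simps)
  then have "emeasure M {\<omega>\<in>space M. \<exists>j. \<exists>i<2 ^ (m + j). d * (3 / 4) ^ j < norm (\<sigma> *\<^sub>R incr T (m + j) (\<lambda>t. W t \<omega>) i)}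
    \<le> emeasure M (\<Union>j. \<Union>i<2 ^ (m + j). ?A j i)"
    by (intro emeasure_mono) auto
  also have "\<dots> \<le> (\<Sum>j. emeasure M (\<Union>i<2 ^ (m + j). ?A j i))"
    by (intro emeasure_subadditive_countably) auto
  also have "\<dots> \<le> (\<Sum>j. ennreal (C * (1 / 2) ^ j))"
    by (intro suminf_le A) auto
  also have "\<dots> = ennreal (C * 2)"
  proof (rule suminf_ennreal_eq)
    show "(\<lambda>j. C * (1 / 2) ^ j) sums (C * 2)"
      using sums_mult[OF geometric_sums[of "1 / 2 :: real"], of C] by simp
  qed (simp add: C_def)
  finally show ?thesis by (simp add: C_def B_def mult_ac)
qed

section \<open>Lower bounds for Brownian increments near prescribed values\<close>

lemma prod_gaussian_density:
  assumes "0 < s"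
  shows "(\<Prod>b\<in>Basis. normal_density 0 (sqrt s) ((y :: 'a::euclidean_space) \<bullet> b))
    = (1 / sqrt (2 * pi * s)) ^ DIM('a) * exp (- ((norm y)\<^sup>2 / (2 * s)))"
proof -
  have "(norm y)\<^sup>2 = (\<Sum>b\<in>Basis. (y \<bullet> b)\<^sup>2)"
    unfolding power2_norm_eq_inner by (subst euclidean_inner) (simp add: power2_eq_square)
  then have "exp (- ((norm y)\<^sup>2 / (2 * s))) = (\<Prod>b\<in>Basis. exp (- (y \<bullet> b)\<^sup>2 / (2 * s)))"
    by (simp add: exp_sum[symmetric] sum_divide_distrib sum_negf)
  then show ?thesis using assms
    by (simp add: normal_density_def prod_dividef power_one_over)
qed

text \<open>Because \<sigma> \<le> 1, the set of admissible increments contains the ball of radius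
  \<rho> around a/\<sigma>, whose volume does not depend on \<sigma>. On that set the density is at
  least its value at distance (|a| + \<rho>)/\<sigma> from the origin.\<close>

lemma incr_near_lower_bound:
  assumes W: "brownian_motion M (W :: real \<Rightarrow> 'w \<Rightarrow> 'a::euclidean_space)" and T: "0 < T" and \<rho>: "0 < \<rho>"
    and \<sigma>: "0 < \<sigma>" "\<sigma> \<le> 1"
  shows "(1 / sqrt (2 * pi * (T / 2 ^ m))) ^ DIM('a) * (unit_ball_vol DIM('a) * \<rho> ^ DIM('a))
      * exp (- ((norm a + \<rho>)\<^sup>2 / (2 * \<sigma>\<^sup>2 * (T / 2 ^ m))))
    \<le> measure M {\<omega>\<in>space M. norm (\<sigma> *\<^sub>R incr T m (\<lambda>t. W t \<omega>) i - a) < \<rho>}"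
proof -
  interpret prob_space M using brownian_motion_prob_space[OF W] .
  let ?h = "T / 2 ^ m" and ?B = "{y :: 'a. norm (\<sigma> *\<^sub>R y - a) < \<rho>}"
  let ?c = "(1 / sqrt (2 * pi * ?h)) ^ DIM('a) * exp (- ((norm a + \<rho>)\<^sup>2 / (2 * \<sigma>\<^sup>2 * ?h)))"
  have [measurable]: "?B \<in> sets borel" by measurable
  have h: "0 < ?h" using T by simp
  have sub: "ball (a /\<^sub>R \<sigma>) \<rho> \<subseteq> ?B"
  proof
    fix y assume "y \<in> ball (a /\<^sub>R \<sigma>) \<rho>"
    then have "\<sigma> * norm (y - a /\<^sub>R \<sigma>) < 1 * \<rho>"
      using \<sigma> by (intro mult_le_less_imp_less) (auto simp: dist_norm norm_minus_commute)
    moreover have "\<sigma> *\<^sub>R y - a = \<sigma> *\<^sub>R (y - a /\<^sub>R \<sigma>)" using \<sigma> by (simp add: algebra_simps)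
    ultimately show "y \<in> ?B" using \<sigma> by simp
  qed
  have c: "?c \<le> (\<Prod>b\<in>Basis. normal_density 0 (sqrt ?h) (y \<bullet> b))" if "y \<in> ?B" for y
  proof -
    have "norm (\<sigma> *\<^sub>R y) \<le> norm a + \<rho>"
      using that norm_triangle_ineq[of "\<sigma> *\<^sub>R y - a" a] by simp
    then have "(norm (\<sigma> *\<^sub>R y))\<^sup>2 \<le> (norm a + \<rho>)\<^sup>2" by (intro power_mono) auto
    then have "(norm y)\<^sup>2 \<le> (norm a + \<rho>)\<^sup>2 / \<sigma>\<^sup>2" using \<sigma> by (simp add: power_mult_distrib field_simps)
    then have "(norm y)\<^sup>2 / (2 * ?h) \<le> (norm a + \<rho>)\<^sup>2 / \<sigma>\<^sup>2 / (2 * ?h)" using h by (intro divide_right_mono) auto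
    also have "\<dots> = (norm a + \<rho>)\<^sup>2 / (2 * \<sigma>\<^sup>2 * ?h)" by (simp add: mult_ac)
    finally show ?thesis unfolding prod_gaussian_density[OF h]
      using h T by (intro mult_left_mono zero_le_power) auto
  qed
  have "ennreal (unit_ball_vol DIM('a) * \<rho> ^ DIM('a) * ?c) = (\<integral>\<^sup>+y. ennreal ?c * indicator (ball (a /\<^sub>R \<sigma>) \<rho>) y \<partial>lborel)"
    using \<rho> by (subst nn_integral_cmult_indicator) (auto simp: emeasure_ball ennreal_mult'[symmetric] mult.commute)
  also have "\<dots> \<le> (\<integral>\<^sup>+y. ennreal (\<Prod>b\<in>Basis. normal_density 0 (sqrt ?h) (y \<bullet> b)) * indicator ?B y \<partial>lborel)"
    using sub c by (intro nn_integral_mono) (auto simp: indicator_def intro!: ennreal_leI)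
  also have "\<dots> = emeasure M ((\<lambda>\<omega>. incr T m (\<lambda>t. W t \<omega>) i) -` ?B \<inter> space M)"
    by (subst distributed_emeasure[OF brownian_motion_incr_distributed[OF W T]]) auto
  also have "(\<lambda>\<omega>. incr T m (\<lambda>t. W t \<omega>) i) -` ?B \<inter> space M = {\<omega>\<in>space M. norm (\<sigma> *\<^sub>R incr T m (\<lambda>t. W t \<omega>) i - a) < \<rho>}"
    by auto
  finally show ?thesis
    unfolding emeasure_eq_measure by (subst (asm) ennreal_le_iff) (auto simp: mult_ac)
qed

text \<open>By independence the bounds for the single increments multiply. The constant is chosen
  before \<sigma>, hence is negligible on the scale \<sigma>^2 log.\<close>

lemma all_incr_near_lower_bound:
  assumes W: "brownian_motion M (W :: real \<Rightarrow> 'w \<Rightarrow> 'a::euclidean_space)" and T: "0 < T" and \<rho>: "0 < \<rho>"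
  shows "\<exists>c>0. \<forall>\<sigma>. 0 < \<sigma> \<longrightarrow> \<sigma> \<le> 1 \<longrightarrow>
    c * exp (- ((\<Sum>i<2 ^ m. (norm (a i) + \<rho>)\<^sup>2 / (T / 2 ^ m)) / (2 * \<sigma>\<^sup>2)))
    \<le> measure M {\<omega>\<in>space M. \<forall>i<2 ^ m. norm (\<sigma> *\<^sub>R incr T m (\<lambda>t. W t \<omega>) i - a i) < \<rho>}"
proof -
  interpret prob_space M using brownian_motion_prob_space[OF W] .
  let ?h = "T / 2 ^ m"
  define k where "k = (1 / sqrt (2 * pi * ?h)) ^ DIM('a) * (unit_ball_vol DIM('a) * \<rho> ^ DIM('a))"
  have k: "0 < k" using T \<rho> by (auto simp: k_def intro!: mult_pos_pos)
  show ?thesis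
  proof (intro exI[of _ "k ^ (2 ^ m)"] conjI allI impI)
    fix \<sigma> :: real assume \<sigma>: "0 < \<sigma>" "\<sigma> \<le> 1"
    let ?X = "\<lambda>i \<omega>. incr T m (\<lambda>t. W t \<omega>) i" and ?A = "\<lambda>i. {y :: 'a. norm (\<sigma> *\<^sub>R y - a i) < \<rho>}"
    have "k ^ (2 ^ m) * exp (- ((\<Sum>i<2 ^ m. (norm (a i) + \<rho>)\<^sup>2 / ?h) / (2 * \<sigma>\<^sup>2)))
       = (\<Prod>i<2 ^ m. k * exp (- ((norm (a i) + \<rho>)\<^sup>2 / (2 * \<sigma>\<^sup>2 * ?h))))"
      by (simp add: prod.distrib exp_sum[symmetric] sum_negf sum_divide_distrib mult_ac)
    also have "\<dots> \<le> (\<Prod>i<2 ^ m. prob (?X i -` ?A i \<inter> space M))"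
    proof (intro prod_mono conjI)
      fix i :: nat
      have "?X i -` ?A i \<inter> space M = {\<omega>\<in>space M. norm (\<sigma> *\<^sub>R ?X i \<omega> - a i) < \<rho>}" by auto
      then show "k * exp (- ((norm (a i) + \<rho>)\<^sup>2 / (2 * \<sigma>\<^sup>2 * ?h))) \<le> prob (?X i -` ?A i \<inter> space M)"
        unfolding k_def using incr_near_lower_bound[OF W T \<rho> \<sigma>, of m "a i" i] by simp
    qed (use k in auto)
    also have "\<dots> = prob (\<Inter>i<2 ^ m. ?X i -` ?A i \<inter> space M)"
      by (rule indep_varsD_finite[OF brownian_motion_incr_indep[OF W T], symmetric]) (auto simp: lessThan_empty_iff)
    also have "(\<Inter>i<2 ^ m. ?X i -` ?A i \<inter> space M) = {\<omega>\<in>space M. \<forall>i<2 ^ m. norm (\<sigma> *\<^sub>R ?X i \<omega> - a i) < \<rho>}"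
      by (auto simp: lessThan_empty_iff)
    finally show "k ^ (2 ^ m) * exp (- ((\<Sum>i<2 ^ m. (norm (a i) + \<rho>)\<^sup>2 / ?h) / (2 * \<sigma>\<^sup>2)))
       \<le> measure M {\<omega>\<in>space M. \<forall>i<2 ^ m. norm (\<sigma> *\<^sub>R ?X i \<omega> - a i) < \<rho>}" .
  qed (use k in simp)
qed


section \<open>The drift as a functional of the path\<close>

text \<open>The bound \<open>w_occ S t * t \<le> 1\<close> is what tames the occupation weight,
  which behaves like 1/t near 0 when \<open>S = 0\<close>.\<close>

lemma
  assumes "0 \<le> t"
  shows w_init_nonneg: "0 \<le> w_init S t" and w_init_le_1: "w_init S t \<le> 1"
    and w_occ_nonneg: "0 \<le> w_occ S t" and w_occ_times_le_1: "w_occ S t * t \<le> 1"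
proof -
  \<comment> \<open>The sum vanishes only for time 0 with \<open>enn2real S = 0\<close>; division by
    zero then gives 0, consistent with all four bounds.\<close>
  have "enn2real S + t = 0 \<or> 0 < enn2real S + t" using assms enn2real_nonneg[of S] by linarith
  then show "0 \<le> w_init S t" "w_init S t \<le> 1" "0 \<le> w_occ S t" "w_occ S t * t \<le> 1"
    using assms enn2real_nonneg[of S] by (auto simp: w_init_def w_occ_def divide_le_eq_1)
qed

lemma measurable_w_init [measurable]: "w_init S \<in> borel_measurable borel"
  unfolding w_init_def[abs_def] by (cases "S = \<infinity>") simp_all

lemma measurable_w_occ [measurable]: "w_occ S \<in> borel_measurable borel"
  unfolding w_occ_def[abs_def] by (cases "S = \<infinity>") simp_all

section \<open>Integration against the interaction measure\<close>

lemma nn_integral_sum_measure: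
  assumes sets: "sets N = sets borel" "sets \<mu> = sets borel" "sets \<nu> = sets borel"
    and N: "\<And>A. A \<in> sets borel \<Longrightarrow> emeasure N A = a * emeasure \<mu> A + b * emeasure \<nu> A"
    and f: "f \<in> borel_measurable borel"
  shows "(\<integral>\<^sup>+y. f y \<partial>N) = a * (\<integral>\<^sup>+y. f y \<partial>\<mu>) + b * (\<integral>\<^sup>+y. f y \<partial>\<nu>)"
proof -
  note [measurable_cong] = sets
  show ?thesis using f
  proof (induction f rule: borel_measurable_induct)
    case (cong f g)
    then show ?case by (simp add: fun_eq_iff)
  next
    case (set A)
    then show ?case using N by (simp add: sets)
  next
    case (mult u c)
    then show ?case by (simp add: nn_integral_cmult algebra_simps)
  next
    case (add u v)
    then show ?case by (simp add: nn_integral_add algebra_simps)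
  next
    case (seq U)
    have [measurable]: "U i \<in> borel_measurable borel" for i using seq by blast
    have S: "(\<integral>\<^sup>+y. (SUP i. U i y) \<partial>K) = (SUP i. \<integral>\<^sup>+y. U i y \<partial>K)" if "sets K = sets borel" for K :: "'a measure"
    proof -
      have "U i \<in> borel_measurable K" for i using that by measurable
      then show ?thesis by (rule nn_integral_monotone_convergence_SUP[OF seq(3)])
    qed
    have inc: "incseq (\<lambda>i. \<integral>\<^sup>+y. U i y \<partial>K)" for K :: "'a measure"
      using seq(3) by (auto simp: incseq_def le_fun_def intro!: nn_integral_mono)
    have "(\<integral>\<^sup>+y. (SUP i. U i y) \<partial>N) = (SUP i. a * (\<integral>\<^sup>+y. U i y \<partial>\<mu>) + b * (\<integral>\<^sup>+y. U i y \<partial>\<nu>))"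
      using seq by (simp add: S[OF sets(1)])
    also have "\<dots> = (SUP i. a * (\<integral>\<^sup>+y. U i y \<partial>\<mu>)) + (SUP i. b * (\<integral>\<^sup>+y. U i y \<partial>\<nu>))"
      using inc by (intro ennreal_SUP_add) (auto simp: incseq_def intro!: mult_left_mono)
    finally show ?case
      by (simp add: S[OF sets(2)] S[OF sets(3)] SUP_mult_left_ennreal image_comp)
  qed
qed

lemma integral_sum_measure_nonneg:
  fixes f :: "'a::topological_space \<Rightarrow> real"
  assumes sets: "sets N = sets borel" "sets \<mu> = sets borel" "sets \<nu> = sets borel"
    and N: "\<And>A. A \<in> sets borel \<Longrightarrow> emeasure N A = ennreal a * emeasure \<mu> A + ennreal b * emeasure \<nu> A"
    and ab: "0 \<le> a" "0 \<le> b"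
    and f: "f \<in> borel_measurable borel" "\<And>y. 0 \<le> f y" "integrable \<mu> f" "integrable \<nu> f"
  shows "integrable N f" "integral\<^sup>L N f = a * integral\<^sup>L \<mu> f + b * integral\<^sup>L \<nu> f"
proof -
  have "(\<integral>\<^sup>+y. ennreal (f y) \<partial>N) = ennreal a * (\<integral>\<^sup>+y. ennreal (f y) \<partial>\<mu>) + ennreal b * (\<integral>\<^sup>+y. ennreal (f y) \<partial>\<nu>)"
    using f(1) by (intro nn_integral_sum_measure[OF sets N]) auto
  also have "\<dots> = ennreal (a * integral\<^sup>L \<mu> f + b * integral\<^sup>L \<nu> f)"
    using f ab by (simp add: nn_integral_eq_integral ennreal_mult' integral_nonneg_AE)
  finally have "(\<integral>\<^sup>+y. ennreal (f y) \<partial>N) = ennreal (a * integral\<^sup>L \<mu> f + b * integral\<^sup>L \<nu> f)" .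
  moreover have "f \<in> borel_measurable N"
    using f(1) sets(1) by (simp cong: measurable_cong_sets)
  ultimately have "integrable N f \<and> integral\<^sup>L N f = a * integral\<^sup>L \<mu> f + b * integral\<^sup>L \<nu> f"
    using f ab by (subst nn_integral_eq_integrable[symmetric]) (auto simp: integral_nonneg_AE)
  then show "integrable N f" "integral\<^sup>L N f = a * integral\<^sup>L \<mu> f + b * integral\<^sup>L \<nu> f" by auto
qed

text \<open>Each coordinate is split into positive and negative part, to which the nonnegative case
  applies.\<close>

lemma integral_sum_measure:
  fixes f :: "'a::topological_space \<Rightarrow> 'b::euclidean_space"
  assumes sets: "sets N = sets borel" "sets \<mu> = sets borel" "sets \<nu> = sets borel"
    and N: "\<And>A. A \<in> sets borel \<Longrightarrow> emeasure N A = ennreal a * emeasure \<mu> A + ennreal b * emeasure \<nu> A"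
    and ab: "0 \<le> a" "0 \<le> b"
    and f: "f \<in> borel_measurable borel" "integrable \<mu> f" "integrable \<nu> f"
  shows "integral\<^sup>L N f = a *\<^sub>R integral\<^sup>L \<mu> f + b *\<^sub>R integral\<^sup>L \<nu> f"
proof -
  note nonneg = integral_sum_measure_nonneg[OF sets N ab]
  have "integrable N (\<lambda>y. norm (f y))"
    using f by (intro nonneg) auto
  moreover have "f \<in> borel_measurable N"
    using f(1) sets(1) by (simp cong: measurable_cong_sets)
  ultimately have iN: "integrable N f" by (rule integrable_norm_cancel)
  show ?thesis
  proof (rule euclidean_eqI)
    fix i :: 'b assume i: "i \<in> Basis"
    \<comment> \<open>Both parts at once: \<open>c = 1\<close> gives the positive part and
      \<open>c = -1\<close> the negative one.\<close>
    have pos: "integral\<^sup>L N (\<lambda>y. max 0 (c * (f y \<bullet> i))) = a * integral\<^sup>L \<mu> (\<lambda>y. max 0 (c * (f y \<bullet> i)))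
       + b * integral\<^sup>L \<nu> (\<lambda>y. max 0 (c * (f y \<bullet> i)))" for c :: real
      using f by (intro nonneg) auto
    have split: "integral\<^sup>L K f \<bullet> i = integral\<^sup>L K (\<lambda>y. max 0 (1 * (f y \<bullet> i))) - integral\<^sup>L K (\<lambda>y. max 0 ((-1) * (f y \<bullet> i)))"
      if "integrable K f" for K
    proof -
      have "(\<lambda>y. f y \<bullet> i) = (\<lambda>y. max 0 (1 * (f y \<bullet> i)) - max 0 ((-1) * (f y \<bullet> i)))"
        by (auto simp: max_def)
      moreover have "integral\<^sup>L K f \<bullet> i = integral\<^sup>L K (\<lambda>y. f y \<bullet> i)" using that by simp
      ultimately have "integral\<^sup>L K f \<bullet> i = integral\<^sup>L K (\<lambda>y. max 0 (1 * (f y \<bullet> i)) - max 0 ((-1) * (f y \<bullet> i)))"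
        by (simp only:)
      then show ?thesis using that by (subst (asm) Bochner_Integration.integral_diff) auto
    qed
    show "integral\<^sup>L N f \<bullet> i = (a *\<^sub>R integral\<^sup>L \<mu> f + b *\<^sub>R integral\<^sup>L \<nu> f) \<bullet> i"
      unfolding inner_add_left inner_scaleR_left split[OF iN] split[OF f(2)] split[OF f(3)] pos
      by (simp add: algebra_simps)
  qed
qed

text \<open>The occupation part is the image of Lebesgue measure on \<open>{0..t}\<close> under
  \<open>p\<close>. So the set function in the definition is a nonnegative combination of two
  genuine measures, which yields countable additivity and reduces the claim to
  \<open>integral_sum_measure\<close>.\<close>

lemma integral_interaction_measure:
  fixes g :: "'a::euclidean_space \<Rightarrow> 'a"
  assumes M: "sets (Mc x) = sets borel" and t: "0 \<le> t" and p: "continuous_on {0..t} p"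
    and g: "continuous_on UNIV g" "integrable (Mc x) g"
  shows "(\<integral>z. g z \<partial>interaction_measure x p t)
    = w_init (Tc x) t *\<^sub>R (\<integral>z. g z \<partial>Mc x) + w_occ (Tc x) t *\<^sub>R (LINT s:{0..t}|lborel. g (p s))"
proof -
  define R where "R = restrict_space lborel {0..t}"
  define \<nu> where "\<nu> = distr R borel p"
  let ?a = "w_init (Tc x) t" and ?b = "w_occ (Tc x) t"
  have pm [measurable]: "p \<in> borel_measurable R"
  proof -
    have "p \<in> borel_measurable (restrict_space borel {0..t})"
      by (rule borel_measurable_continuous_on_restrict[OF p])
    then show ?thesis unfolding R_def
      by (subst measurable_cong_sets[where M' = "restrict_space borel {0..t}" and N' = borel])
        (simp_all add: sets_restrict_space)
  qed
  have [measurable]: "g \<in> borel_measurable borel" using g(1) by (rule borel_measurable_continuous_onI)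
  have \<nu>: "emeasure \<nu> A = (\<integral>\<^sup>+s\<in>{0..t}. emeasure (return borel (p s)) A \<partial>lborel)" if A: "A \<in> sets borel" for A
  proof -
    have "emeasure \<nu> A = (\<integral>\<^sup>+y. indicator A y \<partial>\<nu>)"
      using A by (simp add: \<nu>_def)
    also have "\<dots> = (\<integral>\<^sup>+s. indicator A (p s) \<partial>R)"
      unfolding \<nu>_def using A by (subst nn_integral_distr) auto
    also have "\<dots> = (\<integral>\<^sup>+s\<in>{0..t}. indicator A (p s) \<partial>lborel)"
      unfolding R_def by (subst nn_integral_restrict_space) auto
    finally show ?thesis using A by simp
  qed
  let ?\<phi> = "\<lambda>A. ennreal ?a * emeasure (Mc x) A + ennreal ?b * emeasure \<nu> A"
  have sets: "sets (interaction_measure x p t) = sets borel"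
    unfolding interaction_measure_def by (subst sets_measure_of) (auto simp: sets.sigma_sets_eq[of borel, simplified])
  have N: "emeasure (interaction_measure x p t) A = ?\<phi> A" if A: "A \<in> sets borel" for A
  proof -
    have "emeasure (interaction_measure x p t) A = ennreal ?a * emeasure (Mc x) A
        + ennreal ?b * (\<integral>\<^sup>+s\<in>{0..t}. emeasure (return borel (p s)) A \<partial>lborel)"
    proof (rule emeasure_measure_of[OF interaction_measure_def])
      show "A \<in> sets (interaction_measure x p t)" using A sets by simp
      show "positive (sets (interaction_measure x p t)) (\<lambda>A. ennreal ?a * emeasure (Mc x) A
        + ennreal ?b * (\<integral>\<^sup>+s\<in>{0..t}. emeasure (return borel (p s)) A \<partial>lborel))"
        by (simp add: positive_def)
      show "countably_additive (sets (interaction_measure x p t)) (\<lambda>A. ennreal ?a * emeasure (Mc x) A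
        + ennreal ?b * (\<integral>\<^sup>+s\<in>{0..t}. emeasure (return borel (p s)) A \<partial>lborel))"
        unfolding countably_additive_def
      proof (intro allI impI)
        fix A :: "nat \<Rightarrow> 'a set"
        assume A: "range A \<subseteq> sets (interaction_measure x p t)" "disjoint_family A"
        then have Ai: "range A \<subseteq> sets borel" and Ai': "A i \<in> sets borel" for i using sets by auto
        then have U: "(\<Union>i. A i) \<in> sets borel" by blast
        have "(\<Sum>i. ?\<phi> (A i)) = (\<Sum>i. ennreal ?a * emeasure (Mc x) (A i)) + (\<Sum>i. ennreal ?b * emeasure \<nu> (A i))"
          by (intro suminf_add[symmetric] summableI)
        also have "\<dots> = ennreal ?a * (\<Sum>i. emeasure (Mc x) (A i)) + ennreal ?b * (\<Sum>i. emeasure \<nu> (A i))"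
          by simp
        also have "(\<Sum>i. emeasure (Mc x) (A i)) = emeasure (Mc x) (\<Union>i. A i)"
          using Ai M A(2) by (intro suminf_emeasure) auto
        also have "(\<Sum>i. emeasure \<nu> (A i)) = emeasure \<nu> (\<Union>i. A i)"
          using Ai A(2) by (intro suminf_emeasure) (auto simp: \<nu>_def)
        finally show "(\<Sum>i. ennreal ?a * emeasure (Mc x) (A i)
          + ennreal ?b * (\<integral>\<^sup>+s\<in>{0..t}. emeasure (return borel (p s)) (A i) \<partial>lborel))
          = ennreal ?a * emeasure (Mc x) (\<Union>(range A))
          + ennreal ?b * (\<integral>\<^sup>+s\<in>{0..t}. emeasure (return borel (p s)) (\<Union>(range A)) \<partial>lborel)"
          unfolding \<nu>[OF Ai'] \<nu>[OF U] .
      qed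
    qed auto
    then show ?thesis using \<nu>[OF A] by simp
  qed
  have pg: "continuous_on {0..t} (\<lambda>s. g (p s))"
    by (rule continuous_on_compose2[OF g(1) p]) auto
  have iR: "integrable R (\<lambda>s. g (p s))"
    unfolding R_def
    using borel_integrable_atLeastAtMost'[OF pg]
    by (subst integrable_restrict_space) (auto simp: set_integrable_def)
  have "integrable \<nu> g"
    unfolding \<nu>_def using iR by (subst integrable_distr_eq) auto
  moreover have "integral\<^sup>L \<nu> g = (LINT s:{0..t}|lborel. g (p s))"
    unfolding \<nu>_def R_def
    by (subst integral_distr) (use pm in \<open>auto simp: R_def integral_restrict_space set_lebesgue_integral_def\<close>)
  ultimately show ?thesis
    using integral_sum_measure[OF sets M _ N, of g] g(2) w_init_nonneg[OF t] w_occ_nonneg[OF t]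
    by (simp add: \<nu>_def)
qed

section \<open>The drift field, the noise functional and their Lipschitz estimates\<close>

locale self_interacting =
  fixes V F :: "'a::euclidean_space \<Rightarrow> real" and x :: "'a init" and T LV LF :: real
  assumes lipV: "LV-lipschitz_on UNIV (grad V)" and lipF: "LF-lipschitz_on UNIV (grad F)"
    and F0: "grad F 0 = 0" and x: "x \<in> XX" and T: "0 < T"
begin

definition field :: "(real \<Rightarrow> 'a) \<Rightarrow> real \<Rightarrow> 'a" where
  "field f t = - grad V (f t) - w_init (Tc x) t *\<^sub>R convolve (grad F) (Mc x) (f t)
     - w_occ (Tc x) t *\<^sub>R (LINT s:{0..t}|lborel. grad F (f t - f s))"

text \<open>The prescribed point \<open>Pc x\<close> is subtracted, not \<open>f 0\<close>, so that
  \<open>noise f 0 = 0\<close> encodes the initial condition.\<close>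

definition noise :: "(real \<Rightarrow> 'a) \<Rightarrow> real \<Rightarrow> 'a" where
  "noise f t = f t - Pc x - (LINT s:{0..t}|lborel. field f s)"

text \<open>Lipschitz constant of the drift: \<open>LV\<close> from the potential, \<open>LF\<close>
  from the convolution with the initial measure, \<open>2 * LF\<close> from the occupation integral;
  the 1 makes it positive.\<close>

definition K :: real where "K = LV + 3 * LF + 1"

lemma LV_nonneg: "0 \<le> LV" and LF_nonneg: "0 \<le> LF"
  by (rule lipschitz_on_nonneg[OF lipV], rule lipschitz_on_nonneg[OF lipF])

lemma K_pos: "0 < K"
  unfolding K_def using LV_nonneg LF_nonneg by linarith

lemma gradV_lip: "norm (grad V y - grad V z) \<le> LV * norm (y - z)"
  using lipschitz_onD[OF lipV, of y z] by (simp add: dist_norm)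

lemma gradF_lip: "norm (grad F y - grad F z) \<le> LF * norm (y - z)"
  using lipschitz_onD[OF lipF, of y z] by (simp add: dist_norm)

lemma gradV_cont: "continuous_on A (grad V)"
  by (rule continuous_on_subset[OF lipschitz_on_continuous_on[OF lipV] subset_UNIV])

lemma gradF_cont: "continuous_on A (grad F)"
  by (rule continuous_on_subset[OF lipschitz_on_continuous_on[OF lipF] subset_UNIV])

lemma gradV_measurable [measurable]: "grad V \<in> borel_measurable borel"
  by (rule borel_measurable_continuous_onI[OF gradV_cont])

lemma gradF_measurable [measurable]: "grad F \<in> borel_measurable borel"
  by (rule borel_measurable_continuous_onI[OF gradF_cont])

lemma Mc_props: "prob_space (Mc x)" "sets (Mc x) = sets borel" "integrable (Mc x) (\<lambda>z. (norm z)\<^sup>2)"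
  using x unfolding XX_def P2_def Mc_def mem_Times_iff by simp_all

text \<open>A Lipschitz gradient vanishing at 0 has at most linear growth, and the second moment of
  \<open>Mc x\<close> controls the first through
  \<open>norm z \<le> 1 + (norm z)\<^sup>2\<close>.\<close>

lemma integrable_gradF_Mc: "integrable (Mc x) (\<lambda>z. grad F (y - z))"
proof -
  interpret prob_space "Mc x" by (rule Mc_props)
  have "(\<lambda>z. grad F (y - z)) \<in> borel_measurable borel" by measurable
  then have m: "(\<lambda>z. grad F (y - z)) \<in> borel_measurable (Mc x)"
    using Mc_props(2) by (simp cong: measurable_cong_sets)
  show ?thesis
  proof (rule Bochner_Integration.integrable_bound)
    show "integrable (Mc x) (\<lambda>z. LF * (norm y + (1 + (norm z)\<^sup>2)))"
      using Mc_props(3) by auto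
    have "norm (grad F (y - z)) \<le> norm (LF * (norm y + (1 + (norm z)\<^sup>2)))" for z
    proof -
      have "norm z \<le> 1 + (norm z)\<^sup>2"
        using zero_le_power2[of "norm z - 1"] by (simp add: power2_diff) (smt (verit) norm_ge_zero)
      then have "norm (y - z) \<le> norm y + (1 + (norm z)\<^sup>2)" using norm_triangle_ineq4[of y z] by linarith
      then have "LF * norm (y - z) \<le> LF * (norm y + (1 + (norm z)\<^sup>2))" using LF_nonneg by (rule mult_left_mono)
      with gradF_lip[of "y - z" 0] F0 have "norm (grad F (y - z)) \<le> LF * (norm y + (1 + (norm z)\<^sup>2))" by simp
      then show ?thesis by (simp add: LF_nonneg)
    qed
    then show "AE z in Mc x. norm (grad F (y - z)) \<le> norm (LF * (norm y + (1 + (norm z)\<^sup>2)))" by simp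
  qed (rule m)
qed

lemma convolve_lip: "norm (convolve (grad F) (Mc x) y - convolve (grad F) (Mc x) z) \<le> LF * norm (y - z)"
proof -
  interpret prob_space "Mc x" by (rule Mc_props)
  have "convolve (grad F) (Mc x) y - convolve (grad F) (Mc x) z = (\<integral>u. grad F (y - u) - grad F (z - u) \<partial>Mc x)"
    unfolding convolve_def by (simp add: integrable_gradF_Mc)
  also have "norm \<dots> \<le> (\<integral>u. norm (grad F (y - u) - grad F (z - u)) \<partial>Mc x)"
    by (rule integral_norm_bound)
  also have "\<dots> \<le> (\<integral>u. LF * norm (y - z) \<partial>Mc x)"
  proof (intro integral_mono)
    show "norm (grad F (y - u) - grad F (z - u)) \<le> LF * norm (y - z)" for u
      using gradF_lip[of "y - u" "z - u"] by simp
    show "integrable (Mc x) (\<lambda>u. norm (grad F (y - u) - grad F (z - u)))"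
      by (intro integrable_norm Bochner_Integration.integrable_diff integrable_gradF_Mc)
  qed simp
  also have "\<dots> = LF * norm (y - z)" by (simp add: prob_space)
  finally show ?thesis .
qed

lemma convolve_measurable [measurable]: "convolve (grad F) (Mc x) \<in> borel_measurable borel"
proof -
  have "LF-lipschitz_on UNIV (convolve (grad F) (Mc x))"
    using convolve_lip LF_nonneg by (intro lipschitz_onI) (auto simp: dist_norm)
  then show ?thesis by (intro borel_measurable_continuous_onI lipschitz_on_continuous_on)
qed

lemma integrable_gradF_path:
  fixes f :: "real \<Rightarrow> 'a"
  assumes "continuous_on {0..t} f"
  shows "set_integrable lborel {0..t} (\<lambda>s. grad F (y - f s))"
proof (rule borel_integrable_atLeastAtMost')
  show "continuous_on {0..t} (\<lambda>s. grad F (y - f s))"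
    by (rule continuous_on_compose2[OF gradF_cont[of UNIV]]) (auto intro!: continuous_intros assms)
qed

lemma drift_eq_field:
  assumes "0 \<le> t" "continuous_on {0..t} f"
  shows "drift V F x f t = field f t"
proof -
  have "continuous_on UNIV (\<lambda>z. grad F (f t - z))"
    by (intro continuous_on_compose2[OF gradF_cont] continuous_intros) auto
  then show ?thesis
    using integral_interaction_measure[OF Mc_props(2) assms _ integrable_gradF_Mc]
    by (simp add: drift_def field_def convolve_def)
qed

text \<open>The difference \<open>f t - f s\<close> changes by at most \<open>2 * c\<close>, so the
  occupation integral changes by at most \<open>t * (LF * (2 * c))\<close>, and the weight
  \<open>w_occ\<close> cancels the factor \<open>t\<close>. Only the past up to \<open>t\<close>
  enters, as Gronwall's argument requires.\<close>

lemma field_diff_le: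
  assumes t: "0 \<le> t" and f: "continuous_on {0..t} f" and g: "continuous_on {0..t} g"
    and c: "\<And>s. s \<in> {0..t} \<Longrightarrow> norm (f s - g s) \<le> c"
  shows "norm (field f t - field g t) \<le> K * c"
proof -
  have ct: "norm (f t - g t) \<le> c" using c t by simp
  then have c0: "0 \<le> c" by (rule order_trans[OF norm_ge_zero])
  let ?Jf = "LINT s:{0..t}|lborel. grad F (f t - f s)" and ?Jg = "LINT s:{0..t}|lborel. grad F (g t - g s)"
  let ?Cf = "convolve (grad F) (Mc x) (f t)" and ?Cg = "convolve (grad F) (Mc x) (g t)"
  note If = integrable_gradF_path[OF f, of "f t"] and Ig = integrable_gradF_path[OF g, of "g t"]
  have "norm (?Jf - ?Jg) \<le> (LINT s:{0..t}|lborel. norm (grad F (f t - f s) - grad F (g t - g s)))"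
    using If Ig set_integral_norm_bound[OF set_integral_diff(1)[OF If Ig]]
    by (simp add: set_integral_diff(2)[OF If Ig])
  also have "\<dots> \<le> (LINT s:{0..t}|lborel. LF * (2 * c))"
  proof (rule set_integral_mono)
    show "set_integrable lborel {0..t} (\<lambda>s. norm (grad F (f t - f s) - grad F (g t - g s)))"
      using set_integrable_norm[OF set_integral_diff(1)[OF If Ig]] .
    show "set_integrable lborel {0..t} (\<lambda>s. LF * (2 * c))"
      by (intro borel_integrable_atLeastAtMost' continuous_intros)
    fix s assume s: "s \<in> {0..t}"
    have "norm ((f t - f s) - (g t - g s)) \<le> norm (f t - g t) + norm (f s - g s)"
      using norm_triangle_ineq4[of "f t - g t" "f s - g s"] by (simp add: algebra_simps)
    also have "\<dots> \<le> 2 * c" using ct c[OF s] by simp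
    finally show "norm (grad F (f t - f s) - grad F (g t - g s)) \<le> LF * (2 * c)"
      using gradF_lip[of "f t - f s" "g t - g s"] LF_nonneg
      by (meson mult_left_mono order_trans)
  qed
  also have "\<dots> = t * (LF * (2 * c))" using t by (simp add: set_lebesgue_integral_def)
  finally have J: "norm (?Jf - ?Jg) \<le> t * (LF * (2 * c))" .
  have "norm (w_occ (Tc x) t *\<^sub>R (?Jf - ?Jg)) \<le> w_occ (Tc x) t * (t * (LF * (2 * c)))"
    using J w_occ_nonneg[OF t, of "Tc x"] by (simp add: mult_left_mono)
  also have "\<dots> = (w_occ (Tc x) t * t) * (LF * (2 * c))" by simp
  also have "\<dots> \<le> 1 * (LF * (2 * c))"
    using w_occ_times_le_1[OF t] c0 LF_nonneg by (intro mult_right_mono) auto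
  finally have 3: "norm (w_occ (Tc x) t *\<^sub>R (?Jf - ?Jg)) \<le> 2 * LF * c" by simp
  have "norm (w_init (Tc x) t *\<^sub>R (?Cf - ?Cg)) = w_init (Tc x) t * norm (?Cf - ?Cg)"
    using w_init_nonneg[OF t, of "Tc x"] by simp
  also have "\<dots> \<le> 1 * (LF * norm (f t - g t))"
    using w_init_le_1[OF t] LF_nonneg by (intro mult_mono convolve_lip) auto
  also have "\<dots> \<le> LF * c" using ct LF_nonneg by (simp add: mult_left_mono)
  finally have 2: "norm (w_init (Tc x) t *\<^sub>R (?Cf - ?Cg)) \<le> LF * c" .
  have 1: "norm (grad V (f t) - grad V (g t)) \<le> LV * c"
    using gradV_lip[of "f t" "g t"] mult_left_mono[OF ct LV_nonneg] by simp
  have "field f t - field g t = - ((grad V (f t) - grad V (g t)) + w_init (Tc x) t *\<^sub>R (?Cf - ?Cg)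
      + w_occ (Tc x) t *\<^sub>R (?Jf - ?Jg))"
    by (simp add: field_def algebra_simps)
  then have "norm (field f t - field g t) \<le> norm (grad V (f t) - grad V (g t))
      + norm (w_init (Tc x) t *\<^sub>R (?Cf - ?Cg)) + norm (w_occ (Tc x) t *\<^sub>R (?Jf - ?Jg))"
    by (simp only: norm_minus_cancel) (intro norm_triangle_mono norm_triangle_ineq order_refl)
  also have "\<dots> \<le> LV * c + LF * c + 2 * LF * c" by (intro add_mono 1 2 3)
  also have "\<dots> \<le> K * c" using c0 by (simp add: K_def algebra_simps)
  finally show ?thesis .
qed

text \<open>Comparison with the zero path, whose occupation term vanishes because
  \<open>grad F 0 = 0\<close>.\<close>

lemma field_bounded:
  assumes f: "continuous_on {0..T} f"
  shows "\<exists>B\<ge>0. \<forall>t\<in>{0..T}. norm (field f t) \<le> B"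
proof -
  have "bounded (f ` {0..T})" by (intro compact_imp_bounded compact_continuous_image f) simp
  then obtain C where "\<forall>y\<in>f ` {0..T}. norm y \<le> C" unfolding bounded_iff by blast
  then have C: "norm (f s) \<le> C" if "s \<in> {0..T}" for s using that by blast
  have C0: "0 \<le> C" by (rule order_trans[OF norm_ge_zero C[of 0]]) (use T in simp)
  let ?D = "norm (grad V 0) + norm (convolve (grad F) (Mc x) 0)"
  have z: "norm (field (\<lambda>_. 0) t) \<le> ?D" if t: "t \<in> {0..T}" for t
  proof -
    have "norm (field (\<lambda>_. 0) t) \<le> norm (grad V 0) + norm (w_init (Tc x) t *\<^sub>R convolve (grad F) (Mc x) 0)"
      using norm_triangle_ineq4[of "- grad V 0" "w_init (Tc x) t *\<^sub>R convolve (grad F) (Mc x) 0"]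
      by (simp add: field_def F0 set_lebesgue_integral_def)
    also have "norm (w_init (Tc x) t *\<^sub>R convolve (grad F) (Mc x) 0) \<le> 1 * norm (convolve (grad F) (Mc x) 0)"
      unfolding norm_scaleR using t w_init_nonneg[of t "Tc x"] w_init_le_1[of t "Tc x"]
      by (intro mult_right_mono) auto
    finally show ?thesis by simp
  qed
  have "norm (field f t) \<le> K * C + ?D" if t: "t \<in> {0..T}" for t
  proof -
    have "norm (field f t - field (\<lambda>_. 0) t) \<le> K * C"
      using t C by (intro field_diff_le continuous_on_subset[OF f]) auto
    then show ?thesis using z[OF t] norm_triangle_ineq2[of "field f t" "field (\<lambda>_. 0) t"] by linarith
  qed
  then show ?thesis using C0 K_pos by (intro exI[of _ "K * C + ?D"]) auto
qed

lemma field_cong: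
  assumes "\<And>s. s \<in> {0..t} \<Longrightarrow> f s = g s" "0 \<le> t"
  shows "field f t = field g t"
proof -
  have "(LINT s:{0..t}|lborel. grad F (f t - f s)) = (LINT s:{0..t}|lborel. grad F (g t - g s))"
    using assms by (intro set_lebesgue_integral_cong) auto
  then show ?thesis using assms by (simp add: field_def)
qed

text \<open>Outside \<open>{0..T}\<close> the path is arbitrary. Freezing it at the end points gives
  a continuous function on the line with the same field on \<open>{0..T}\<close>, and the integral
  with moving end point becomes a parameter integral over the whole line.\<close>

lemma field_measurable:
  assumes f: "continuous_on {0..T} f"
  shows "set_borel_measurable lborel {0..T} (field f)"
proof -
  define h where "h s = f (max 0 (min T s))" for s
  have "continuous_on UNIV h"
    unfolding h_def using T by (intro continuous_on_compose2[OF f] continuous_intros) auto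
  then have [measurable]: "h \<in> borel_measurable borel" by (rule borel_measurable_continuous_onI)
  have "(\<lambda>t. \<integral>s. (if 0 \<le> s \<and> s \<le> t then 1 else 0) *\<^sub>R grad F (h t - h s) \<partial>lborel) \<in> borel_measurable borel"
    by measurable
  then have [measurable]: "(\<lambda>t. LINT s:{0..t}|lborel. grad F (h t - h s)) \<in> borel_measurable borel"
    unfolding set_lebesgue_integral_def by (simp add: indicator_def[abs_def])
  have "field h \<in> borel_measurable borel"
    unfolding field_def[abs_def] by measurable
  moreover have "(\<lambda>t. indicator {0..T} t *\<^sub>R field f t) = (\<lambda>t. indicator {0..T} t *\<^sub>R field h t)"
  proof
    fix t
    have "field f t = field h t" if "t \<in> {0..T}"
      using that by (intro field_cong) (auto simp: h_def)
    then show "indicator {0..T} t *\<^sub>R field f t = indicator {0..T} t *\<^sub>R field h t"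
      by (cases "t \<in> {0..T}") simp_all
  qed
  ultimately show ?thesis unfolding set_borel_measurable_def by simp
qed

lemma field_L2:
  assumes f: "continuous_on {0..T} f"
  shows "field f \<in> L2_fun T"
proof -
  obtain B where B: "0 \<le> B" "\<forall>t\<in>{0..T}. norm (field f t) \<le> B"
    using field_bounded[OF f] by blast
  have m: "(\<lambda>t. indicator {0..T} t *\<^sub>R field f t) \<in> borel_measurable lborel"
    using field_measurable[OF f] by (simp add: set_borel_measurable_def)
  have "set_integrable lborel {0..T} (\<lambda>s. (norm (field f s))\<^sup>2)"
    unfolding set_integrable_def
  proof (rule Bochner_Integration.integrable_bound)
    show "integrable lborel (\<lambda>s. indicator {0..T} s *\<^sub>R B\<^sup>2)"
      using borel_integrable_atLeastAtMost'[of 0 T "\<lambda>_. B\<^sup>2"] by (simp add: set_integrable_def)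
    have "indicator {0..T} t *\<^sub>R (norm (field f t))\<^sup>2 = (norm (indicator {0..T} t *\<^sub>R field f t))\<^sup>2" for t
      by (cases "t \<in> {0..T}") simp_all
    moreover have "(\<lambda>t. (norm (indicator {0..T} t *\<^sub>R field f t))\<^sup>2) \<in> borel_measurable lborel" using m by measurable
    ultimately show "(\<lambda>t. indicator {0..T} t *\<^sub>R (norm (field f t))\<^sup>2) \<in> borel_measurable lborel"
      by (simp only:)
    have "norm (indicator {0..T} s *\<^sub>R (norm (field f s))\<^sup>2) \<le> norm (indicator {0..T} s *\<^sub>R B\<^sup>2)" for s
      using B by (cases "s \<in> {0..T}") (simp_all add: power_mono)
    then show "AE s in lborel. norm (indicator {0..T} s *\<^sub>R (norm (field f s))\<^sup>2) \<le> norm (indicator {0..T} s *\<^sub>R B\<^sup>2)"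
      by simp
  qed
  then show ?thesis using field_measurable[OF f] by (simp add: L2_fun_iff)
qed

lemma field_integrable:
  assumes "continuous_on {0..T} f" "0 \<le> a" "b \<le> T"
  shows "set_integrable lborel {a..b} (field f)"
  using L2_fun_imp_set_integrable[OF field_L2[OF assms(1)]]
  by (rule set_integrable_subset) (use assms in auto)

lemma noise_continuous:
  assumes f: "continuous_on {0..T} f"
  shows "continuous_on {0..T} (noise f)"
proof -
  obtain B where B: "0 \<le> B" "\<forall>t\<in>{0..T}. norm (field f t) \<le> B"
    using field_bounded[OF f] by blast
  have le: "norm ((LINT u:{0..t}|lborel. field f u) - (LINT u:{0..s}|lborel. field f u)) \<le> B * (t - s)"
    if st: "0 \<le> s" "s \<le> t" "t \<le> T" for s t
  proof -
    have i: "set_integrable lborel {s..t} (field f)" using f st by (intro field_integrable) auto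
    have "norm (LINT u:{s..t}|lborel. field f u) \<le> (LINT u:{s..t}|lborel. norm (field f u))"
      by (rule set_integral_norm_bound[OF i])
    also have "\<dots> \<le> (LINT u:{s..t}|lborel. B)"
      using B st
      by (intro set_integral_mono[OF set_integrable_norm[OF i]] borel_integrable_atLeastAtMost' continuous_intros) auto
    also have "\<dots> = B * (t - s)" using st by (simp add: set_lebesgue_integral_def)
    finally show ?thesis
      using LINT_interval_diff[OF field_integrable[OF f, of 0 T] st] by simp
  qed
  have "B-lipschitz_on {0..T} (\<lambda>t. LINT u:{0..t}|lborel. field f u)"
  proof (rule lipschitz_onI[OF _ B(1)])
    fix s t assume "s \<in> {0..T}" "t \<in> {0..T}"
    then show "dist (LINT u:{0..s}|lborel. field f u) (LINT u:{0..t}|lborel. field f u) \<le> B * dist s t"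
      using le[of s t] le[of t s] by (cases "s \<le> t") (auto simp: dist_norm norm_minus_commute)
  qed
  then show ?thesis unfolding noise_def[abs_def]
    by (intro continuous_intros f lipschitz_on_continuous_on)
qed

text \<open>The majorant \<open>h\<close> is left general: it is constant in
  \<open>noise_diff_le\<close> and exponential in \<open>diff_le_noise_diff\<close>.\<close>

lemma LINT_field_diff_le:
  assumes f: "continuous_on {0..T} f" and g: "continuous_on {0..T} g" and t: "t \<in> {0..T}"
    and h: "continuous_on {0..t} h" "\<And>s. s \<in> {0..t} \<Longrightarrow> norm (field f s - field g s) \<le> h s"
  shows "norm ((LINT s:{0..t}|lborel. field f s) - (LINT s:{0..t}|lborel. field g s)) \<le> (LINT s:{0..t}|lborel. h s)"
proof -
  have i: "set_integrable lborel {0..t} (field f)" "set_integrable lborel {0..t} (field g)"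
    using f g t by (auto intro!: field_integrable)
  note d = set_integral_diff[OF i]
  have "norm ((LINT s:{0..t}|lborel. field f s) - (LINT s:{0..t}|lborel. field g s))
     \<le> (LINT s:{0..t}|lborel. norm (field f s - field g s))"
    using set_integral_norm_bound[OF d(1)] d(2) by simp
  also have "\<dots> \<le> (LINT s:{0..t}|lborel. h s)"
    using h by (intro set_integral_mono[OF set_integrable_norm[OF d(1)]] borel_integrable_atLeastAtMost') auto
  finally show ?thesis .
qed

lemma noise_diff_le:
  assumes f: "continuous_on {0..T} f" and g: "continuous_on {0..T} g" and t: "t \<in> {0..T}"
    and c: "\<And>s. s \<in> {0..T} \<Longrightarrow> norm (f s - g s) \<le> c"
  shows "norm (noise f t - noise g t) \<le> (1 + K * T) * c"
proof -
  have c0: "0 \<le> c" using c[OF t] norm_ge_zero[of "f t - g t"] by linarith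
  have "norm (field f s - field g s) \<le> K * c" if "s \<in> {0..t}" for s
    using that t c by (intro field_diff_le continuous_on_subset[OF f] continuous_on_subset[OF g]) auto
  then have "norm ((LINT s:{0..t}|lborel. field f s) - (LINT s:{0..t}|lborel. field g s)) \<le> (LINT s:{0..t}|lborel. K * c)"
    by (intro LINT_field_diff_le[OF f g t] continuous_intros) auto
  also have "\<dots> = t * (K * c)" using t by (simp add: set_lebesgue_integral_def)
  also have "\<dots> \<le> T * (K * c)" using t c0 K_pos by (intro mult_right_mono) auto
  finally have "norm ((LINT s:{0..t}|lborel. field f s) - (LINT s:{0..t}|lborel. field g s)) \<le> T * (K * c)" .
  moreover have "noise f t - noise g t = (f t - g t)
      - ((LINT s:{0..t}|lborel. field f s) - (LINT s:{0..t}|lborel. field g s))"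
    by (simp add: noise_def)
  then have "norm (noise f t - noise g t) \<le> norm (f t - g t)
      + norm ((LINT s:{0..t}|lborel. field f s) - (LINT s:{0..t}|lborel. field g s))"
    by (simp only: norm_triangle_ineq4)
  ultimately have "norm (noise f t - noise g t) \<le> c + T * (K * c)"
    using c[OF t] by linarith
  then show ?thesis by (simp add: algebra_simps)
qed

text \<open>Gronwall's inequality, by means of the weighted norm with weight \<open>exp (- 2 K t)\<close>.\<close>

lemma diff_le_noise_diff:
  assumes f: "continuous_on {0..T} f" and g: "continuous_on {0..T} g" and t: "t \<in> {0..T}"
    and d: "\<And>s. s \<in> {0..T} \<Longrightarrow> norm (noise f s - noise g s) \<le> d"
  shows "norm (f t - g t) \<le> 2 * exp (2 * K * T) * d"
proof -
  have d0: "0 \<le> d" using d[OF t] norm_ge_zero[of "noise f t - noise g t"] by linarith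
  define u where "u s = exp (- (2 * K * s)) * norm (f s - g s)" for s
  have "continuous_on {0..T} u" unfolding u_def by (intro continuous_intros f g)
  then obtain r where r: "r \<in> {0..T}" "\<And>s. s \<in> {0..T} \<Longrightarrow> u s \<le> u r"
    using continuous_attains_sup[of "{0..T}" u] T by auto
  define N where "N = u r"
  have N0: "0 \<le> N" by (simp add: N_def u_def)
  have le: "norm (f s - g s) \<le> N * exp (2 * K * s)" if "s \<in> {0..T}" for s
    using r(2)[OF that] by (simp add: u_def N_def exp_minus divide_le_eq flip: inverse_eq_divide)
      (simp add: field_simps)
  have "norm (field f s - field g s) \<le> K * (N * exp (2 * K * s))" if s: "s \<in> {0..r}" for s
  proof (rule field_diff_le)
    fix s' assume s': "s' \<in> {0..s}"
    have "N * exp (2 * K * s') \<le> N * exp (2 * K * s)"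
      using s' N0 K_pos by (intro mult_left_mono) auto
    then show "norm (f s' - g s') \<le> N * exp (2 * K * s)" using le[of s'] s' s r(1) by auto
  qed (use s r(1) in \<open>auto intro: continuous_on_subset[OF f] continuous_on_subset[OF g]\<close>)
  then have "norm ((LINT s:{0..r}|lborel. field f s) - (LINT s:{0..r}|lborel. field g s))
      \<le> (LINT s:{0..r}|lborel. K * (N * exp (2 * K * s)))"
    by (intro LINT_field_diff_le[OF f g r(1)] continuous_intros) auto
  \<comment> \<open>The rate \<open>2 * K\<close> instead of \<open>K\<close> produces the factor
    1/2. The estimate at \<open>r\<close> thus becomes \<open>N \<le> d + N / 2\<close>, and the
    last term is absorbed.\<close>
  also have "\<dots> = N / 2 * exp (2 * K * r) - N / 2"
  proof -
    have "((\<lambda>s. N / 2 * exp (2 * K * s)) has_real_derivative K * (N * exp (2 * K * s))) (at s)" for s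
      by (auto intro!: derivative_eq_intros)
    then have "has_bochner_integral lborel (\<lambda>s. K * (N * exp (2 * K * s)) * indicator {0..r} s)
       (N / 2 * exp (2 * K * r) - N / 2 * exp (2 * K * 0))"
      using r(1) by (intro has_bochner_integral_FTC_Icc_real) (auto intro!: continuous_intros)
    then have "(LINT s|lborel. K * (N * exp (2 * K * s)) * indicator {0..r} s)
       = N / 2 * exp (2 * K * r) - N / 2 * exp (2 * K * 0)"
      by (rule has_bochner_integral_integral_eq)
    then show ?thesis
      unfolding set_lebesgue_integral_def real_scaleR_def mult.commute[of "indicator {0..r} _"] by simp
  qed
  finally have I: "norm ((LINT s:{0..r}|lborel. field f s) - (LINT s:{0..r}|lborel. field g s))
      \<le> N / 2 * exp (2 * K * r)" using N0 by linarith
  have "f r - g r = (noise f r - noise g r)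
     + ((LINT s:{0..r}|lborel. field f s) - (LINT s:{0..r}|lborel. field g s))"
    by (simp add: noise_def)
  then have "norm (f r - g r) \<le> d + N / 2 * exp (2 * K * r)"
    using I d[OF r(1)] norm_triangle_ineq[of "noise f r - noise g r"
        "(LINT s:{0..r}|lborel. field f s) - (LINT s:{0..r}|lborel. field g s)"] by simp
  then have "exp (- (2 * K * r)) * norm (f r - g r) \<le> exp (- (2 * K * r)) * (d + N / 2 * exp (2 * K * r))"
    by (intro mult_left_mono) auto
  also have "\<dots> = exp (- (2 * K * r)) * d + N / 2" by (simp add: exp_minus algebra_simps)
  also have "exp (- (2 * K * r)) * d \<le> 1 * d"
    using r(1) K_pos d0 by (intro mult_right_mono) auto
  finally have "N \<le> 2 * d" by (simp add: N_def u_def)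
  then have "N * exp (2 * K * t) \<le> 2 * d * exp (2 * K * T)"
    using t K_pos d0 by (intro mult_mono) auto
  then show ?thesis using le[OF t] by (simp add: mult_ac)
qed

end


section \<open>The rate function\<close>

lemma nn_integral_L2_fun:
  fixes g :: "real \<Rightarrow> 'a::euclidean_space"
  assumes "g \<in> L2_fun T"
  shows "(\<integral>\<^sup>+t\<in>{0..T}. ennreal ((norm (g t))\<^sup>2) \<partial>lborel) = ennreal (LINT t:{0..T}|lborel. (norm (g t))\<^sup>2)"
proof -
  have i: "integrable lborel (\<lambda>t. indicator {0..T} t *\<^sub>R (norm (g t))\<^sup>2)"
    using assms by (simp add: L2_fun_iff set_integrable_def)
  have "(\<integral>\<^sup>+t\<in>{0..T}. ennreal ((norm (g t))\<^sup>2) \<partial>lborel)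
      = (\<integral>\<^sup>+t. ennreal (indicator {0..T} t *\<^sub>R (norm (g t))\<^sup>2) \<partial>lborel)"
    by (intro nn_integral_cong) (simp add: indicator_def)
  also have "\<dots> = ennreal (LINT t:{0..T}|lborel. (norm (g t))\<^sup>2)"
    unfolding set_lebesgue_integral_def by (rule nn_integral_eq_integral[OF i]) simp
  finally show ?thesis .
qed

lemma L2_fun_add:
  fixes g h :: "real \<Rightarrow> 'a::euclidean_space"
  assumes g: "g \<in> L2_fun T" and h: "h \<in> L2_fun T"
  shows "(\<lambda>t. g t + h t) \<in> L2_fun T"
proof -
  have mg: "(\<lambda>t. indicator {0..T} t *\<^sub>R g t) \<in> borel_measurable lborel"
    and mh: "(\<lambda>t. indicator {0..T} t *\<^sub>R h t) \<in> borel_measurable lborel"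
    using g h by (simp_all add: L2_fun_iff set_borel_measurable_def)
  have m: "(\<lambda>t. indicator {0..T} t *\<^sub>R (g t + h t)) \<in> borel_measurable lborel"
    unfolding scaleR_add_right using mg mh by (rule borel_measurable_add)
  have "set_integrable lborel {0..T} (\<lambda>t. (norm (g t + h t))\<^sup>2)"
    unfolding set_integrable_def
  proof (rule Bochner_Integration.integrable_bound)
    have "set_integrable lborel {0..T} (\<lambda>t. 2 * (norm (g t))\<^sup>2 + 2 * (norm (h t))\<^sup>2)"
      using g h by (intro set_integral_add set_integrable_mult_right) (auto simp: L2_fun_iff)
    then show "integrable lborel (\<lambda>t. indicator {0..T} t *\<^sub>R (2 * (norm (g t))\<^sup>2 + 2 * (norm (h t))\<^sup>2))"
      by (simp add: set_integrable_def)
    have "indicator {0..T} t *\<^sub>R (norm (g t + h t))\<^sup>2 = (norm (indicator {0..T} t *\<^sub>R (g t + h t)))\<^sup>2" for t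
      by (cases "t \<in> {0..T}") simp_all
    moreover have "(\<lambda>t. (norm (indicator {0..T} t *\<^sub>R (g t + h t)))\<^sup>2) \<in> borel_measurable lborel"
      using m by measurable
    ultimately show "(\<lambda>t. indicator {0..T} t *\<^sub>R (norm (g t + h t))\<^sup>2) \<in> borel_measurable lborel"
      by (simp only:)
    have "(norm (g t + h t))\<^sup>2 \<le> 2 * (norm (g t))\<^sup>2 + 2 * (norm (h t))\<^sup>2" for t
    proof -
      have "(norm (g t + h t))\<^sup>2 \<le> (norm (g t) + norm (h t))\<^sup>2"
        by (intro power_mono norm_triangle_ineq) simp
      also have "\<dots> \<le> 2 * (norm (g t))\<^sup>2 + 2 * (norm (h t))\<^sup>2"
        using zero_le_power2[of "norm (g t) - norm (h t)"] by (simp add: power2_eq_square algebra_simps)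
      finally show ?thesis .
    qed
    then have "norm (indicator {0..T} t *\<^sub>R (norm (g t + h t))\<^sup>2)
        \<le> norm (indicator {0..T} t *\<^sub>R (2 * (norm (g t))\<^sup>2 + 2 * (norm (h t))\<^sup>2))" for t
      by (cases "t \<in> {0..T}") simp_all
    then show "AE t in lborel. norm (indicator {0..T} t *\<^sub>R (norm (g t + h t))\<^sup>2)
        \<le> norm (indicator {0..T} t *\<^sub>R (2 * (norm (g t))\<^sup>2 + 2 * (norm (h t))\<^sup>2))"
      by simp
  qed
  then show ?thesis using m by (simp add: L2_fun_iff set_borel_measurable_def)
qed

lemma L2_fun_uminus: "g \<in> L2_fun T \<Longrightarrow> (\<lambda>t. - g t) \<in> L2_fun T"
  by (simp add: L2_fun_iff set_borel_measurable_def)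

text \<open>The choice in \<open>velocity\<close> refers to \<open>f 0\<close>, which equals
  \<open>y\<close> because the integral over a single point vanishes; hence the chosen density fits
  the definition of \<open>H1\<close>.\<close>

lemma velocity_props:
  assumes "f \<in> H1 T y" "0 < T"
  shows "f 0 = y" "velocity T f \<in> L2_fun T" "f = primitive T y (velocity T f)"
proof -
  obtain g where g: "g \<in> L2_fun T" "f = primitive T y g"
    using assms(1) unfolding H1_def by blast
  have "(LINT s:{0..0}|lborel. g s) = 0"
    by (rule LINT_singleton)
  then show f0: "f 0 = y" using g(2) assms(2) by (simp add: primitive_def)
  have "g \<in> L2_fun T \<and> f = primitive T (f 0) g" unfolding f0 using g by (rule conjI)
  then have "velocity T f \<in> L2_fun T \<and> f = primitive T (f 0) (velocity T f)"
    unfolding velocity_def by (rule someI[where P = "\<lambda>g. g \<in> L2_fun T \<and> f = primitive T (f 0) g"])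
  then show "velocity T f \<in> L2_fun T" "f = primitive T y (velocity T f)" unfolding f0 by blast+
qed

section \<open>Compactness of sets of paths with bounded energy\<close>

lemma norm_LINT_le_sqrt:
  fixes g :: "real \<Rightarrow> 'a::euclidean_space"
  assumes g: "g \<in> L2_fun T" and a: "(LINT s:{0..T}|lborel. (norm (g s))\<^sup>2) \<le> a"
    and st: "0 \<le> s" "s \<le> t" "t \<le> T"
  shows "norm ((LINT u:{0..t}|lborel. g u) - (LINT u:{0..s}|lborel. g u)) \<le> sqrt ((t - s) * a)"
proof -
  have g': "set_borel_measurable lborel {0..T} g" "set_integrable lborel {0..T} (\<lambda>s. (norm (g s))\<^sup>2)"
    using g by (auto simp: L2_fun_iff)
  have sub: "{s..t} \<subseteq> {0..T}" using st by auto
  have "(LINT u:{s..t}|lborel. (norm (g u))\<^sup>2) \<le> (LINT u:{0..T}|lborel. (norm (g u))\<^sup>2)"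
    unfolding set_lebesgue_integral_def
  proof (rule integral_mono)
    show "integrable lborel (\<lambda>x. indicator {s..t} x *\<^sub>R (norm (g x))\<^sup>2)"
      using set_integrable_subset[OF g'(2), of "{s..t}"] sub by (simp add: set_integrable_def)
    show "integrable lborel (\<lambda>x. indicator {0..T} x *\<^sub>R (norm (g x))\<^sup>2)"
      using g'(2) by (simp add: set_integrable_def)
    show "indicator {s..t} u *\<^sub>R (norm (g u))\<^sup>2 \<le> indicator {0..T} u *\<^sub>R (norm (g u))\<^sup>2" for u
      using sub by (auto simp: indicator_def)
  qed
  with a have "(t - s) * (LINT u:{s..t}|lborel. (norm (g u))\<^sup>2) \<le> (t - s) * a"
    using st by (intro mult_left_mono) auto
  moreover have "(norm (LINT u:{s..t}|lborel. g u))\<^sup>2 \<le> (t - s) * (LINT u:{s..t}|lborel. (norm (g u))\<^sup>2)"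
    using sub set_integrable_subset[OF g'(2), of "{s..t}"] set_borel_measurable_subset[OF g'(1), of "{s..t}"]
    by (intro norm_LINT_square_le st) auto
  ultimately show ?thesis
    unfolding LINT_interval_diff[OF L2_fun_imp_set_integrable[OF g] st] by (intro real_le_rsqrt) linarith
qed

text \<open>For fixed \<open>m\<close> the energy is a continuous function of finitely many values.
  Taken over all \<open>m\<close>, this is lower semicontinuity of the full energy.\<close>

lemma energy_uniform_limit:
  fixes w :: "real \<Rightarrow> 'a::euclidean_space"
  assumes "0 < T" "uniform_limit {0..T} v w sequentially" "\<And>n. energy T m (v n) \<le> a"
  shows "energy T m w \<le> a"
proof -
  have p: "(\<lambda>n. v n t) \<longlonglongrightarrow> w t" if "t \<in> {0..T}" for t
    using tendsto_uniform_limitI[OF assms(2) that] .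
  have "(\<lambda>n. energy T m (v n)) \<longlonglongrightarrow> energy T m w"
    unfolding energy_def incr_def using assms(1)
    by (intro tendsto_intros p grid_in) auto
  then show ?thesis by (rule LIMSEQ_le_const2) (use assms(3) in blast)
qed

text \<open>The bound \<open>a\<close> gives all paths the common modulus sqrt(|t - s| a), hence
  equicontinuity, and boundedness because they start at 0.\<close>

lemma bounded_energy_subseq:
  fixes v :: "nat \<Rightarrow> real \<Rightarrow> 'a::euclidean_space"
  assumes T: "0 < T" and v: "\<And>n. continuous_on {0..T} (v n)" "\<And>n. v n 0 = 0"
    and a: "\<And>n m. energy T m (v n) \<le> a"
  obtains w r where "continuous_on {0..T} w" "strict_mono r" "uniform_limit {0..T} (v \<circ> r) w sequentially"
proof -
  have a0: "0 \<le> a" using energy_nonneg[OF T, of 0 "v 0"] a[of 0 0] by simp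
  have le: "norm (v n t - v n s) \<le> sqrt ((t - s) * a)" if st: "0 \<le> s" "s \<le> t" "t \<le> T" for n s t
  proof -
    obtain g where g: "g \<in> L2_fun T" and w: "\<And>t. t \<in> {0..T} \<Longrightarrow> v n t = (LINT s:{0..t}|lborel. g s)"
      and ga: "(LINT s:{0..T}|lborel. (norm (g s))\<^sup>2) \<le> a"
      using bounded_energy_imp_L2_density[OF T v(1,2), of n a] a[of _ n] by metis
    have "t \<in> {0..T}" "s \<in> {0..T}" using st by auto
    then show ?thesis using norm_LINT_le_sqrt[OF g ga st] by (simp only: w)
  qed
  have abs: "norm (v n t - v n s) \<le> sqrt (\<bar>t - s\<bar> * a)" if "s \<in> {0..T}" "t \<in> {0..T}" for n s t
    using le[of s t n] le[of t s n] that by (cases "s \<le> t") (auto simp: norm_minus_commute abs_if)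
  have b: "norm (v n t) \<le> sqrt (T * a)" if "t \<in> {0..T}" for n t
  proof -
    have "norm (v n t) \<le> sqrt ((t - 0) * a)" using le[of 0 t n] that v(2)[of n] by simp
    also have "\<dots> \<le> sqrt (T * a)" using that a0 by (simp add: mult_right_mono)
    finally show ?thesis .
  qed
  have equi: "\<exists>d. 0 < d \<and> (\<forall>n y. y \<in> {0..T} \<and> norm (x - y) < d \<longrightarrow> norm (v n x - v n y) < e)"
    if x: "x \<in> {0..T}" and e: "0 < e" for x e
  \<comment> \<open>The denominator \<open>a + 1\<close> keeps the radius positive and finite when
    \<open>a = 0\<close>.\<close>
  proof (intro exI[of _ "e\<^sup>2 / (a + 1)"] conjI allI impI)
    show "0 < e\<^sup>2 / (a + 1)" using e a0 by simp
    fix n y assume y: "y \<in> {0..T} \<and> norm (x - y) < e\<^sup>2 / (a + 1)"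
    have "\<bar>x - y\<bar> * a \<le> \<bar>x - y\<bar> * (a + 1)" by (intro mult_left_mono) auto
    also have "\<dots> < e\<^sup>2" using y a0 by (simp add: pos_less_divide_eq)
    finally have "sqrt (\<bar>x - y\<bar> * a) < e" using e by (intro real_less_lsqrt) (auto simp: a0)
    then show "norm (v n x - v n y) < e" using abs[of y x n] x y by simp
  qed
  obtain w r where w: "continuous_on {0..T} w" and r: "strict_mono (r :: nat \<Rightarrow> nat)"
    and lim: "\<And>e. 0 < e \<Longrightarrow> \<exists>N. \<forall>n x. n \<ge> N \<and> x \<in> {0..T} \<longrightarrow> norm (v (r n) x - w x) < e"
    using Arzela_Ascoli[OF compact_Icc b equi] by blast
  have "uniform_limit {0..T} (v \<circ> r) w sequentially"
  proof (rule uniform_limitI)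
    fix e :: real assume "0 < e"
    then obtain N where "\<forall>n x. n \<ge> N \<and> x \<in> {0..T} \<longrightarrow> norm (v (r n) x - w x) < e" using lim by blast
    then show "\<forall>\<^sub>F n in sequentially. \<forall>x\<in>{0..T}. dist ((v \<circ> r) n x) (w x) < e"
      unfolding eventually_sequentially by (intro exI[of _ N]) (auto simp: dist_norm)
  qed
  with w r show ?thesis using that by blast
qed

section \<open>The rate function in terms of the energies of the noise\<close>

context self_interacting
begin

lemma noise_0: "noise f 0 = f 0 - Pc x"
proof -
  have "(LINT s:{0..0}|lborel. field f s) = 0"
    by (rule LINT_singleton)
  then show ?thesis by (simp add: noise_def)
qed

lemma rate_function_eq:
  "rate_function V F T x f = (if f \<in> H1 T (Pc x) then
     ennreal (1 / 4) * (\<integral>\<^sup>+t\<in>{0..T}. ennreal ((norm (velocity T f t + - field f t))\<^sup>2) \<partial>lborel) else \<infinity>)"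
  unfolding rate_function_def field_def by (simp add: algebra_simps)

lemma rate_function_eq_LINT:
  assumes "f \<in> H1 T (Pc x)" "g \<in> L2_fun T"
    and "(\<integral>\<^sup>+t\<in>{0..T}. ennreal ((norm (velocity T f t + - field f t))\<^sup>2) \<partial>lborel)
      = (\<integral>\<^sup>+t\<in>{0..T}. ennreal ((norm (g t))\<^sup>2) \<partial>lborel)"
  shows "rate_function V F T x f = ennreal (1 / 4 * (LINT t:{0..T}|lborel. (norm (g t))\<^sup>2))"
  unfolding rate_function_eq assms(3) nn_integral_L2_fun[OF assms(2)]
  using assms(1) by (subst ennreal_mult') simp_all

lemma H1_imp_paths: "f \<in> H1 T y \<Longrightarrow> f \<in> paths T"
proof -
  assume "f \<in> H1 T y"
  then obtain g where g: "g \<in> L2_fun T" "f = primitive T y g" unfolding H1_def by blast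
  have cont: "continuous_on {0..T} (\<lambda>t. y + (LINT s:{0..t}|lborel. g s))"
  proof -
    define A where "A = (LINT s:{0..T}|lborel. (norm (g s))\<^sup>2)"
    have A0: "0 \<le> A" unfolding A_def set_lebesgue_integral_def by (intro integral_nonneg_AE) auto
    have le: "norm ((LINT u:{0..t}|lborel. g u) - (LINT u:{0..s}|lborel. g u)) \<le> sqrt (\<bar>t - s\<bar> * A)"
      if "s \<in> {0..T}" "t \<in> {0..T}" for s t
      using norm_LINT_le_sqrt[OF g(1), of A s t] norm_LINT_le_sqrt[OF g(1), of A t s] that
      by (cases "s \<le> t") (auto simp: A_def abs_if norm_minus_commute)
    have "continuous_on {0..T} (\<lambda>t. LINT s:{0..t}|lborel. g s)"
      unfolding continuous_on_def
    proof
      fix t assume t: "t \<in> {0..T}"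
      have "((\<lambda>s. sqrt (\<bar>s - t\<bar> * A)) \<longlongrightarrow> sqrt (\<bar>t - t\<bar> * A)) (at t within {0..T})"
        by (intro tendsto_intros)
      then have z: "((\<lambda>s. sqrt (\<bar>s - t\<bar> * A)) \<longlongrightarrow> 0) (at t within {0..T})" by simp
      have "((\<lambda>s. (LINT u:{0..s}|lborel. g u) - (LINT u:{0..t}|lborel. g u)) \<longlongrightarrow> 0) (at t within {0..T})"
        by (rule Lim_null_comparison[OF _ z]) (use le[OF t] in \<open>auto simp: eventually_at_filter\<close>)
      then show "((\<lambda>s. LINT u:{0..s}|lborel. g u) \<longlongrightarrow> (LINT u:{0..t}|lborel. g u)) (at t within {0..T})"
        by (rule Lim_null[THEN iffD2])
    qed
    then show ?thesis by (intro continuous_intros)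
  qed
  have "continuous_on {0..T} f"
    using cont by (rule continuous_on_eq) (simp add: g(2) primitive_def)
  then show ?thesis using g(2) by (simp add: paths_def primitive_def)
qed

lemma noise_eq_LINT:
  assumes f: "f \<in> H1 T (Pc x)" and t: "t \<in> {0..T}"
  shows "noise f t = (LINT s:{0..t}|lborel. velocity T f s + - field f s)"
proof -
  note vel = velocity_props[OF f T]
  have cont: "continuous_on {0..T} f" using H1_imp_paths[OF f] by (simp add: paths_def)
  have "set_integrable lborel {0..t} (velocity T f)"
    using L2_fun_imp_set_integrable[OF vel(2)] by (rule set_integrable_subset) (use t in auto)
  moreover have "set_integrable lborel {0..t} (field f)" using cont t by (intro field_integrable) auto
  ultimately have "(LINT s:{0..t}|lborel. velocity T f s - field f s)
      = (LINT s:{0..t}|lborel. velocity T f s) - (LINT s:{0..t}|lborel. field f s)"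
    by (rule set_integral_diff(2))
  moreover have "f t = Pc x + (LINT s:{0..t}|lborel. velocity T f s)"
    using t by (subst vel(3)) (simp add: primitive_def)
  ultimately show ?thesis by (simp add: noise_def)
qed

lemma velocity_minus_field_L2:
  assumes f: "f \<in> H1 T (Pc x)"
  shows "(\<lambda>s. velocity T f s + - field f s) \<in> L2_fun T"
  using H1_imp_paths[OF f] velocity_props[OF f T]
  by (intro L2_fun_add L2_fun_uminus field_L2) (auto simp: paths_def)

text \<open>The noise of a path in \<open>H1\<close> has density \<open>velocity\<close> minus
  \<open>field\<close>, and the supremum of the energies is the squared L2 norm of the density; the
  4 compensates the factor 1/4 of the rate function. All later arguments use this
  description.\<close>

lemma rate_function_le_iff:
  assumes f: "f \<in> paths T" and a: "0 \<le> a"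
  shows "rate_function V F T x f \<le> ennreal a \<longleftrightarrow> f 0 = Pc x \<and> (\<forall>m. energy T m (noise f) \<le> 4 * a)"
proof
  assume L: "rate_function V F T x f \<le> ennreal a"
  then have f1: "f \<in> H1 T (Pc x)" by (auto simp: rate_function_eq top_unique split: if_splits)
  let ?g = "\<lambda>s. velocity T f s + - field f s"
  note vel = velocity_props[OF f1 T] and g = velocity_minus_field_L2[OF f1]
  have "ennreal (1 / 4 * (LINT t:{0..T}|lborel. (norm (?g t))\<^sup>2)) \<le> ennreal a"
    using L unfolding rate_function_eq_LINT[OF f1 g refl] .
  then have "(LINT t:{0..T}|lborel. (norm (?g t))\<^sup>2) \<le> 4 * a"
    using a by (subst (asm) ennreal_le_iff) auto
  moreover have "energy T m (noise f) \<le> (LINT t:{0..T}|lborel. (norm (?g t))\<^sup>2)" for m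
    by (rule energy_le_LINT[OF T g]) (rule noise_eq_LINT[OF f1])
  ultimately show "f 0 = Pc x \<and> (\<forall>m. energy T m (noise f) \<le> 4 * a)"
    using vel(1) by (meson order_trans)
next
  assume R: "f 0 = Pc x \<and> (\<forall>m. energy T m (noise f) \<le> 4 * a)"
  have cont: "continuous_on {0..T} f" using f by (simp add: paths_def)
  have "noise f 0 = 0" using R by (simp add: noise_0)
  then obtain g where g: "g \<in> L2_fun T" and gn: "\<And>t. t \<in> {0..T} \<Longrightarrow> noise f t = (LINT s:{0..t}|lborel. g s)"
    and ga: "(LINT s:{0..T}|lborel. (norm (g s))\<^sup>2) \<le> 4 * a"
    using bounded_energy_imp_L2_density[OF T noise_continuous[OF cont], of "4 * a"] R by metis
  \<comment> \<open>Conversely, a density \<open>g\<close> of the noise makes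
    \<open>g + field f\<close> a density of the path, so that \<open>f\<close> lies in
    \<open>H1\<close>.\<close>
  have "f = primitive T (Pc x) (\<lambda>s. g s + field f s)"
  proof
    fix t
    show "f t = primitive T (Pc x) (\<lambda>s. g s + field f s) t"
    proof (cases "t \<in> {0..T}")
      case True
      have "set_integrable lborel {0..t} g"
        using L2_fun_imp_set_integrable[OF g] by (rule set_integrable_subset) (use True in auto)
      moreover have "set_integrable lborel {0..t} (field f)" using cont True by (intro field_integrable) auto
      ultimately have "(LINT s:{0..t}|lborel. g s + field f s)
        = (LINT s:{0..t}|lborel. g s) + (LINT s:{0..t}|lborel. field f s)"
        by (rule set_integral_add(2))
      then show ?thesis using gn[OF True] True by (simp add: primitive_def noise_def algebra_simps)
    next
      case False
      then show ?thesis using f by (auto simp: primitive_def paths_def extensional_def)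
    qed
  qed
  then have f1: "f \<in> H1 T (Pc x)"
    unfolding H1_def using L2_fun_add[OF g field_L2[OF cont]] by blast
  let ?g = "\<lambda>s. velocity T f s + - field f s"
  note g' = velocity_minus_field_L2[OF f1]
  \<comment> \<open>The velocity is an arbitrary choice and may differ from
    \<open>g + field f\<close>, but only on a null set of times, which the integral ignores.\<close>
  have "AE s in lborel. s \<in> {0..T} \<longrightarrow> ?g s - g s = 0"
  proof (rule AE_eq_0_if_primitive_eq_0[OF _ T])
    note i = L2_fun_imp_set_integrable[OF g'] L2_fun_imp_set_integrable[OF g]
    show "set_integrable lborel {0..T} (\<lambda>s. ?g s - g s)" using i by (rule set_integral_diff(1))
    fix t assume t: "t \<in> {0..T}"
    have i': "set_integrable lborel {0..t} ?g" "set_integrable lborel {0..t} g"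
      using t by (intro set_integrable_subset[OF i(1)] set_integrable_subset[OF i(2)]; simp)+
    show "(LINT s:{0..t}|lborel. ?g s - g s) = 0"
      unfolding set_integral_diff(2)[OF i'] using noise_eq_LINT[OF f1 t] gn[OF t] by simp
  qed
  then have "(\<integral>\<^sup>+t\<in>{0..T}. ennreal ((norm (?g t))\<^sup>2) \<partial>lborel) = (\<integral>\<^sup>+t\<in>{0..T}. ennreal ((norm (g t))\<^sup>2) \<partial>lborel)"
    by (intro nn_integral_cong_AE) (auto elim!: eventually_mono simp: indicator_def)
  then have "rate_function V F T x f = ennreal (1 / 4 * (LINT t:{0..T}|lborel. (norm (g t))\<^sup>2))"
    by (rule rate_function_eq_LINT[OF f1 g])
  also have "\<dots> \<le> ennreal a" using ga by (intro ennreal_leI) simp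
  finally show "rate_function V F T x f \<le> ennreal a" .
qed

lemma noise_uniform_limit:
  assumes "\<And>n. continuous_on {0..T} (f n)" "continuous_on {0..T} h" "uniform_limit {0..T} f h sequentially"
  shows "uniform_limit {0..T} (\<lambda>n. noise (f n)) (noise h) sequentially"
proof (rule uniform_limitI)
  fix e :: real assume e: "0 < e"
  have c: "0 < 1 + K * T" using K_pos T by (simp add: add_pos_pos)
  then have "0 < e / (2 * (1 + K * T))" using e by simp
  from uniform_limitD[OF assms(3) this]
  show "\<forall>\<^sub>F n in sequentially. \<forall>t\<in>{0..T}. dist (noise (f n) t) (noise h t) < e"
  proof eventually_elim
    case (elim n)
    show ?case
    proof
      fix t assume t: "t \<in> {0..T}"
      have "norm (noise (f n) t - noise h t) \<le> (1 + K * T) * (e / (2 * (1 + K * T)))"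
        using elim by (intro noise_diff_le assms t) (auto simp: dist_norm intro: less_imp_le)
      also have "\<dots> = e / 2"
        using nonzero_mult_div_cancel_left[of "1 + K * T" "e / 2"] c by (simp add: mult.commute)
      also have "\<dots> < e" using e by simp
      finally show "dist (noise (f n) t) (noise h t) < e" by (simp add: dist_norm)
    qed
  qed
qed

text \<open>A subsequence of \<open>v\<close> converges uniformly, hence so does
  \<open>noise (f n)\<close>, and the Lipschitz inverse makes the paths uniformly Cauchy. The
  \<open>v n\<close> may be any paths of bounded energy: with \<open>v n = noise (f n)\<close> the
  level sets become compact, with nearby interpolations the closed sets are separated.\<close>

lemma near_bounded_energy_subseq:
  assumes f: "\<And>n. f n \<in> paths T" and v: "\<And>n. continuous_on {0..T} (v n)" "\<And>n. v n 0 = 0"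
    and a: "\<And>n m. energy T m (v n) \<le> 4 * a"
    and near: "uniform_limit {0..T} (\<lambda>n t. noise (f n) t - v n t) (\<lambda>_. 0) sequentially"
  obtains h r where "h \<in> paths T" "strict_mono r" "uniform_limit {0..T} (f \<circ> r) h sequentially"
    "rate_function V F T x h \<le> ennreal a"
proof -
  have a0: "0 \<le> a" using energy_nonneg[OF T, of 0 "v 0"] a[of 0 0] by simp
  have fc: "continuous_on {0..T} (f n)" for n using f by (simp add: paths_def)
  obtain w r where w: "continuous_on {0..T} w" and r: "strict_mono r"
    and lim: "uniform_limit {0..T} (v \<circ> r) w sequentially"
    by (rule bounded_energy_subseq[OF T v(1) v(2) a])
  have "uniform_limit {0..T} (\<lambda>n t. noise (f (r n)) t - v (r n) t) (\<lambda>_. 0) sequentially"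
  proof (rule uniform_limitI)
    fix e :: real assume "0 < e"
    from uniform_limitD[OF near this]
    show "\<forall>\<^sub>F n in sequentially. \<forall>t\<in>{0..T}. dist (noise (f (r n)) t - v (r n) t) 0 < e"
      by (rule eventually_subseq[OF r])
  qed
  from uniform_limit_add[OF this lim]
  have nlim: "uniform_limit {0..T} (\<lambda>n. noise (f (r n))) w sequentially" by (simp add: comp_def)
  define C where "C = 2 * exp (2 * K * T)"
  have C: "0 < C" by (simp add: C_def)
  have "uniformly_convergent_on {0..T} (\<lambda>n. f (r n))"
  proof (rule Cauchy_uniformly_convergent, rule uniformly_Cauchy_onI)
    fix e :: real assume e: "0 < e"
    have "uniformly_Cauchy_on {0..T} (\<lambda>n. noise (f (r n)))"
      using nlim by (intro uniformly_convergent_Cauchy) (auto simp: uniformly_convergent_on_def)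
    then obtain N where N: "\<And>t m n. t \<in> {0..T} \<Longrightarrow> N \<le> m \<Longrightarrow> N \<le> n \<Longrightarrow>
        dist (noise (f (r m)) t) (noise (f (r n)) t) < e / (2 * C)"
      using e C unfolding uniformly_Cauchy_on_def by (meson divide_pos_pos mult_pos_pos zero_less_numeral)
    show "\<exists>N. \<forall>t\<in>{0..T}. \<forall>m\<ge>N. \<forall>n\<ge>N. dist (f (r m) t) (f (r n) t) < e"
    proof (intro exI[of _ N] ballI allI impI)
      fix t m n assume "t \<in> {0..T}" "N \<le> m" "N \<le> n"
      then have "norm (f (r m) t - f (r n) t) \<le> C * (e / (2 * C))"
        unfolding C_def using N[of _ m n]
        by (intro diff_le_noise_diff fc) (auto simp: dist_norm C_def intro: less_imp_le)
      also have "\<dots> < e" using e C by simp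
      finally show "dist (f (r m) t) (f (r n) t) < e" by (simp add: dist_norm)
    qed
  qed
  then obtain h0 where h0: "uniform_limit {0..T} (\<lambda>n. f (r n)) h0 sequentially"
    by (auto simp: uniformly_convergent_on_def)
  \<comment> \<open>The uniform limit is undetermined outside \<open>{0..T}\<close>; the restriction
    makes it a point of the path space.\<close>
  define h where "h = restrict h0 {0..T}"
  have h: "uniform_limit {0..T} (\<lambda>n. f (r n)) h sequentially"
    using h0 by (rule uniform_limit_cong'[THEN iffD1, rotated 2]) (auto simp: h_def)
  have hc: "continuous_on {0..T} h"
    by (rule uniform_limit_theorem[OF _ h]) (auto simp: fc)
  then have hp: "h \<in> paths T" by (simp add: paths_def h_def)
  have nh: "uniform_limit {0..T} (\<lambda>n. noise (f (r n))) (noise h) sequentially"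
    by (rule noise_uniform_limit[OF fc hc h])
  have eq: "noise h t = w t" if "t \<in> {0..T}" for t
    using tendsto_uniform_limitI[OF nh that] tendsto_uniform_limitI[OF nlim that] by (rule LIMSEQ_unique)
  have "(\<lambda>n. (v \<circ> r) n 0) \<longlonglongrightarrow> w 0" using tendsto_uniform_limitI[OF lim, of 0] T by simp
  then have "w 0 = 0" by (simp add: v(2) LIMSEQ_const_iff)
  then have "h 0 = Pc x" using eq[of 0] T by (simp add: noise_0)
  moreover have "energy T m (noise h) \<le> 4 * a" for m
  proof -
    have "energy T m w \<le> 4 * a" by (rule energy_uniform_limit[OF T lim]) (simp add: a)
    moreover have "energy T m (noise h) = energy T m w"
      unfolding energy_def incr_def using grid_in[OF T, of _ m] by (intro sum.cong refl) (simp add: eq)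
    ultimately show ?thesis by simp
  qed
  ultimately have "rate_function V F T x h \<le> ennreal a"
    using rate_function_le_iff[OF hp a0] by simp
  then show ?thesis using that[OF hp r] h by (simp add: comp_def)
qed

text \<open>Lower semicontinuity comes for free: the path space is Hausdorff, so compact level sets
  are closed, and for \<alpha> = \<infinity> the set to be shown open is empty.\<close>

lemma good_rate_function: "good_rate_function (path_space T) (rate_function V F T x)"
proof -
  have comp: "compactin (path_space T) {f \<in> paths T. rate_function V F T x f \<le> \<alpha>}" if "\<alpha> < \<infinity>" for \<alpha>
  proof (rule compactin_path_spaceI[OF T])
    obtain a where a: "\<alpha> = ennreal a" "0 \<le> a" using \<open>\<alpha> < \<infinity>\<close> by (cases \<alpha>) auto
    fix \<sigma> :: "nat \<Rightarrow> real \<Rightarrow> 'a"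
    assume s: "range \<sigma> \<subseteq> {f \<in> paths T. rate_function V F T x f \<le> \<alpha>}"
    then have sp: "\<sigma> n \<in> paths T" and sr: "rate_function V F T x (\<sigma> n) \<le> ennreal a" for n using a by auto
    have e: "\<sigma> n 0 = Pc x" "energy T m (noise (\<sigma> n)) \<le> 4 * a" for m n
      using sr[of n] rate_function_le_iff[OF sp[of n] a(2)] by auto
    obtain h r where "h \<in> paths T" "strict_mono r" "uniform_limit {0..T} (\<sigma> \<circ> r) h sequentially"
      "rate_function V F T x h \<le> ennreal a"
    proof (rule near_bounded_energy_subseq[of \<sigma> "\<lambda>n. noise (\<sigma> n)" a, OF sp])
      show "continuous_on {0..T} (noise (\<sigma> n))" for n using sp[of n] by (intro noise_continuous) (simp add: paths_def)
      show "uniform_limit {0..T} (\<lambda>n t. noise (\<sigma> n) t - noise (\<sigma> n) t) (\<lambda>_. 0) sequentially"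
        by (simp add: uniform_limit_const)
    qed (use e in \<open>auto simp: noise_0\<close>)
    then show "\<exists>l\<in>{f \<in> paths T. rate_function V F T x f \<le> \<alpha>}. \<exists>r. strict_mono r
        \<and> uniform_limit {0..T} (\<sigma> \<circ> r) l sequentially"
      using a by blast
  qed auto
  have "openin (path_space T) {f \<in> paths T. \<alpha> < rate_function V F T x f}" for \<alpha>
  proof (cases "\<alpha> = \<infinity>")
    case False
    then have "closedin (path_space T) {f \<in> paths T. rate_function V F T x f \<le> \<alpha>}"
      by (intro compactin_path_space_imp_closedin comp) (simp add: top.not_eq_extremum)
    then have "openin (path_space T) (topspace (path_space T) - {f \<in> paths T. rate_function V F T x f \<le> \<alpha>})"
      by blast
    also have "topspace (path_space T) - {f \<in> paths T. rate_function V F T x f \<le> \<alpha>}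
        = {f \<in> paths T. \<alpha> < rate_function V F T x f}" by auto
    finally show ?thesis .
  qed simp
  with comp show ?thesis unfolding good_rate_function_def by simp
qed

end


section \<open>Large deviation bounds\<close>

text \<open>The 2 in the exponent matches the normalization \<sigma>^2 / 2, and the constant
  \<open>A\<close> contributes \<open>\<sigma>\<^sup>2 / 2 * ln A\<close>, which tends to 0.\<close>

lemma Limsup_log_le:
  assumes "0 < A" "\<forall>\<^sub>F \<sigma> in at_right 0. p \<sigma> \<le> ennreal (A * exp (- (2 * c) / \<sigma>\<^sup>2))"
  shows "Limsup (at_right 0) (\<lambda>\<sigma>. ereal (\<sigma>\<^sup>2 / 2) * ln_ennreal (p \<sigma>)) \<le> ereal (- c)"
proof -
  have "((\<lambda>\<sigma>::real. \<sigma>\<^sup>2 / 2 * ln A - c) \<longlongrightarrow> 0\<^sup>2 / 2 * ln A - c) (at_right 0)"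
    by (intro tendsto_intros) auto
  then have lim: "((\<lambda>\<sigma>::real. ereal (\<sigma>\<^sup>2 / 2 * ln A - c)) \<longlongrightarrow> ereal (- c)) (at_right 0)"
    by (simp add: tendsto_ereal)
  have "\<forall>\<^sub>F \<sigma> in at_right 0. ereal (\<sigma>\<^sup>2 / 2) * ln_ennreal (p \<sigma>) \<le> ereal (\<sigma>\<^sup>2 / 2 * ln A - c)"
    using assms(2) eventually_at_right_less[of "0::real"]
  proof eventually_elim
    case (elim \<sigma>)
    show ?case
    proof (cases "p \<sigma> = 0")
      case True
      then show ?thesis using elim by (simp add: ln_ennreal_def)
    next
      case False
      have "p \<sigma> \<noteq> \<infinity>" using elim(1) by (auto simp: top_unique)
      then obtain r where r: "p \<sigma> = ennreal r" "0 < r"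
        using False by (cases "p \<sigma>") (auto simp: less_le)
      then have "r \<le> A * exp (- (2 * c) / \<sigma>\<^sup>2)" using elim(1) assms(1) by simp
      then have "ln r \<le> ln (A * exp (- (2 * c) / \<sigma>\<^sup>2))" using r assms(1) by simp
      also have "\<dots> = ln A - 2 * c / \<sigma>\<^sup>2" using assms(1) by (simp add: ln_mult)
      finally have "\<sigma>\<^sup>2 / 2 * ln r \<le> \<sigma>\<^sup>2 / 2 * (ln A - 2 * c / \<sigma>\<^sup>2)" by (intro mult_left_mono) auto
      also have "\<dots> = \<sigma>\<^sup>2 / 2 * ln A - c" using elim(2) by (simp add: field_simps)
      finally show ?thesis using r by (simp add: ln_ennreal_def)
    qed
  qed
  then have "Limsup (at_right 0) (\<lambda>\<sigma>. ereal (\<sigma>\<^sup>2 / 2) * ln_ennreal (p \<sigma>))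
      \<le> Limsup (at_right 0) (\<lambda>\<sigma>::real. ereal (\<sigma>\<^sup>2 / 2 * ln A - c))"
    by (rule Limsup_mono)
  also have "\<dots> = ereal (- c)" by (rule lim_imp_Limsup[OF _ lim]) simp
  finally show ?thesis .
qed

lemma Liminf_log_ge:
  assumes "0 < A" "\<forall>\<^sub>F \<sigma> in at_right 0. ennreal (A * exp (- (2 * c) / \<sigma>\<^sup>2)) \<le> p \<sigma>"
    and "\<forall>\<^sub>F \<sigma> in at_right 0. p \<sigma> \<noteq> \<infinity>"
  shows "ereal (- c) \<le> Liminf (at_right 0) (\<lambda>\<sigma>. ereal (\<sigma>\<^sup>2 / 2) * ln_ennreal (p \<sigma>))"
proof -
  have "((\<lambda>\<sigma>::real. \<sigma>\<^sup>2 / 2 * ln A - c) \<longlongrightarrow> 0\<^sup>2 / 2 * ln A - c) (at_right 0)"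
    by (intro tendsto_intros) auto
  then have lim: "((\<lambda>\<sigma>::real. ereal (\<sigma>\<^sup>2 / 2 * ln A - c)) \<longlongrightarrow> ereal (- c)) (at_right 0)"
    by (simp add: tendsto_ereal)
  have "\<forall>\<^sub>F \<sigma> in at_right 0. ereal (\<sigma>\<^sup>2 / 2 * ln A - c) \<le> ereal (\<sigma>\<^sup>2 / 2) * ln_ennreal (p \<sigma>)"
    using assms(2,3) eventually_at_right_less[of "0::real"]
  proof eventually_elim
    case (elim \<sigma>)
    obtain r where r: "p \<sigma> = ennreal r" "0 \<le> r" using elim(2) by (cases "p \<sigma>") auto
    have pos: "0 < A * exp (- (2 * c) / \<sigma>\<^sup>2)" using assms(1) by simp
    have le: "A * exp (- (2 * c) / \<sigma>\<^sup>2) \<le> r" using elim(1) r by simp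
    then have "0 < r" using pos by linarith
    have "ln A - 2 * c / \<sigma>\<^sup>2 = ln (A * exp (- (2 * c) / \<sigma>\<^sup>2))" using assms(1) by (simp add: ln_mult)
    also have "\<dots> \<le> ln r" using le pos by simp
    finally have "\<sigma>\<^sup>2 / 2 * (ln A - 2 * c / \<sigma>\<^sup>2) \<le> \<sigma>\<^sup>2 / 2 * ln r" by (intro mult_left_mono) auto
    moreover have "\<sigma>\<^sup>2 / 2 * (ln A - 2 * c / \<sigma>\<^sup>2) = \<sigma>\<^sup>2 / 2 * ln A - c" using elim(3) by (simp add: field_simps)
    ultimately show ?case using r \<open>0 < r\<close> by (simp add: ln_ennreal_def)
  qed
  then have "Liminf (at_right 0) (\<lambda>\<sigma>::real. ereal (\<sigma>\<^sup>2 / 2 * ln A - c))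
    \<le> Liminf (at_right 0) (\<lambda>\<sigma>. ereal (\<sigma>\<^sup>2 / 2) * ln_ennreal (p \<sigma>))"
    by (rule Liminf_mono)
  moreover have "Liminf (at_right 0) (\<lambda>\<sigma>::real. ereal (\<sigma>\<^sup>2 / 2 * ln A - c)) = ereal (- c)"
    by (rule lim_imp_Liminf[OF _ lim]) simp
  ultimately show ?thesis by simp
qed

lemma eventually_small_noise:
  assumes "0 < (b::real)"
  shows "\<forall>\<^sub>F \<sigma> in at_right 0. k \<le> b / \<sigma>\<^sup>2"
proof -
  have "filterlim (\<lambda>\<sigma>::real. \<sigma>\<^sup>2) (at_right 0) (at_right 0)"
    unfolding filterlim_at
  proof
    have "((\<lambda>\<sigma>::real. \<sigma>\<^sup>2) \<longlongrightarrow> 0\<^sup>2) (at_right 0)" by (intro tendsto_intros)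
    then show "((\<lambda>\<sigma>::real. \<sigma>\<^sup>2) \<longlongrightarrow> 0) (at_right 0)" by simp
    show "\<forall>\<^sub>F \<sigma>::real in at_right 0. \<sigma>\<^sup>2 \<in> {0<..} \<and> \<sigma>\<^sup>2 \<noteq> 0"
      using eventually_at_right_less[of "0::real"] by eventually_elim simp
  qed
  from filterlim_compose[OF filterlim_inverse_at_top_right this]
  have "filterlim (\<lambda>\<sigma>::real. b * inverse (\<sigma>\<^sup>2)) at_top (at_right 0)"
    by (intro filterlim_tendsto_pos_mult_at_top[OF tendsto_const assms])
  then show ?thesis by (simp add: filterlim_at_top divide_inverse)
qed

section \<open>Deterministic estimates for interpolations\<close>

lemma incr_scaleR: "incr T m (\<lambda>t. \<sigma> *\<^sub>R w t) i = \<sigma> *\<^sub>R incr T m w i"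
  by (simp add: incr_def scaleR_diff_right)

lemma energy_scaleR: "energy T m (\<lambda>t. \<sigma> *\<^sub>R w t) = \<sigma>\<^sup>2 * energy T m w"
  unfolding energy_def sum_distrib_left
  by (intro sum.cong refl) (simp add: incr_scaleR power_mult_distrib mult.assoc)

lemma step_diff: "step T m w t - step T m u t = step T m (\<lambda>s. w s - u s) t"
  unfolding step_def sum_subtractf[symmetric]
  by (intro sum.cong refl) (simp add: incr_def algebra_simps)

text \<open>Finite energy bounds the increments at level m + j by sqrt(a T / 2^(m+j)). They decay by
  1/sqrt 2 < 3/4 per level, so the chaining estimate applies.\<close>

lemma small_energy_interpolation:
  fixes w :: "real \<Rightarrow> 'a::euclidean_space"
  assumes T: "0 < T" and w: "continuous_on {0..T} w" and a: "\<And>k. energy T k w \<le> a" and t: "t \<in> {0..T}"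
  shows "norm (w t - (w 0 + (LINT s:{0..t}|lborel. step T m w s))) \<le> 4 * sqrt (a * T / 2 ^ m)"
proof (rule interpolation_error_le[OF T w _ _ t])
  have a0: "0 \<le> a" using energy_nonneg[OF T, of 0 w] a[of 0] by linarith
  then show "0 \<le> sqrt (a * T / 2 ^ m)" using T by simp
  fix j i :: nat assume i: "i < 2 ^ (m + j)"
  have "(norm (incr T (m + j) w i))\<^sup>2 \<le> (T / 2 ^ (m + j)) * energy T (m + j) w"
    using grid_increment_le_energy[OF T, of i "Suc i" "m + j" w] i by (simp add: incr_def grid_Suc)
  also have "\<dots> \<le> (T / 2 ^ (m + j)) * a" using T by (intro mult_left_mono a) simp
  also have "\<dots> = (a * T / 2 ^ m) * (1 / 2) ^ j" by (simp add: power_add power_one_over field_simps)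
  also have "\<dots> \<le> (a * T / 2 ^ m) * ((3 / 4)\<^sup>2) ^ j"
    using a0 T by (intro mult_left_mono power_mono) (auto simp: power2_eq_square)
  also have "((3 / 4 :: real)\<^sup>2) ^ j = ((3 / 4) ^ j)\<^sup>2" by (simp only: power_mult[symmetric] mult.commute)
  finally have "norm (incr T (m + j) w i) \<le> sqrt ((a * T / 2 ^ m) * ((3 / 4) ^ j)\<^sup>2)" by (rule real_le_rsqrt)
  then show "norm (incr T (m + j) w i) \<le> sqrt (a * T / 2 ^ m) * (3 / 4) ^ j"
    by (subst (asm) real_sqrt_mult) simp
qed

text \<open>The increments give energy at most \<open>(2 ^ m * \<rho>)\<^sup>2 / T\<close>; the
  Hoelder bound for the primitive multiplies this by at most \<open>T\<close> under the
  root.\<close>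

lemma norm_LINT_step_le:
  fixes u :: "real \<Rightarrow> 'a::euclidean_space"
  assumes T: "0 < T" and \<rho>: "0 \<le> \<rho>" "\<And>i. i < 2 ^ m \<Longrightarrow> norm (incr T m u i) \<le> \<rho>" and t: "t \<in> {0..T}"
  shows "norm (LINT s:{0..t}|lborel. step T m u s) \<le> 2 ^ m * \<rho>"
proof -
  have "energy T m u \<le> (\<Sum>i<(2::nat) ^ m. \<rho>\<^sup>2 / (T / 2 ^ m))"
    unfolding energy_def using T \<rho> by (intro sum_mono divide_right_mono power_mono) auto
  also have "\<dots> = (2 ^ m * \<rho>)\<^sup>2 / T" by (simp add: power2_eq_square)
  finally have e: "energy T m u \<le> (2 ^ m * \<rho>)\<^sup>2 / T" .
  have "(LINT s:{0..T}|lborel. (norm (step T m u s))\<^sup>2) \<le> (2 ^ m * \<rho>)\<^sup>2 / T"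
    using LINT_norm_step_le_energy[OF T, of m u] e by linarith
  from norm_LINT_le_sqrt[OF step_in_L2_fun[OF T] this, of 0 t]
  have "norm ((LINT s:{0..t}|lborel. step T m u s) - (LINT s:{0..0}|lborel. step T m u s))
      \<le> sqrt (t * ((2 ^ m * \<rho>)\<^sup>2 / T))" using t by simp
  also have "\<dots> \<le> sqrt ((2 ^ m * \<rho>)\<^sup>2)"
  proof (rule real_sqrt_le_mono)
    have "t * ((2 ^ m * \<rho>)\<^sup>2 / T) \<le> T * ((2 ^ m * \<rho>)\<^sup>2 / T)" using t T by (intro mult_right_mono) auto
    then show "t * ((2 ^ m * \<rho>)\<^sup>2 / T) \<le> (2 ^ m * \<rho>)\<^sup>2" using T by simp
  qed
  also have "(LINT s:{0..0}|lborel. step T m u s) = 0"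
    using LINT_step_grid[OF T, of 0 m u] by simp
  finally show ?thesis using \<rho>(1) by simp
qed

section \<open>The diffusion as a random path and its driving noise\<close>

locale self_interacting_noise = self_interacting V F x T LV LF
  for V F :: "'a::euclidean_space \<Rightarrow> real" and x :: "'a init" and T LV LF :: real +
  fixes M :: "'w measure" and W :: "real \<Rightarrow> 'w \<Rightarrow> 'a" and X :: "real \<Rightarrow> real \<Rightarrow> 'w \<Rightarrow> 'a"
  assumes W: "brownian_motion M W"
    and sol: "\<And>\<sigma>. \<sigma> > 0 \<Longrightarrow> strong_solution V F x \<sigma> M W (X \<sigma>)"
begin

definition path :: "real \<Rightarrow> 'w \<Rightarrow> real \<Rightarrow> 'a" where
  "path \<sigma> \<omega> = (\<lambda>t\<in>{0..T}. X \<sigma> t \<omega>)"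

lemma sets_brownian_filtration: "sets (brownian_filtration M W t) \<subseteq> sets M"
  and space_brownian_filtration: "space (brownian_filtration M W t) = space M"
proof -
  let ?G = "{W s -` A \<inter> space M |s A. 0 \<le> s \<and> s \<le> t \<and> A \<in> sets borel} \<union> null_sets M"
  have G: "?G \<subseteq> sets M"
    using brownian_motion_measurable[OF W] by (auto intro: measurable_sets)
  then have "?G \<subseteq> Pow (space M)" using sets.space_closed by blast
  then show "sets (brownian_filtration M W t) \<subseteq> sets M" "space (brownian_filtration M W t) = space M"
    unfolding brownian_filtration_def using sets.sigma_sets_subset[OF G]
    by (simp_all add: sets_measure_of space_measure_of)
qed

lemma X_measurable:
  assumes "0 < \<sigma>" "0 \<le> t"
  shows "X \<sigma> t \<in> borel_measurable M"
proof (rule measurable_from_subalg)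
  show "subalgebra M (brownian_filtration M W t)"
    using sets_brownian_filtration space_brownian_filtration by (simp add: subalgebra_def)
  show "X \<sigma> t \<in> borel_measurable (brownian_filtration M W t)"
    using sol[OF assms(1)] assms(2) by (simp add: strong_solution_def)
qed

lemma X_continuous: "0 < \<sigma> \<Longrightarrow> \<omega> \<in> space M \<Longrightarrow> continuous_on {0..} (\<lambda>t. X \<sigma> t \<omega>)"
  using sol by (simp add: strong_solution_def)

lemma path_in_paths:
  assumes "0 < \<sigma>" "\<omega> \<in> space M"
  shows "path \<sigma> \<omega> \<in> paths T"
proof -
  have "continuous_on {0..T} (\<lambda>t. X \<sigma> t \<omega>)"
    by (rule continuous_on_subset[OF X_continuous[OF assms]]) auto
  then have "continuous_on {0..T} (path \<sigma> \<omega>)"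
    by (rule continuous_on_eq) (simp add: path_def)
  then show ?thesis by (simp add: paths_def path_def)
qed

lemma path_measurable:
  assumes "0 < \<sigma>"
  shows "path \<sigma> \<in> measurable M (borel_of (path_space T))"
proof (rule measurable_path_map[OF T])
  show "(\<lambda>\<omega>. path \<sigma> \<omega> t) \<in> borel_measurable M" if "t \<in> {0..T}" for t
    using that X_measurable[OF assms, of t] by (simp add: path_def)
qed (rule path_in_paths[OF assms])

lemma emeasure_path_law:
  assumes "0 < \<sigma>" "A \<in> sets (borel_of (path_space T))"
  shows "emeasure (path_law T M (X \<sigma>)) A = emeasure M {\<omega>\<in>space M. path \<sigma> \<omega> \<in> A}"
proof -
  have "path_law T M (X \<sigma>) = distr M (borel_of (path_space T)) (path \<sigma>)"
    by (simp add: path_law_def path_def[abs_def])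
  moreover have "path \<sigma> -` A \<inter> space M = {\<omega>\<in>space M. path \<sigma> \<omega> \<in> A}" by auto
  ultimately show ?thesis using emeasure_distr[OF path_measurable[OF assms(1)] assms(2)] by simp
qed

text \<open>Along a continuous trajectory \<open>drift\<close> and \<open>field\<close> agree, and
  \<open>field\<close> looks only at the past, so the restriction to \<open>{0..T}\<close> changes
  nothing. The equation of the diffusion then says that its noise is \<sigma> times the Brownian
  path.\<close>

lemma AE_noise_path:
  assumes \<sigma>: "0 < \<sigma>"
  shows "AE \<omega> in M. \<forall>t\<in>{0..T}. noise (path \<sigma> \<omega>) t = \<sigma> *\<^sub>R W t \<omega>"
proof -
  have 1: "AE \<omega> in M. X \<sigma> 0 \<omega> = Pc x"
    and 2: "AE \<omega> in M. \<forall>t\<ge>0. set_integrable lborel {0..t} (drift V F x (\<lambda>s. X \<sigma> s \<omega>)) \<and>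
        X \<sigma> t \<omega> = X \<sigma> 0 \<omega> + (LINT s:{0..t}|lborel. drift V F x (\<lambda>s. X \<sigma> s \<omega>) s) + \<sigma> *\<^sub>R W t \<omega>"
    using sol[OF \<sigma>] by (simp_all add: strong_solution_def)
  show ?thesis using 1 2 AE_space
  proof eventually_elim
    case (elim \<omega>)
    show ?case
    proof
      fix t assume t: "t \<in> {0..T}"
      have "(LINT s:{0..t}|lborel. drift V F x (\<lambda>s. X \<sigma> s \<omega>) s) = (LINT s:{0..t}|lborel. field (path \<sigma> \<omega>) s)"
      proof (rule set_lebesgue_integral_cong)
        show "\<forall>s. s \<in> {0..t} \<longrightarrow> drift V F x (\<lambda>s. X \<sigma> s \<omega>) s = field (path \<sigma> \<omega>) s"
        proof (intro allI impI)
          fix s assume s: "s \<in> {0..t}"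
          have "continuous_on {0..s} (\<lambda>s. X \<sigma> s \<omega>)"
            by (rule continuous_on_subset[OF X_continuous[OF \<sigma> elim(3)]]) auto
          then have "drift V F x (\<lambda>s. X \<sigma> s \<omega>) s = field (\<lambda>s. X \<sigma> s \<omega>) s"
            using s by (intro drift_eq_field) auto
          also have "\<dots> = field (path \<sigma> \<omega>) s"
            using s t by (intro field_cong) (auto simp: path_def)
          finally show "drift V F x (\<lambda>s. X \<sigma> s \<omega>) s = field (path \<sigma> \<omega>) s" .
        qed
      qed simp
      moreover have "X \<sigma> t \<omega> = X \<sigma> 0 \<omega> + (LINT s:{0..t}|lborel. drift V F x (\<lambda>s. X \<sigma> s \<omega>) s) + \<sigma> *\<^sub>R W t \<omega>"
        by (rule elim(2)[rule_format, THEN conjunct2]) (use t in simp)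
      moreover have "path \<sigma> \<omega> t = X \<sigma> t \<omega>" using t by (simp add: path_def)
      ultimately show "noise (path \<sigma> \<omega>) t = \<sigma> *\<^sub>R W t \<omega>" using elim(1) by (simp add: noise_def)
    qed
  qed
qed

lemma AE_driving_noise: "AE \<omega> in M. W 0 \<omega> = 0 \<and> continuous_on {0..T} (\<lambda>t. W t \<omega>)"
  using brownian_motion_AE[OF W] by eventually_elim (auto intro: continuous_on_subset)

text \<open>Exceptional event of the chaining argument: off it,
  \<open>interpolation_error_le\<close> applies to \<sigma> W with constant \<open>d\<close>, on all
  levels from \<open>m\<close> on simultaneously.\<close>

definition oscillates :: "real \<Rightarrow> real \<Rightarrow> nat \<Rightarrow> 'w set" where
  "oscillates \<sigma> d m = {\<omega>\<in>space M. \<exists>j. \<exists>i<2 ^ (m + j). d * (3 / 4) ^ j < norm (\<sigma> *\<^sub>R incr T (m + j) (\<lambda>t. W t \<omega>) i)}"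

lemma oscillates_measurable [measurable]: "oscillates \<sigma> d m \<in> sets M"
proof -
  note [measurable] = brownian_motion_incr_measurable[OF W T]
  show ?thesis unfolding oscillates_def by measurable
qed

lemma interpolation_error_noise:
  assumes "\<omega> \<in> space M" "\<omega> \<notin> oscillates \<sigma> d m" "W 0 \<omega> = 0" "continuous_on {0..T} (\<lambda>t. W t \<omega>)" "0 \<le> d"
    and "t \<in> {0..T}"
  shows "norm (\<sigma> *\<^sub>R W t \<omega> - (LINT s:{0..t}|lborel. step T m (\<lambda>t. \<sigma> *\<^sub>R W t \<omega>) s)) \<le> 4 * d"
proof -
  have "norm (\<sigma> *\<^sub>R W t \<omega> - (\<sigma> *\<^sub>R W 0 \<omega> + (LINT s:{0..t}|lborel. step T m (\<lambda>t. \<sigma> *\<^sub>R W t \<omega>) s))) \<le> 4 * d"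
  proof (rule interpolation_error_le[OF T _ assms(5) _ assms(6)])
    show "continuous_on {0..T} (\<lambda>t. \<sigma> *\<^sub>R W t \<omega>)" by (intro continuous_intros assms)
    show "norm (incr T (m + j) (\<lambda>t. \<sigma> *\<^sub>R W t \<omega>) i) \<le> d * (3 / 4) ^ j" if "i < 2 ^ (m + j)" for j i
    proof -
      have "\<not> d * (3 / 4) ^ j < norm (\<sigma> *\<^sub>R incr T (m + j) (\<lambda>t. W t \<omega>) i)"
        using assms(1,2) that unfolding oscillates_def by blast
      then show ?thesis unfolding incr_scaleR by (simp only: not_less)
    qed
  qed
  then show ?thesis using assms(3) by simp
qed

text \<open>The decay rate d^2 2^m / (4 T) exceeds any given \<open>b\<close> once \<open>m\<close>
  is large: the interpolations are exponentially good approximations of \<sigma> W.\<close>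

lemma oscillates_le:
  assumes "0 < d" "0 < b" "4 * T * b \<le> d\<^sup>2 * 2 ^ m"
  obtains B where "0 < B" "\<forall>\<^sub>F \<sigma> in at_right 0. emeasure M (oscillates \<sigma> d m) \<le> ennreal (B * exp (- b / \<sigma>\<^sup>2))"
proof -
  let ?B = "2 * sqrt 2 ^ DIM('a) * 2 ^ m :: real"
  have pos: "0 < d\<^sup>2 * 2 ^ m / (32 * T)" using assms(1) T by simp
  have "\<forall>\<^sub>F \<sigma> in at_right 0. emeasure M (oscillates \<sigma> d m) \<le> ennreal (?B * exp (- b / \<sigma>\<^sup>2))"
    using eventually_small_noise[OF pos, of "ln 4"] eventually_at_right_less[of "0::real"]
  proof eventually_elim
    case (elim \<sigma>)
    have "emeasure M (oscillates \<sigma> d m) \<le> ennreal (?B * exp (- (d\<^sup>2 * 2 ^ m / (4 * T)) / \<sigma>\<^sup>2))"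
      unfolding oscillates_def using elim by (intro oscillation_tail[OF W T assms(1)]) simp_all
    also have "\<dots> \<le> ennreal (?B * exp (- b / \<sigma>\<^sup>2))"
    proof (intro ennreal_leI mult_left_mono)
      have "b \<le> d\<^sup>2 * 2 ^ m / (4 * T)" using assms(3) T by (simp add: field_simps)
      then have "- (d\<^sup>2 * 2 ^ m / (4 * T)) / \<sigma>\<^sup>2 \<le> - b / \<sigma>\<^sup>2" by (intro divide_right_mono) auto
      then show "exp (- (d\<^sup>2 * 2 ^ m / (4 * T)) / \<sigma>\<^sup>2) \<le> exp (- b / \<sigma>\<^sup>2)" by simp
    qed simp
    finally show ?case .
  qed
  then show ?thesis using that[of ?B] by simp
qed

lemma closed_separation:
  assumes C: "closedin (path_space T) C" and rate: "\<And>f. f \<in> C \<Longrightarrow> \<not> rate_function V F T x f \<le> ennreal a"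
  obtains \<delta> where "0 < \<delta>" "\<And>f v. f \<in> C \<Longrightarrow> continuous_on {0..T} v \<Longrightarrow> v 0 = 0 \<Longrightarrow>
    \<forall>m. energy T m v \<le> 4 * a \<Longrightarrow> \<forall>t\<in>{0..T}. norm (noise f t - v t) \<le> \<delta> \<Longrightarrow> False"
proof (rule ccontr)
  assume "\<not> thesis"
  then have "\<exists>f v. f \<in> C \<and> continuous_on {0..T} v \<and> v 0 = 0 \<and> (\<forall>m. energy T m v \<le> 4 * a)
      \<and> (\<forall>t\<in>{0..T}. norm (noise f t - v t) \<le> 1 / Suc n)" for n
    using that[of "1 / Suc n"] by auto
  then obtain f v where f: "\<And>n. f n \<in> C" and v: "\<And>n. continuous_on {0..T} (v n)" "\<And>n. v n 0 = 0"
    and e: "\<And>n m. energy T m (v n) \<le> 4 * a"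
    and near: "\<And>n t. t \<in> {0..T} \<Longrightarrow> norm (noise (f n) t - v n t) \<le> 1 / Suc n"
    by metis
  have "C \<subseteq> paths T" using closedin_subset[OF C] by simp
  then have fp: "f n \<in> paths T" for n using f by blast
  have near': "uniform_limit {0..T} (\<lambda>n t. noise (f n) t - v n t) (\<lambda>_. 0) sequentially"
  proof (rule uniform_limitI)
    fix e :: real assume "0 < e"
    have "(\<lambda>n. 1 / real (Suc n)) \<longlonglongrightarrow> 0" by (rule LIMSEQ_Suc[OF lim_const_over_n])
    from order_tendstoD(2)[OF this \<open>0 < e\<close>]
    show "\<forall>\<^sub>F n in sequentially. \<forall>t\<in>{0..T}. dist (noise (f n) t - v n t) 0 < e"
    proof eventually_elim
      case (elim n)
      then show ?case using near[of _ n] le_less_trans by (fastforce simp: dist_norm)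
    qed
  qed
  obtain h r where h: "h \<in> paths T" and r: "strict_mono r" and lim: "uniform_limit {0..T} (f \<circ> r) h sequentially"
    and hr: "rate_function V F T x h \<le> ennreal a"
    by (rule near_bounded_energy_subseq[OF fp v(1) v(2) e near'])
  have "h \<in> C"
  proof (rule ccontr)
    assume "h \<notin> C"
    moreover have "openin (path_space T) (paths T - C)" using C by (simp add: closedin_def)
    ultimately obtain d where d: "0 < d" "\<And>g. g \<in> paths T \<Longrightarrow> (\<forall>t\<in>{0..T}. dist (h t) (g t) \<le> d) \<Longrightarrow> g \<in> paths T - C"
      using h unfolding openin_path_space_iff[OF T] by (meson DiffI)
    have "\<forall>\<^sub>F n in sequentially. \<forall>t\<in>{0..T}. dist ((f \<circ> r) n t) (h t) < d"
      using uniform_limitD[OF lim d(1)] .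
    then obtain n where "\<forall>t\<in>{0..T}. dist (f (r n) t) (h t) < d"
      using eventually_happens'[OF sequentially_bot] by fastforce
    then have "f (r n) \<in> paths T - C" using fp by (intro d(2)) (auto simp: dist_commute intro: less_imp_le)
    then show False using f by blast
  qed
  then show False using rate hr by blast
qed

lemma interpolation_continuous: "continuous_on {0..T} (\<lambda>t. LINT s:{0..t}|lborel. step T m w s)"
proof -
  have "primitive T 0 (step T m w) \<in> paths T"
    by (rule H1_imp_paths[of _ 0]) (use step_in_L2_fun[OF T] in \<open>auto simp: H1_def\<close>)
  then have "continuous_on {0..T} (primitive T 0 (step T m w))" by (simp add: paths_def)
  then show ?thesis by (rule continuous_on_eq) (simp add: primitive_def)
qed

lemma ex_dyadic_level:
  assumes "0 < (d::real)"
  obtains m :: nat where "b \<le> d * 2 ^ m"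
proof -
  obtain m where "b / d < 2 ^ m" using real_arch_pow[of 2 "b / d"] by auto
  then show ?thesis using that[of m] assms by (simp add: field_simps less_imp_le)
qed

text \<open>If the diffusion is in \<open>C\<close>, then either the grid energy of \<sigma> W is at
  least \<open>4 * a\<close> or \<sigma> W is far from its interpolation; otherwise the
  interpolation would violate the separation. The level \<open>m\<close> depends on
  \<open>C\<close>, \<open>a\<close> and \<eta>, not on \<sigma>.\<close>

lemma closed_exponential_bound:
  assumes C: "closedin (path_space T) C" and rate: "\<And>f. f \<in> C \<Longrightarrow> \<not> rate_function V F T x f \<le> ennreal a"
    and a: "0 < a" and \<eta>: "0 < \<eta>" "\<eta> < 1"
  shows "\<exists>A>0. \<forall>\<^sub>F \<sigma> in at_right 0. emeasure M {\<omega>\<in>space M. path \<sigma> \<omega> \<in> C} \<le> ennreal (A * exp (- (2 * ((1 - \<eta>) * a)) / \<sigma>\<^sup>2))"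
proof -
  obtain \<delta> where \<delta>: "0 < \<delta>" and sep: "\<And>f v. f \<in> C \<Longrightarrow> continuous_on {0..T} v \<Longrightarrow> v 0 = 0 \<Longrightarrow>
    \<forall>m. energy T m v \<le> 4 * a \<Longrightarrow> \<forall>t\<in>{0..T}. norm (noise f t - v t) \<le> \<delta> \<Longrightarrow> False"
    using closed_separation[OF C rate] by metis
  \<comment> \<open>The interpolation error is \<open>4 * d\<close>, which has to stay within
    \<delta>.\<close>
  define d where "d = \<delta> / 4"
  \<comment> \<open>The exponent supplied by \<open>energy_tail\<close> at the threshold
    \<open>4 * a / \<sigma>\<^sup>2\<close>; the oscillation event is given the same rate.\<close>
  define b where "b = 2 * ((1 - \<eta>) * a)"
  have d: "0 < d" and b: "0 < b" using \<delta> a \<eta> by (auto simp: d_def b_def)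
  obtain m where m: "4 * T * b \<le> d\<^sup>2 * 2 ^ m" using ex_dyadic_level[of "d\<^sup>2" "4 * T * b"] d by auto
  obtain B where B: "0 < B" "\<forall>\<^sub>F \<sigma> in at_right 0. emeasure M (oscillates \<sigma> d m) \<le> ennreal (B * exp (- b / \<sigma>\<^sup>2))"
    by (rule oscillates_le[OF d b m])
  let ?A = "((1 / sqrt \<eta>) ^ DIM('a)) ^ (2 ^ m)"
  have A: "0 < ?A" using \<eta> by simp
  have "\<forall>\<^sub>F \<sigma> in at_right 0. emeasure M {\<omega>\<in>space M. path \<sigma> \<omega> \<in> C} \<le> ennreal ((?A + B) * exp (- b / \<sigma>\<^sup>2))"
    using B(2) eventually_at_right_less[of "0::real"]
  proof eventually_elim
    case (elim \<sigma>)
    note [measurable] = brownian_motion_incr_measurable[OF W T]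
    let ?E = "{\<omega>\<in>space M. 4 * a / \<sigma>\<^sup>2 \<le> energy T m (\<lambda>t. W t \<omega>)}"
    have E [measurable]: "?E \<in> sets M" unfolding energy_def by measurable
    have "AE \<omega> in M. \<omega> \<in> {\<omega>\<in>space M. path \<sigma> \<omega> \<in> C} \<longrightarrow> \<omega> \<in> ?E \<union> oscillates \<sigma> d m"
      using AE_noise_path[OF elim(2)] AE_driving_noise AE_space
    proof eventually_elim
      case (elim \<omega>)
      show ?case
      proof (rule impI, rule ccontr)
        assume pC: "\<omega> \<in> {\<omega>\<in>space M. path \<sigma> \<omega> \<in> C}" and n: "\<omega> \<notin> ?E \<union> oscillates \<sigma> d m"
        let ?w = "\<lambda>t. \<sigma> *\<^sub>R W t \<omega>"
        let ?v = "\<lambda>t. LINT s:{0..t}|lborel. step T m ?w s"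
        have "energy T m (\<lambda>t. W t \<omega>) < 4 * a / \<sigma>\<^sup>2" using n elim(3) by auto
        then have "energy T m ?w \<le> 4 * a"
          using \<open>0 < \<sigma>\<close> by (simp add: energy_scaleR field_simps)
        then have en: "energy T k ?v \<le> 4 * a" for k
          using energy_interpolation_le[OF T, of k m ?w] by linarith
        have "?v 0 = 0" using LINT_step_grid[OF T, of 0 m ?w] by simp
        moreover have "norm (noise (path \<sigma> \<omega>) t - ?v t) \<le> \<delta>" if "t \<in> {0..T}" for t
          using interpolation_error_noise[of \<omega> \<sigma> d m t] n elim d that by (simp add: d_def)
        ultimately show False using sep[of "path \<sigma> \<omega>" ?v] pC en interpolation_continuous by blast
      qed
    qed
    then have "emeasure M {\<omega>\<in>space M. path \<sigma> \<omega> \<in> C} \<le> emeasure M (?E \<union> oscillates \<sigma> d m)"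
      by (intro emeasure_mono_AE) auto
    also have "\<dots> \<le> emeasure M ?E + emeasure M (oscillates \<sigma> d m)"
      by (intro emeasure_subadditive) auto
    also have "\<dots> \<le> ennreal (?A * exp (- b / \<sigma>\<^sup>2)) + ennreal (B * exp (- b / \<sigma>\<^sup>2))"
    proof (rule add_mono[OF _ elim(1)])
      have "(1 - \<eta>) / 2 * (4 * a / \<sigma>\<^sup>2) = b / \<sigma>\<^sup>2" by (simp add: b_def)
      then show "emeasure M ?E \<le> ennreal (?A * exp (- b / \<sigma>\<^sup>2))"
        using energy_tail[OF W T \<eta>, of "4 * a / \<sigma>\<^sup>2" m] by (simp only: minus_divide_left)
    qed
    also have "\<dots> = ennreal ((?A + B) * exp (- b / \<sigma>\<^sup>2))"
      using A B(1) by (subst ennreal_plus[symmetric]) (auto simp: distrib_right)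
    finally show ?case .
  qed
  then show ?thesis unfolding b_def using A B(1) by (intro exI[of _ "?A + B"]) auto
qed

section \<open>Lower bound for open sets\<close>

lemma sum_square_perturbation:
  fixes c :: "nat \<Rightarrow> real"
  assumes "(\<Sum>i<N. (c i)\<^sup>2 / h) < e"
  shows "\<forall>\<^sub>F \<rho> in at_right 0. (\<Sum>i<N. (c i + \<rho>)\<^sup>2 / h) < e"
proof -
  have "((\<lambda>\<rho>. \<Sum>i<N. (c i + \<rho>)\<^sup>2 / h) \<longlongrightarrow> (\<Sum>i<N. (c i + 0)\<^sup>2 / h)) (at_right 0)"
    unfolding divide_inverse by (intro tendsto_intros)
  then show ?thesis using assms by (intro order_tendstoD(2)) auto
qed

text \<open>If the grid increments of \<sigma> W are close to those of \<open>noise f\<close> and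
  \<sigma> W does not oscillate, then the two noises are close and, by the Lipschitz inverse, the
  diffusion is close to \<open>f\<close>. The first event has the right probability, and removing
  the second costs at most half of it.\<close>

lemma open_exponential_bound:
  assumes G: "openin (path_space T) G" and f: "f \<in> G" and rate: "rate_function V F T x f \<le> ennreal a"
    and a: "0 \<le> a" and \<epsilon>: "0 < \<epsilon>"
  shows "\<exists>A>0. \<forall>\<^sub>F \<sigma> in at_right 0. ennreal (A * exp (- (2 * (a + \<epsilon>)) / \<sigma>\<^sup>2)) \<le> emeasure M {\<omega>\<in>space M. path \<sigma> \<omega> \<in> G}"
proof -
  interpret prob_space M by (rule brownian_motion_prob_space[OF W])
  note [measurable] = brownian_motion_incr_measurable[OF W T]
  obtain r where r: "0 < r" and ball: "\<And>g. g \<in> paths T \<Longrightarrow> (\<forall>t\<in>{0..T}. dist (f t) (g t) \<le> r) \<Longrightarrow> g \<in> G"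
    using G f unfolding openin_path_space_iff[OF T] by metis
  have fp: "f \<in> paths T" using G f openin_subset by fastforce
  then have fc: "continuous_on {0..T} f" by (simp add: paths_def)
  define w where "w = noise f"
  have w: "continuous_on {0..T} w" unfolding w_def by (rule noise_continuous[OF fc])
  have f0: "f 0 = Pc x" and en: "\<And>k. energy T k w \<le> 4 * a"
    using rate rate_function_le_iff[OF fp a] by (auto simp: w_def)
  have w0: "w 0 = 0" using f0 by (simp add: w_def noise_0)
  \<comment> \<open>Inverse of the Lipschitz constant in \<open>diff_le_noise_diff\<close>, so that
    noises within \<delta> force paths within \<open>r\<close>.\<close>
  define \<delta> where "\<delta> = r / (2 * exp (2 * K * T))"
  have \<delta>: "0 < \<delta>" using r by (simp add: \<delta>_def)
  \<comment> \<open>Three errors occur: \<open>4 * d\<close> for each of the two interpolations and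
    \<open>d\<close> between them, in total \<open>9 * d\<close>, below \<delta>.\<close>
  define d where "d = \<delta> / 16"
  \<comment> \<open>The additional 1 makes oscillation less likely than the main event by a factor
    of order exp(-1/\<sigma>^2).\<close>
  define b where "b = 2 * (a + \<epsilon>) + 1"
  have d: "0 < d" and b: "0 < b" using \<delta> a \<epsilon> by (auto simp: d_def b_def)
  \<comment> \<open>One level controls the oscillation of the noise, the other the interpolation of
    the fixed path \<open>w\<close>; both conditions persist on finer grids.\<close>
  obtain m1 where m1: "4 * T * b \<le> d\<^sup>2 * 2 ^ m1" using ex_dyadic_level[of "d\<^sup>2" "4 * T * b"] d by auto
  obtain m2 where m2: "4 * a * T \<le> d\<^sup>2 * 2 ^ m2" using ex_dyadic_level[of "d\<^sup>2" "4 * a * T"] d by auto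
  define m where "m = max m1 m2"
  have "d\<^sup>2 * 2 ^ m1 \<le> d\<^sup>2 * 2 ^ m" "d\<^sup>2 * 2 ^ m2 \<le> d\<^sup>2 * 2 ^ m"
    unfolding m_def by (intro mult_left_mono power_increasing; simp)+
  with m1 m2 have m: "4 * T * b \<le> d\<^sup>2 * 2 ^ m" "4 * a * T \<le> d\<^sup>2 * 2 ^ m" by linarith+
  have interp_w: "norm (w t - (LINT s:{0..t}|lborel. step T m w s)) \<le> 4 * d" if t: "t \<in> {0..T}" for t
  proof -
    have "sqrt (4 * a * T / 2 ^ m) \<le> sqrt (d\<^sup>2)" using m(2) by (intro real_sqrt_le_mono) (simp add: field_simps)
    then have "sqrt (4 * a * T / 2 ^ m) \<le> d" using d by simp
    then show ?thesis using small_energy_interpolation[OF T w en t, of m] w0 by simp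
  qed
  obtain B where B: "0 < B" "\<forall>\<^sub>F \<sigma> in at_right 0. emeasure M (oscillates \<sigma> d m) \<le> ennreal (B * exp (- b / \<sigma>\<^sup>2))"
    by (rule oscillates_le[OF d b m(1)])
  let ?h = "T / 2 ^ m"
  \<comment> \<open>The slack \<epsilon> leaves room to enlarge every increment by a small \<rho>;
    the further requirement \<open>\<rho> < d / 2 ^ m\<close> keeps the two interpolations within
    \<open>d\<close>.\<close>
  have "(\<Sum>i<2 ^ m. (norm (incr T m w i))\<^sup>2 / ?h) < 4 * (a + \<epsilon>)"
    using en[of m] \<epsilon> unfolding energy_def by simp
  from sum_square_perturbation[OF this]
  have "\<forall>\<^sub>F \<rho> in at_right 0. (\<Sum>i<2 ^ m. (norm (incr T m w i) + \<rho>)\<^sup>2 / ?h) < 4 * (a + \<epsilon>)" .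
  moreover have "\<forall>\<^sub>F \<rho> in at_right 0. \<rho> < d / 2 ^ m"
    using d by (intro eventually_at_right_real[of 0 "d / 2 ^ m", THEN eventually_mono]) auto
  ultimately have "\<forall>\<^sub>F \<rho> in at_right 0. 0 < \<rho> \<and> \<rho> < d / 2 ^ m \<and> (\<Sum>i<2 ^ m. (norm (incr T m w i) + \<rho>)\<^sup>2 / ?h) < 4 * (a + \<epsilon>)"
    using eventually_at_right_less[of "0::real"] by eventually_elim simp
  then obtain \<rho> where \<rho>: "0 < \<rho>" "\<rho> < d / 2 ^ m" "(\<Sum>i<2 ^ m. (norm (incr T m w i) + \<rho>)\<^sup>2 / ?h) < 4 * (a + \<epsilon>)"
    using eventually_happens'[OF trivial_limit_at_right_real] by blast
  obtain c where c: "0 < c" and near: "\<forall>\<sigma>. 0 < \<sigma> \<longrightarrow> \<sigma> \<le> 1 \<longrightarrow>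
    c * exp (- ((\<Sum>i<2 ^ m. (norm (incr T m w i) + \<rho>)\<^sup>2 / ?h) / (2 * \<sigma>\<^sup>2)))
    \<le> measure M {\<omega>\<in>space M. \<forall>i<2 ^ m. norm (\<sigma> *\<^sub>R incr T m (\<lambda>t. W t \<omega>) i - incr T m w i) < \<rho>}"
    using all_incr_near_lower_bound[OF W T \<rho>(1), where m = m and a = "incr T m w"] by blast
  \<comment> \<open>Equivalent to B exp(-1/\<sigma>^2) \<le> c/2: oscillation then takes away at
    most half of the main term.\<close>
  have "\<forall>\<^sub>F \<sigma> in at_right 0. ln (2 * B / c) \<le> 1 / \<sigma>\<^sup>2" by (rule eventually_small_noise) simp
  moreover have "\<forall>\<^sub>F \<sigma> in at_right 0. \<sigma> < (1::real)"
    by (intro eventually_at_right_real[of 0 1, THEN eventually_mono]) auto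
  ultimately have "\<forall>\<^sub>F \<sigma> in at_right 0. ennreal (c / 2 * exp (- (2 * (a + \<epsilon>)) / \<sigma>\<^sup>2)) \<le> emeasure M {\<omega>\<in>space M. path \<sigma> \<omega> \<in> G}"
    using B(2) eventually_at_right_less[of "0::real"]
  proof eventually_elim
    case (elim \<sigma>)
    let ?N = "{\<omega>\<in>space M. \<forall>i<2 ^ m. norm (\<sigma> *\<^sub>R incr T m (\<lambda>t. W t \<omega>) i - incr T m w i) < \<rho>}"
    let ?e = "exp (- (2 * (a + \<epsilon>)) / \<sigma>\<^sup>2)" and ?Y = "{\<omega>\<in>space M. path \<sigma> \<omega> \<in> G}"
    have N [measurable]: "?N \<in> sets M" by measurable
    have Y [measurable]: "?Y \<in> sets M"
      using measurable_sets[OF path_measurable[OF elim(4)] openin_borel_of[OF G]]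
      by (simp add: vimage_def Int_def conj_commute)
    have "AE \<omega> in M. \<omega> \<in> ?N - oscillates \<sigma> d m \<longrightarrow> \<omega> \<in> ?Y"
      using AE_noise_path[OF elim(4)] AE_driving_noise AE_space
    proof eventually_elim
      case (elim \<omega>)
      show ?case
      proof
        assume n: "\<omega> \<in> ?N - oscillates \<sigma> d m"
        let ?w = "\<lambda>t. \<sigma> *\<^sub>R W t \<omega>"
        have pp: "path \<sigma> \<omega> \<in> paths T" using path_in_paths[OF \<open>0 < \<sigma>\<close> elim(3)] .
        then have pc: "continuous_on {0..T} (path \<sigma> \<omega>)" by (simp add: paths_def)
        have dn: "norm (noise f t - noise (path \<sigma> \<omega>) t) \<le> \<delta>" if t: "t \<in> {0..T}" for t
        proof -
          let ?I = "\<lambda>u. LINT s:{0..t}|lborel. step T m u s"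
          have 1: "norm (?w t - ?I ?w) \<le> 4 * d"
            using interpolation_error_noise[of \<omega> \<sigma> d m t] n elim d t by simp
          have 2: "norm (w t - ?I w) \<le> 4 * d" by (rule interp_w[OF t])
          have "norm (?I (\<lambda>s. ?w s - w s)) \<le> 2 ^ m * \<rho>"
          proof (rule norm_LINT_step_le[OF T _ _ t])
            show "norm (incr T m (\<lambda>s. ?w s - w s) i) \<le> \<rho>" if "i < 2 ^ m" for i
            proof -
              have "incr T m (\<lambda>s. ?w s - w s) i = \<sigma> *\<^sub>R incr T m (\<lambda>t. W t \<omega>) i - incr T m w i"
                by (simp add: incr_def algebra_simps)
              then show ?thesis using n that by (auto intro: less_imp_le)
            qed
          qed (use \<rho> in simp)
          also have "\<dots> \<le> d" using \<rho>(2) by (simp add: field_simps)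
          also have "?I (\<lambda>s. ?w s - w s) = ?I ?w - ?I w"
            unfolding step_diff[symmetric] by (rule set_integral_diff(2)) auto
          finally have 3: "norm (?I ?w - ?I w) \<le> d" .
          have "w t - ?w t = (w t - ?I w) - (?w t - ?I ?w) - (?I ?w - ?I w)" by simp
          moreover have "norm (p - q - r) \<le> norm p + norm q + norm r" for p q r :: 'a
            using norm_triangle_ineq4[of "p - q" r] norm_triangle_ineq4[of p q] by linarith
          ultimately have "norm (w t - ?w t) \<le> norm (w t - ?I w) + norm (?w t - ?I ?w) + norm (?I ?w - ?I w)"
            by (simp only:)
          with 1 2 3 d have "norm (w t - ?w t) \<le> \<delta>" by (simp add: d_def)
          then show ?thesis using elim(1) t by (simp add: w_def)
        qed
        have "path \<sigma> \<omega> \<in> G"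
        proof (rule ball[OF pp], rule ballI)
          fix t assume t: "t \<in> {0..T}"
          have "norm (f t - path \<sigma> \<omega> t) \<le> 2 * exp (2 * K * T) * \<delta>"
            by (rule diff_le_noise_diff[OF fc pc t dn])
          then show "dist (f t) (path \<sigma> \<omega> t) \<le> r" by (simp add: dist_norm \<delta>_def)
        qed
        then show "\<omega> \<in> ?Y" using elim(3) by simp
      qed
    qed
    then have "prob (?N - oscillates \<sigma> d m) \<le> prob ?Y" by (intro finite_measure_mono_AE) auto
    moreover have "prob ?N \<le> prob (?N - oscillates \<sigma> d m) + prob (oscillates \<sigma> d m)"
    proof -
      have "prob ?N \<le> prob ((?N - oscillates \<sigma> d m) \<union> oscillates \<sigma> d m)"
        by (intro finite_measure_mono) auto
      also have "\<dots> \<le> prob (?N - oscillates \<sigma> d m) + prob (oscillates \<sigma> d m)"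
        by (intro measure_Un_le) auto
      finally show ?thesis .
    qed
    moreover have "c * ?e \<le> prob ?N"
    proof -
      have "(\<Sum>i<2 ^ m. (norm (incr T m w i) + \<rho>)\<^sup>2 / ?h) / (2 * \<sigma>\<^sup>2) \<le> 4 * (a + \<epsilon>) / (2 * \<sigma>\<^sup>2)"
        using \<rho>(3) by (intro divide_right_mono) auto
      moreover have "- (2 * (a + \<epsilon>)) / \<sigma>\<^sup>2 = - (4 * (a + \<epsilon>) / (2 * \<sigma>\<^sup>2))"
        using elim(4) by (simp add: field_simps)
      ultimately have "?e \<le> exp (- ((\<Sum>i<2 ^ m. (norm (incr T m w i) + \<rho>)\<^sup>2 / ?h) / (2 * \<sigma>\<^sup>2)))"
        by (simp only: exp_le_cancel_iff neg_le_iff_le)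
      then have "c * ?e \<le> c * exp (- ((\<Sum>i<2 ^ m. (norm (incr T m w i) + \<rho>)\<^sup>2 / ?h) / (2 * \<sigma>\<^sup>2)))"
        using c by (intro mult_left_mono) auto
      also have "\<dots> \<le> prob ?N" using elim(2,4) by (intro near[rule_format]) auto
      finally show ?thesis .
    qed
    moreover have "prob (oscillates \<sigma> d m) \<le> c / 2 * ?e"
    proof -
      have "prob (oscillates \<sigma> d m) \<le> B * exp (- b / \<sigma>\<^sup>2)"
        using elim(3) B(1) unfolding emeasure_eq_measure by (subst (asm) ennreal_le_iff) auto
      also have "exp (- b / \<sigma>\<^sup>2) = exp (- (1 / \<sigma>\<^sup>2)) * ?e"
        unfolding mult_exp_exp b_def by (simp add: add_divide_distrib diff_divide_distrib)
      also have "exp (- (1 / \<sigma>\<^sup>2)) \<le> exp (- ln (2 * B / c))" using elim(1) by simp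
      also have "\<dots> = c / (2 * B)" using B(1) c by (simp add: exp_minus)
      finally have "prob (oscillates \<sigma> d m) \<le> B * (c / (2 * B) * ?e)" using B(1) by simp
      then show ?thesis using B(1) by simp
    qed
    ultimately have "c / 2 * ?e \<le> prob ?Y" by linarith
    then show ?case unfolding emeasure_eq_measure by (rule ennreal_leI)
  qed
  then show ?thesis using c by (intro exI[of _ "c / 2"]) auto
qed

section \<open>From exponential bounds to the large deviation principle\<close>

lemma sets_path_law: "sets (path_law T M (X \<sigma>)) = sets (borel_of (path_space T))"
  by (simp add: path_law_def)

definition log_prob :: "(real \<Rightarrow> 'a) set \<Rightarrow> real \<Rightarrow> ereal" where
  "log_prob A \<sigma> = ereal (\<sigma>\<^sup>2 / 2) * ln_ennreal (emeasure (path_law T M (X \<sigma>)) A)"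

text \<open>The exponential bound has rate \<open>(1 - \<eta>) * a\<close> for every \<eta> in (0,
  1); here \<eta> tends to 0, after the limit in \<sigma> has been taken.\<close>

lemma Limsup_log_prob_closed:
  assumes C: "closedin (path_space T) C" and rate: "\<And>f. f \<in> C \<Longrightarrow> \<not> rate_function V F T x f \<le> ennreal a"
    and a: "0 < a"
  shows "Limsup (at_right 0) (log_prob C) \<le> ereal (- a)"
proof -
  have bound: "Limsup (at_right 0) (log_prob C) \<le> ereal (- ((1 - \<eta>) * a))" if \<eta>: "0 < \<eta>" "\<eta> < 1" for \<eta>
  proof -
    obtain A where A: "0 < A" "\<forall>\<^sub>F \<sigma> in at_right 0.
        emeasure M {\<omega>\<in>space M. path \<sigma> \<omega> \<in> C} \<le> ennreal (A * exp (- (2 * ((1 - \<eta>) * a)) / \<sigma>\<^sup>2))"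
      using closed_exponential_bound[OF C rate a \<eta>] by blast
    from A(2) have "\<forall>\<^sub>F \<sigma> in at_right 0.
        emeasure (path_law T M (X \<sigma>)) C \<le> ennreal (A * exp (- (2 * ((1 - \<eta>) * a)) / \<sigma>\<^sup>2))"
      using eventually_at_right_less[of "0::real"]
      by eventually_elim (simp add: emeasure_path_law closedin_borel_of[OF C])
    from Limsup_log_le[OF A(1) this] show ?thesis by (simp only: log_prob_def[abs_def])
  qed
  have lim: "((\<lambda>\<eta>. ereal (- ((1 - \<eta>) * a))) \<longlongrightarrow> ereal (- ((1 - 0) * a))) (at_right 0)"
    by (intro tendsto_intros tendsto_ereal)
  have "\<forall>\<^sub>F \<eta> in at_right (0::real). \<eta> < 1"
    by (intro eventually_at_right_real[of 0 1, THEN eventually_mono]) auto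
  then have "\<forall>\<^sub>F \<eta> in at_right 0. Limsup (at_right 0) (log_prob C) \<le> ereal (- ((1 - \<eta>) * a))"
    using eventually_at_right_less[of "0::real"] by eventually_elim (rule bound)
  from tendsto_lowerbound[OF lim this] show ?thesis by simp
qed

text \<open>The bound with rate \<open>a + \<epsilon>\<close> holds for every positive \<epsilon>,
  and \<epsilon> tends to 0 after \<sigma>.\<close>

lemma Liminf_log_prob_open:
  assumes G: "openin (path_space T) G" and f: "f \<in> G" and rate: "rate_function V F T x f \<le> ennreal a"
    and a: "0 \<le> a"
  shows "ereal (- a) \<le> Liminf (at_right 0) (log_prob G)"
proof -
  interpret prob_space M by (rule brownian_motion_prob_space[OF W])
  have bound: "ereal (- (a + \<epsilon>)) \<le> Liminf (at_right 0) (log_prob G)" if \<epsilon>: "0 < \<epsilon>" for \<epsilon>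
  proof -
    obtain A where A: "0 < A" "\<forall>\<^sub>F \<sigma> in at_right 0.
        ennreal (A * exp (- (2 * (a + \<epsilon>)) / \<sigma>\<^sup>2)) \<le> emeasure M {\<omega>\<in>space M. path \<sigma> \<omega> \<in> G}"
      using open_exponential_bound[OF G f rate a \<epsilon>] by blast
    from A(2) have 1: "\<forall>\<^sub>F \<sigma> in at_right 0.
        ennreal (A * exp (- (2 * (a + \<epsilon>)) / \<sigma>\<^sup>2)) \<le> emeasure (path_law T M (X \<sigma>)) G"
      using eventually_at_right_less[of "0::real"]
      by eventually_elim (simp add: emeasure_path_law openin_borel_of[OF G])
    have 2: "\<forall>\<^sub>F \<sigma> in at_right 0. emeasure (path_law T M (X \<sigma>)) G \<noteq> \<infinity>"
      using eventually_at_right_less[of "0::real"]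
      by eventually_elim (simp add: emeasure_path_law openin_borel_of[OF G])
    from Liminf_log_ge[OF A(1) 1 2] show ?thesis by (simp only: log_prob_def[abs_def])
  qed
  have lim: "((\<lambda>\<epsilon>. ereal (- (a + \<epsilon>))) \<longlongrightarrow> ereal (- (a + 0))) (at_right 0)"
    by (intro tendsto_intros tendsto_ereal)
  have "\<forall>\<^sub>F \<epsilon> in at_right 0. ereal (- (a + \<epsilon>)) \<le> Liminf (at_right 0) (log_prob G)"
    using eventually_at_right_less[of "0::real"] by eventually_elim (rule bound)
  from tendsto_upperbound[OF lim this] show ?thesis by simp
qed

lemma log_prob_mono:
  assumes "A \<subseteq> B" "B \<in> sets (borel_of (path_space T))"
  shows "log_prob A \<sigma> \<le> log_prob B \<sigma>"
proof -
  have le: "emeasure (path_law T M (X \<sigma>)) A \<le> emeasure (path_law T M (X \<sigma>)) B"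
    using assms by (intro emeasure_mono) (simp_all add: sets_path_law)
  have "ln_ennreal p \<le> ln_ennreal q" if "p \<le> q" for p q
  proof (cases p; cases q)
    fix r s assume *: "p = ennreal r" "0 \<le> r" "q = ennreal s" "0 \<le> s"
    with that have "r \<le> s" by simp
    then show ?thesis using * by (auto simp: ln_ennreal_def)
  qed (use that in \<open>auto simp: ln_ennreal_def top_unique\<close>)
  then show ?thesis unfolding log_prob_def using le by (intro ereal_mult_left_mono) auto
qed

text \<open>Probabilities are at most 1. This makes the level chosen in the upper bound negative, so
  that its negative is a genuine nonnegative rate.\<close>

lemma Limsup_log_prob_le_0: "Limsup (at_right 0) (log_prob A) \<le> 0"
proof -
  interpret prob_space M by (rule brownian_motion_prob_space[OF W])
  have "\<forall>\<^sub>F \<sigma> in at_right 0. emeasure (path_law T M (X \<sigma>)) A \<le> ennreal (1 * exp (- (2 * 0) / \<sigma>\<^sup>2))"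
    using eventually_at_right_less[of "0::real"]
  proof eventually_elim
    case (elim \<sigma>)
    interpret P: prob_space "path_law T M (X \<sigma>)"
      using prob_space_distr[OF path_measurable[OF elim]] by (simp add: path_law_def path_def[abs_def])
    show ?case using P.emeasure_le_1[of A] by simp
  qed
  from Limsup_log_le[OF _ this] show ?thesis by (simp add: log_prob_def[abs_def] zero_ereal_def)
qed

text \<open>The set is compared with its interior and its closure. Arguing by contradiction with a
  real number strictly between the two sides treats finite and infinite infima alike, the infimum
  over the empty set included.\<close>

lemma large_deviation_principle:
  "LDP (path_space T) (\<lambda>\<sigma>. path_law T M (X \<sigma>)) (rate_function V F T x)"
  unfolding LDP_def
proof (intro conjI allI impI ballI)
  let ?B = "path_space T :: (real \<Rightarrow> 'a) topology" and ?I = "rate_function V F T x"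
  show "sets (path_law T M (X \<sigma>)) = sets (borel_of ?B)" for \<sigma>
    by (rule sets_path_law)
  show "good_rate_function ?B ?I" by (rule good_rate_function)
  fix \<Gamma> assume \<Gamma>: "\<Gamma> \<in> sets (borel_of ?B)"
  then have sub: "\<Gamma> \<subseteq> topspace ?B" using sets.sets_into_space by fastforce
  show "Liminf (at_right 0) (\<lambda>\<sigma>. ereal (\<sigma>\<^sup>2 / 2) * ln_ennreal (emeasure (path_law T M (X \<sigma>)) \<Gamma>))
      \<le> Limsup (at_right 0) (\<lambda>\<sigma>. ereal (\<sigma>\<^sup>2 / 2) * ln_ennreal (emeasure (path_law T M (X \<sigma>)) \<Gamma>))"
    by (rule Liminf_le_Limsup) simp
  let ?G = "?B interior_of \<Gamma>" and ?C = "?B closure_of \<Gamma>"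
  have "- enn2ereal (INF y\<in>?G. ?I y) \<le> Liminf (at_right 0) (log_prob \<Gamma>)"
  proof (rule ccontr)
    assume "\<not> ?thesis"
    then have "Liminf (at_right 0) (log_prob \<Gamma>) < - enn2ereal (INF y\<in>?G. ?I y)" by simp
    then obtain c where c: "Liminf (at_right 0) (log_prob \<Gamma>) < ereal c" "ereal c < - enn2ereal (INF y\<in>?G. ?I y)"
      using ereal_dense2 by blast
    have "enn2ereal (INF y\<in>?G. ?I y) < ereal (- c)"
      using c(2) unfolding ereal_less_uminus_reorder[of "ereal c"] by simp
    moreover have "0 \<le> enn2ereal (INF y\<in>?G. ?I y)" by simp
    ultimately have "0 < ereal (- c)" by (rule le_less_trans[rotated])
    \<comment> \<open>Nonnegativity of the rate makes \<open>- c\<close> positive, so that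
      \<open>ennreal (- c)\<close> is not truncated and can be compared with values of the rate
      function.\<close>
    then have c0: "0 \<le> - c" by simp
    then have "(INF y\<in>?G. ?I y) < ennreal (- c)"
      using \<open>enn2ereal (INF y\<in>?G. ?I y) < ereal (- c)\<close> by (simp add: less_ennreal.rep_eq enn2ereal_ennreal)
    then obtain f where f: "f \<in> ?G" "?I f < ennreal (- c)" unfolding INF_less_iff by blast
    have "ereal (- (- c)) \<le> Liminf (at_right 0) (log_prob ?G)"
      using f c0 by (intro Liminf_log_prob_open[of _ f]) auto
    also have "\<dots> \<le> Liminf (at_right 0) (log_prob \<Gamma>)"
      by (intro Liminf_mono always_eventually allI log_prob_mono \<Gamma> interior_of_subset)
    finally show False using c(1) by simp
  qed
  then show "- enn2ereal (INF y\<in>?G. ?I y)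
      \<le> Liminf (at_right 0) (\<lambda>\<sigma>. ereal (\<sigma>\<^sup>2 / 2) * ln_ennreal (emeasure (path_law T M (X \<sigma>)) \<Gamma>))"
    unfolding log_prob_def[abs_def] .
  have "Limsup (at_right 0) (log_prob \<Gamma>) \<le> - enn2ereal (INF y\<in>?C. ?I y)"
  proof (rule ccontr)
    assume "\<not> ?thesis"
    then have "- enn2ereal (INF y\<in>?C. ?I y) < Limsup (at_right 0) (log_prob \<Gamma>)" by simp
    then obtain c where c: "- enn2ereal (INF y\<in>?C. ?I y) < ereal c" "ereal c < Limsup (at_right 0) (log_prob \<Gamma>)"
      using ereal_dense2 by blast
    \<comment> \<open>Again this prevents truncation in \<open>ennreal (- c)\<close>; here the sign
      comes from the bound of probabilities by 1.\<close>
    have "ereal c < 0" using c(2) Limsup_log_prob_le_0[of \<Gamma>] by (rule less_le_trans)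
    then have c0: "0 < - c" by simp
    have "- ereal c < enn2ereal (INF y\<in>?C. ?I y)"
      using c(1) by (rule ereal_uminus_less_reorder[THEN iffD1])
    then have less: "ennreal (- c) < (INF y\<in>?C. ?I y)"
      using c0 by (simp add: less_ennreal.rep_eq enn2ereal_ennreal)
    have "Limsup (at_right 0) (log_prob \<Gamma>) \<le> Limsup (at_right 0) (log_prob ?C)"
      by (intro Limsup_mono always_eventually allI log_prob_mono closedin_borel_of closedin_closure_of
          closure_of_subset sub)
    also have "\<dots> \<le> ereal (- (- c))"
    proof (rule Limsup_log_prob_closed[OF closedin_closure_of _ c0])
      fix f assume "f \<in> ?C"
      then show "\<not> ?I f \<le> ennreal (- c)" using less_INF_D[OF less] by (simp add: not_le)
    qed
    finally show False using c(2) by simp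
  qed
  then show "Limsup (at_right 0) (\<lambda>\<sigma>. ereal (\<sigma>\<^sup>2 / 2) * ln_ennreal (emeasure (path_law T M (X \<sigma>)) \<Gamma>))
      \<le> - enn2ereal (INF y\<in>?C. ?I y)"
    unfolding log_prob_def[abs_def] .
qed

end

theorem theorem2p1:
  fixes V F :: "'a::euclidean_space \<Rightarrow> real"
    and T :: real
    and x :: "'a init"
    and M :: "'w measure"
    and W :: "real \<Rightarrow> 'w \<Rightarrow> 'a"
    and X :: "real \<Rightarrow> real \<Rightarrow> 'w \<Rightarrow> 'a"
  assumes "C2 V" and "C2 F"
    and "\<exists>L. L-lipschitz_on UNIV (grad V)" and "\<exists>L. L-lipschitz_on UNIV (grad F)"
    and "grad F 0 = 0" and "F 0 = 0"
    and "T > 0"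
    and "x \<in> XX"
    and "brownian_motion M W"
    and "\<And>\<sigma>. \<sigma> > 0 \<Longrightarrow> strong_solution V F x \<sigma> M W (X \<sigma>)"
  shows "LDP (path_space T) (\<lambda>\<sigma>. path_law T M (X \<sigma>)) (rate_function V F T x)"
proof -
  obtain LV where LV: "LV-lipschitz_on UNIV (grad V)" using assms(3) by blast
  obtain LF where LF: "LF-lipschitz_on UNIV (grad F)" using assms(4) by blast
  interpret self_interacting_noise V F x T LV LF M W X
    using assms LV LF by unfold_locales
  show ?thesis by (rule large_deviation_principle)
qed

end
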